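(* Let $H_n$ be the ensemble of random matrices of the long-range percolation model described in the context, let $G(z)=(H_n-zI)^{-1}$ with entries $G(i,j)$, and let $g_n(z)=\frac1N\operatorname{Tr}G(z)$, $b=b_n$. Suppose that $\mathbf{E}\{a(i,p)^{2l+1}\}=0$ for $l=0,1,2$, $$\mathbf{E}\{a(i,p)^2\}=v^2,\qquad \mathbf{E}\{a(i,p)^4\}=3v^4,\qquad \mathbf{E}\{a(i,p)^6\}=15v^6$$ for all $i,p$, and $$\hat\mu_{10}=\sup_{i,p}\mathbf{E}|a(i,p)|^{10}<\infty,\qquad \int_{\mathbb{R}}\sqrt{\psi(t)}\,dt<\infty.$$ Then, for all $z\in\Lambda_\eta=\{z\in\mathbb{C}:|\operatorname{Im}z|\ge\eta\}$ with $\eta=2v+1$, the estimates $$\sup_{|i|\le n}\left|\mathbf{E}\{g_n^0(z)\,G^0(i,i)\}\right|=O\!\left(\frac{1}{nb}+\frac1b\sqrt{\mathbf{Var}\{g_n(z)\}}\right)$$ and $$\mathbf{Var}\{g_n(z)\}=O\!\left(\frac{1}{b^2}\right)$$ hold for large enough $n$ and $b$, in the limit $n\to\infty$, $b\to\infty$, $b/n\to0$.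
   Context: Setting. Let $v>0$ and let $\{a(i,j): i\le j,\ i,j\in\mathbb{Z}\}$ be independent real random variables with $\mathbf{E}\{a(i,j)\}=0$ and $\mathbf{E}\{a(i,j)^2\}=v^2$ (with $a(j,i)=a(i,j)$). Let $\psi:\mathbb{R}\to[0,1]$ be a continuous even function, non-increasing on $[0,\infty)$ and vanishing at infinity, with $\int_{\mathbb{R}}\psi(t)\,dt=1$. Let $N=2n+1$ and let $b=b_n$ be a sequence of integers with $0<b_n\le N$, $b_n\to\infty$ and $b_n/n\to0$ as $n\to\infty$. For each $n$ let $\{d(i,j): -n\le i\le j\le n\}$ be independent Bernoulli random variables, independent of the family $\{a(i,j)\}$ and defined on the same probability space, with $d(i,j)=1$ with probability $\psi((i-j)/b_n)$ and $d(i,j)=0$ with probability $1-\psi((i-j)/b_n)$. Define the real symmetric $N\times N$ random matrix $H_n$, with rows and columns indexed by $\{-n,\dots,n\}$, by $H_n(i,j)=H_n(j,i)=b_n^{-1/2}a(i,j)d(i,j)$ for $i\le j$. For a complex random variable $\zeta$, $\zeta^0=\zeta-\mathbf{E}\zeta$ and $\mathbf{Var}\{\zeta\}=\mathbf{E}|\zeta^0|^2$; $G^0(i,i)=G(i,i)-\mathbf{E}G(i,i)$, evaluated at the same $z$. *)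

theory Defs
  imports
    "HOL-Probability.Probability"
    "HOL-Library.Landau_Symbols"
    "Jordan_Normal_Form.Gauss_Jordan_Elimination"
begin

definition upper_pairs :: "(int \<times> int) set" where
  "upper_pairs = {(i, j). i \<le> j}"

definition upper_pairs_upto :: "nat \<Rightarrow> (int \<times> int) set" where
  "upper_pairs_upto n = {(i, j). - int n \<le> i \<and> i \<le> j \<and> j \<le> int n}"

text \<open>
  The entries \<open>d n i j\<close> matter only for \<open>- int n \<le> i \<le> j \<le> int n\<close>; nothing is assumed
  about the joint law of \<open>d n\<close> and \<open>d m\<close> for distinct \<open>n\<close> and \<open>m\<close>. The integrability of
  \<open>a i j\<close> and of its square follows from the normalisation of the second moment, as \<open>v > 0\<close>.
\<close>

locale long_range_percolation = prob_space M
  for M :: "'w measure" +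
  fixes v :: real
    and a :: "int \<Rightarrow> int \<Rightarrow> 'w \<Rightarrow> real"
    and \<psi> :: "real \<Rightarrow> real"
    and b :: "nat \<Rightarrow> nat"
    and d :: "nat \<Rightarrow> int \<Rightarrow> int \<Rightarrow> 'w \<Rightarrow> real"
  assumes v_pos: "v > 0"
    and a_sym: "\<And>i j. a j i = a i j"
    and a_indep: "indep_vars (\<lambda>_. borel) (\<lambda>(i, j). a i j) upper_pairs"
    and a_mean: "\<And>i j. expectation (a i j) = 0"
    and a_second_moment: "\<And>i j. expectation (\<lambda>\<omega>. (a i j \<omega>)\<^sup>2) = v\<^sup>2"
    and \<psi>_range: "\<And>t. \<psi> t \<in> {0..1}"
    and \<psi>_cont: "continuous_on UNIV \<psi>"
    and \<psi>_even: "\<And>t. \<psi> (- t) = \<psi> t"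
    and \<psi>_noninc: "\<And>s t. 0 \<le> s \<Longrightarrow> s \<le> t \<Longrightarrow> \<psi> t \<le> \<psi> s"
    and \<psi>_vanishes: "(\<psi> \<longlongrightarrow> 0) at_infinity"
    and \<psi>_integral: "has_bochner_integral lborel \<psi> 1"
    and b_bounds: "\<And>n. 0 < b n \<and> b n \<le> 2 * n + 1"
    and b_at_top: "filterlim b at_top sequentially"
    and b_over_n: "(\<lambda>n. real (b n) / real n) \<longlonglongrightarrow> 0"
    and d_indep: "\<And>n. indep_vars (\<lambda>_. borel) (\<lambda>(i, j). d n i j) (upper_pairs_upto n)"
    and d_one: "\<And>n i j. (i, j) \<in> upper_pairs_upto n \<Longrightarrow>
      prob {\<omega> \<in> space M. d n i j \<omega> = 1} = \<psi> (real_of_int (i - j) / real (b n))"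
    and d_zero: "\<And>n i j. (i, j) \<in> upper_pairs_upto n \<Longrightarrow>
      prob {\<omega> \<in> space M. d n i j \<omega> = 0} = 1 - \<psi> (real_of_int (i - j) / real (b n))"
    and a_d_indep: "\<And>n. indep_var
      (PiM upper_pairs (\<lambda>_. borel)) (\<lambda>\<omega>. \<lambda>(i, j)\<in>upper_pairs. a i j \<omega>)
      (PiM (upper_pairs_upto n) (\<lambda>_. borel)) (\<lambda>\<omega>. \<lambda>(i, j)\<in>upper_pairs_upto n. d n i j \<omega>)"

definition perc_entry ::
  "(int \<Rightarrow> int \<Rightarrow> 'w \<Rightarrow> real) \<Rightarrow> (nat \<Rightarrow> nat) \<Rightarrow> (nat \<Rightarrow> int \<Rightarrow> int \<Rightarrow> 'w \<Rightarrow> real)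
    \<Rightarrow> nat \<Rightarrow> 'w \<Rightarrow> int \<Rightarrow> int \<Rightarrow> real" where
  "perc_entry a b d n \<omega> i j =
     (if i \<le> j then a i j \<omega> * d n i j \<omega> / sqrt (real (b n))
      else a j i \<omega> * d n j i \<omega> / sqrt (real (b n)))"

text \<open>
  Matrices in the library are indexed from \<open>0\<close>, so row and column \<open>k\<close> stand for the index
  \<open>int k - int n\<close> in \<open>{- int n..int n}\<close>.
\<close>

definition perc_mat ::
  "(int \<Rightarrow> int \<Rightarrow> 'w \<Rightarrow> real) \<Rightarrow> (nat \<Rightarrow> nat) \<Rightarrow> (nat \<Rightarrow> int \<Rightarrow> int \<Rightarrow> 'w \<Rightarrow> real)
    \<Rightarrow> nat \<Rightarrow> 'w \<Rightarrow> complex mat" where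
  "perc_mat a b d n \<omega> = mat (2 * n + 1) (2 * n + 1)
     (\<lambda>(k, l). complex_of_real (perc_entry a b d n \<omega> (int k - int n) (int l - int n)))"

definition resolvent :: "complex mat \<Rightarrow> complex \<Rightarrow> complex mat" where
  "resolvent A z = the (mat_inverse (A - z \<cdot>\<^sub>m 1\<^sub>m (dim_row A)))"

definition perc_G ::
  "(int \<Rightarrow> int \<Rightarrow> 'w \<Rightarrow> real) \<Rightarrow> (nat \<Rightarrow> nat) \<Rightarrow> (nat \<Rightarrow> int \<Rightarrow> int \<Rightarrow> 'w \<Rightarrow> real)
    \<Rightarrow> nat \<Rightarrow> complex \<Rightarrow> int \<Rightarrow> int \<Rightarrow> 'w \<Rightarrow> complex" where
  "perc_G a b d n z i j \<omega> =
     resolvent (perc_mat a b d n \<omega>) z $$ (nat (i + int n), nat (j + int n))"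

definition perc_g ::
  "(int \<Rightarrow> int \<Rightarrow> 'w \<Rightarrow> real) \<Rightarrow> (nat \<Rightarrow> nat) \<Rightarrow> (nat \<Rightarrow> int \<Rightarrow> int \<Rightarrow> 'w \<Rightarrow> real)
    \<Rightarrow> nat \<Rightarrow> complex \<Rightarrow> 'w \<Rightarrow> complex" where
  "perc_g a b d n z \<omega> =
     (\<Sum>i = - int n..int n. perc_G a b d n z i i \<omega>) / of_nat (2 * n + 1)"

definition centred :: "'w measure \<Rightarrow> ('w \<Rightarrow> complex) \<Rightarrow> 'w \<Rightarrow> complex" where
  "centred M \<zeta> \<omega> = \<zeta> \<omega> - integral\<^sup>L M \<zeta>"

definition cvariance :: "'w measure \<Rightarrow> ('w \<Rightarrow> complex) \<Rightarrow> real" where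
  "cvariance M \<zeta> = (\<integral>\<omega>. (cmod (centred M \<zeta> \<omega>))\<^sup>2 \<partial>M)"

end

theory Submission
  imports Defs "Jordan_Normal_Form.Determinant"
begin

text \<open>
  Write $y = |\mathrm{Im}\,z|$, $b = b_n$, $N = 2n+1$, and let $U_i = b^{-1}\sum_p \psi((i-p)/b)\,G(p,p)$ be
  the local trace of the resolvent seen from the site $i$; $\zeta^0$ denotes a centred variable.

  The engine is a self-consistent equation. Let $\Xi$ be a centred weighted trace
  $\sum_r w_r G(r,r)$ with $|w_r| \le 1$, or its complex conjugate. Expanding the row $i$ of
  $(H-z)G = 1$ gives $z\,E\{\Xi G(i,i)\} = \sum_p E\{H(i,p)\,\Xi\,G(i,p)\}$. In the summand of index $p$,
  expand $\Xi\,G(i,p)$ in powers of the single entry $h = H(i,p)$ around the matrix in which this entry is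
  set to zero. The coefficients depend on the other entries only, so they are independent of $h$. As
  $E h = E h^3 = 0$, only the term with $E h^2 = v^2\psi/b$ survives, up to an error of order
  $E h^4 = O(\psi/b^2)$; replacing the frozen coefficients by the true ones costs the same order, since the term
  linear in $h$ averages out once more. The term $-G(i,i)G(p,p)$ of the derivative of $G(i,p)$ yields the local
  trace; the other ones contain two off-diagonal factors with index $p$, and their sum over $p$ is bounded,
  because rows of $G$ have bounded $\ell^2$ norm. Hence (lemma \<open>self_consistency\<close>)
  $$z\,E\{\Xi G(i,i)\} = -v^2\,E\{\Xi\,G(i,i)\,U_i\} + O\big((1+E|\Xi|)/b\big).$$
  The expansion is carried out algebraically, by iterating the resolvent identity for a change of one entry
  (\<open>edge_resolvent_identity\<close>); one entry is averaged in \<open>edge_estimate\<close>.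

  Centring all factors in $E\{\Xi\,G(i,i)\,U_i\}$ leaves two terms that are linear in the numbers
  $E\{\Xi G(p,p)\}$, each with total weight at most $(1+1/b)/y$, and $E\{\Xi\,G^0(i,i)\,U_i^0\}$
  (\<open>covariance_bound\<close>). Taken for $\Xi = b\,\overline{U_j^0}$ with the site $j$ of largest variance, the last term
  is at most $(2/y)\,b\,\mathbf{Var}\{U_j\}$. Together the three terms carry the factor $4v^2(1+1/b)/y^2$, which is below
  $1$ for $b \ge v$ because $4v^2 + 4v < (2v+1)^2 \le y^2$. The resulting quadratic inequality gives $\mathbf{Var}\{U_j\} = O(1/b^2)$
  (\<open>local_trace_variance\<close>).

  With this, the same inequality for $\Xi = N g_n^0$ bounds $E\{g_n^0G^0(i,i)\}$ by
  $O(1/(Nb) + b^{-1}\sqrt{\mathbf{Var}\{g_n\}})$, and for $\Xi = N\overline{g_n^0}$, averaged over $i$, it gives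
  $\mathbf{Var}\{g_n\} = O(1/b^2)$ because $b \le N$
  (\<open>trace_covariance_g\<close>, \<open>trace_variance_g\<close>). All constants depend on $v$ and $z$ only.
\<close>

section \<open>Resolvents of real symmetric matrices and rank-two changes\<close>

text \<open>
  Matrices are functions on a finite index set, which allows the indices $-n,\dots,n$ of the model. The two
  clauses say that the matrix is a right and a left inverse of $A - z$; the resolvent identity needs one for
  each of the two matrices in it.
\<close>

definition resolvent_of ::
  "'i set \<Rightarrow> ('i \<Rightarrow> 'i \<Rightarrow> real) \<Rightarrow> complex \<Rightarrow> ('i \<Rightarrow> 'i \<Rightarrow> complex) \<Rightarrow> bool" where
  "resolvent_of I A z G \<longleftrightarrow> (\<forall>i\<in>I. \<forall>j\<in>I.
     (\<Sum>k\<in>I. of_real (A i k) * G k j) - z * G i j = (if i = j then 1 else 0) \<and>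
     (\<Sum>k\<in>I. G i k * of_real (A k j)) - z * G i j = (if i = j then 1 else 0))"

lemma resolvent_identity:
  assumes fin: "finite I" and G: "resolvent_of I A z G" and F: "resolvent_of I B z F"
    and ij: "i \<in> I" "j \<in> I"
  shows "G i j = F i j + (\<Sum>k\<in>I. \<Sum>l\<in>I. G i k * of_real (B k l - A k l) * F l j)"
proof -
  have "(\<Sum>k\<in>I. \<Sum>l\<in>I. G i k * of_real (B k l) * F l j)
      = (\<Sum>k\<in>I. G i k * (\<Sum>l\<in>I. of_real (B k l) * F l j))"
    by (simp add: sum_distrib_left mult.assoc)
  also have "\<dots> = (\<Sum>k\<in>I. G i k * (z * F k j + (if k = j then 1 else 0)))"
    using F ij by (intro sum.cong refl) (auto simp: resolvent_of_def diff_eq_eq add.commute)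
  also have "\<dots> = (\<Sum>k\<in>I. z * (G i k * F k j)) + G i j"
    using ij fin by (simp add: distrib_left sum.distrib if_distrib[of "\<lambda>x. _ * x"] mult_ac cong: if_cong)
  finally have 1: "(\<Sum>k\<in>I. \<Sum>l\<in>I. G i k * of_real (B k l) * F l j)
      = (\<Sum>k\<in>I. z * (G i k * F k j)) + G i j" .
  have "(\<Sum>k\<in>I. \<Sum>l\<in>I. G i k * of_real (A k l) * F l j)
      = (\<Sum>l\<in>I. (\<Sum>k\<in>I. G i k * of_real (A k l)) * F l j)"
    by (subst sum.swap) (simp add: sum_distrib_right)
  also have "\<dots> = (\<Sum>l\<in>I. (z * G i l + (if i = l then 1 else 0)) * F l j)"
    using G ij by (intro sum.cong refl) (auto simp: resolvent_of_def diff_eq_eq add.commute)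
  also have "\<dots> = (\<Sum>k\<in>I. z * (G i k * F k j)) + F i j"
    using ij fin by (simp add: distrib_right sum.distrib algebra_simps if_distrib[of "\<lambda>x. _ * x"] cong: if_cong)
  finally have 2: "(\<Sum>k\<in>I. \<Sum>l\<in>I. G i k * of_real (A k l) * F l j)
      = (\<Sum>k\<in>I. z * (G i k * F k j)) + F i j" .
  have "(\<Sum>k\<in>I. \<Sum>l\<in>I. G i k * of_real (B k l - A k l) * F l j)
     = (\<Sum>k\<in>I. \<Sum>l\<in>I. G i k * of_real (B k l) * F l j) - (\<Sum>k\<in>I. \<Sum>l\<in>I. G i k * of_real (A k l) * F l j)"
    by (simp add: sum_subtractf algebra_simps)
  thus ?thesis using 1 2 by simp
qed

text \<open>
  The transpose is a resolvent of the same matrix, and the resolvent identity for equal matrices is uniqueness.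
\<close>

lemma resolvent_symmetric:
  assumes fin: "finite I" and sym: "\<And>i j. A i j = A j i" and G: "resolvent_of I A z G"
    and ij: "i \<in> I" "j \<in> I"
  shows "G i j = G j i"
proof -
  have "resolvent_of I A z (\<lambda>i j. G j i)"
    using G unfolding resolvent_of_def by (auto simp: mult.commute sym[of _ i for i] intro: sym)
  from resolvent_identity[OF fin G this ij] show ?thesis by simp
qed

text \<open>
  The quadratic form of a real symmetric matrix is real, so that the imaginary part of
  $\langle y, (A-z)y\rangle$ is $-\mathrm{Im}\,z\,\|y\|^2$; the Cauchy--Schwarz inequality bounds it by $\|y\|\,\|x\|$.
\<close>

lemma shifted_symmetric_lower_bound:
  fixes x y :: "'i \<Rightarrow> complex"
  assumes sym: "\<And>i j. A i j = A j i"
    and eq: "\<And>i. i \<in> I \<Longrightarrow> (\<Sum>k\<in>I. of_real (A i k) * y k) - z * y i = x i"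
  shows "\<bar>Im z\<bar> * L2_set (\<lambda>i. cmod (y i)) I \<le> L2_set (\<lambda>i. cmod (x i)) I"
proof -
  let ?Y = "L2_set (\<lambda>i. cmod (y i)) I" and ?X = "L2_set (\<lambda>i. cmod (x i)) I"
  define Q where "Q = (\<Sum>i\<in>I. \<Sum>k\<in>I. cnj (y i) * (of_real (A i k) * y k))"
  have "cnj Q = (\<Sum>i\<in>I. \<Sum>k\<in>I. cnj (y k) * (of_real (A k i) * y i))"
    unfolding Q_def by (simp add: mult_ac sym)
  also have "\<dots> = Q" unfolding Q_def by (subst sum.swap) simp
  finally have ImQ: "Im Q = 0" by (metis Reals_cnj_iff complex_is_Real_iff)
  have "(\<Sum>i\<in>I. cnj (y i) * x i) = (\<Sum>i\<in>I. cnj (y i) * ((\<Sum>k\<in>I. of_real (A i k) * y k) - z * y i))"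
    using eq by simp
  also have "\<dots> = Q - z * (\<Sum>i\<in>I. cnj (y i) * y i)"
    unfolding Q_def by (simp add: right_diff_distrib sum_subtractf sum_distrib_left mult_ac)
  also have "(\<Sum>i\<in>I. cnj (y i) * y i) = of_real (?Y\<^sup>2)"
    by (simp add: L2_set_def sum_nonneg complex_norm_square[symmetric] mult.commute)
  finally have "Im (\<Sum>i\<in>I. cnj (y i) * x i) = - (Im z * ?Y\<^sup>2)"
    using ImQ by simp
  hence "\<bar>Im z\<bar> * ?Y\<^sup>2 \<le> cmod (\<Sum>i\<in>I. cnj (y i) * x i)"
    using abs_Im_le_cmod[of "\<Sum>i\<in>I. cnj (y i) * x i"] by (simp add: abs_mult)
  also have "\<dots> \<le> (\<Sum>i\<in>I. \<bar>cmod (y i)\<bar> * \<bar>cmod (x i)\<bar>)"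
    by (rule order.trans[OF norm_sum]) (simp add: norm_mult)
  also have "\<dots> \<le> ?Y * ?X" by (rule L2_set_mult_ineq)
  finally have *: "?Y * (\<bar>Im z\<bar> * ?Y) \<le> ?Y * ?X" by (simp add: power2_eq_square mult_ac)
  show ?thesis
  proof (cases "?Y = 0")
    case False
    hence "?Y > 0" using L2_set_nonneg[of "\<lambda>i. cmod (y i)" I] by linarith
    with * show ?thesis by simp
  qed (simp add: L2_set_nonneg)
qed

lemma resolvent_contraction:
  fixes x :: "'i \<Rightarrow> complex"
  assumes fin: "finite I" and sym: "\<And>i j. A i j = A j i" and G: "resolvent_of I A z G"
  shows "\<bar>Im z\<bar> * L2_set (\<lambda>i. cmod (\<Sum>j\<in>I. G i j * x j)) I \<le> L2_set (\<lambda>i. cmod (x i)) I"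
proof (rule shifted_symmetric_lower_bound[OF sym])
  fix i assume i: "i \<in> I"
  have "(\<Sum>k\<in>I. of_real (A i k) * (\<Sum>j\<in>I. G k j * x j)) - z * (\<Sum>j\<in>I. G i j * x j)
      = (\<Sum>j\<in>I. ((\<Sum>k\<in>I. of_real (A i k) * G k j) - z * G i j) * x j)"
    unfolding sum_distrib_left sum_distrib_right left_diff_distrib sum_subtractf
    by (subst sum.swap) (simp add: mult_ac)
  also have "\<dots> = (\<Sum>j\<in>I. (if i = j then 1 else 0) * x j)"
    using G i by (intro sum.cong refl) (auto simp: resolvent_of_def)
  also have "\<dots> = x i" using i fin by (simp add: if_distrib[of "\<lambda>x. x * _"] cong: if_cong)
  finally show "(\<Sum>k\<in>I. of_real (A i k) * (\<Sum>j\<in>I. G k j * x j)) - z * (\<Sum>j\<in>I. G i j * x j) = x i" .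
qed

text \<open>
  A substitute for a bound on the operator norm that controls entries and weighted traces and is stable under
  the products with matrix units below.
\<close>

definition rows_cols_bounded :: "'i set \<Rightarrow> real \<Rightarrow> ('i \<Rightarrow> 'i \<Rightarrow> complex) \<Rightarrow> bool" where
  "rows_cols_bounded I c A \<longleftrightarrow>
     (\<forall>k\<in>I. L2_set (\<lambda>l. cmod (A k l)) I \<le> c \<and> L2_set (\<lambda>l. cmod (A l k)) I \<le> c)"

lemma rows_cols_bounded_entry:
  assumes "finite I" "rows_cols_bounded I c A" "k \<in> I" "l \<in> I"
  shows "cmod (A k l) \<le> c"
  using member_le_L2_set[of I l "\<lambda>l. cmod (A k l)"] assms
  by (force simp: rows_cols_bounded_def)

lemma resolvent_rows_cols_bounded:
  assumes fin: "finite I" and sym: "\<And>i j. A i j = A j i" and G: "resolvent_of I A z G"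
    and c: "0 \<le> c" "1 \<le> c * \<bar>Im z\<bar>"
  shows "rows_cols_bounded I c G"
proof -
  have col: "L2_set (\<lambda>l. cmod (G l k)) I \<le> c" if k: "k \<in> I" for k
  proof -
    define Y where "Y = L2_set (\<lambda>l. cmod (G l k)) I"
    have "\<bar>Im z\<bar> * Y \<le> L2_set (\<lambda>i. cmod (if i = k then 1 else 0)) I"
      using resolvent_contraction[OF fin sym G, of "\<lambda>i. if i = k then 1 else 0"] k fin
      by (simp add: if_distrib[of "\<lambda>x. _ * x"] Y_def cong: if_cong)
    also have "\<dots> = 1" using k fin by (simp add: L2_set_def if_distrib[of cmod] if_distrib[of "\<lambda>x. x^2"] cong: if_cong)
    finally have "\<bar>Im z\<bar> * Y \<le> 1" .
    hence "c * (\<bar>Im z\<bar> * Y) \<le> c" using mult_left_mono[OF _ c(1), of "\<bar>Im z\<bar> * Y" 1] by simp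
    moreover have "1 * Y \<le> c * \<bar>Im z\<bar> * Y" using c by (intro mult_right_mono) (simp_all add: Y_def L2_set_nonneg)
    ultimately show ?thesis unfolding Y_def by (simp add: mult.assoc)
  qed
  moreover have "L2_set (\<lambda>l. cmod (G k l)) I \<le> c" if k: "k \<in> I" for k
  proof -
    have "L2_set (\<lambda>l. cmod (G k l)) I = L2_set (\<lambda>l. cmod (G l k)) I"
      using k by (intro L2_set_cong) (auto simp: resolvent_symmetric[OF fin sym G])
    thus ?thesis using col[OF k] by simp
  qed
  ultimately show ?thesis unfolding rows_cols_bounded_def by simp
qed

text \<open>
  The matrix product $A V B$, where $V$ has the entry $1$ at $(p,q)$ and at $(q,p)$ and $0$ elsewhere. On the
  diagonal, $p = q$, there is only one such position.
\<close>

definition sandwich ::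
  "'i \<Rightarrow> 'i \<Rightarrow> ('i \<Rightarrow> 'i \<Rightarrow> complex) \<Rightarrow> ('i \<Rightarrow> 'i \<Rightarrow> complex) \<Rightarrow> 'i \<Rightarrow> 'i \<Rightarrow> complex" where
  "sandwich p q A B k l = A k p * B q l + (if p = q then 0 else A k q * B p l)"

lemma rows_cols_bounded_sandwich:
  assumes fin: "finite I" and A: "rows_cols_bounded I c A" and B: "rows_cols_bounded I d B"
    and pq: "p \<in> I" "q \<in> I"
  shows "rows_cols_bounded I (2 * (c * d)) (sandwich p q A B)"
proof -
    have pw: "cmod (sandwich p q A B k l) \<le> cmod (A k p) * cmod (B q l) + cmod (A k q) * cmod (B p l)" for k l
    unfolding sandwich_def by (rule order.trans[OF norm_triangle_ineq]) (simp add: norm_mult)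
  have one: "L2_set (\<lambda>l. u * f l + v * g l) I \<le> 2 * (m * n)"
    if "0 \<le> u" "u \<le> m" "0 \<le> v" "v \<le> m" "L2_set f I \<le> n" "L2_set g I \<le> n" for u v m n and f g :: "'a \<Rightarrow> real"
  proof -
    have "L2_set (\<lambda>l. u * f l + v * g l) I \<le> L2_set (\<lambda>l. u * f l) I + L2_set (\<lambda>l. v * g l) I"
      by (rule L2_set_triangle_ineq)
    also have "\<dots> = u * L2_set f I + v * L2_set g I"
      using that by (simp add: L2_set_right_distrib)
    also have "\<dots> \<le> m * n + m * n"
      using that by (intro add_mono mult_mono) (auto simp: L2_set_nonneg)
    finally show ?thesis by simp
  qed
  have "L2_set (\<lambda>l. cmod (sandwich p q A B k l)) I \<le> 2 * (c * d)" if k: "k \<in> I" for k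
  proof -
    have "L2_set (\<lambda>l. cmod (sandwich p q A B k l)) I
      \<le> L2_set (\<lambda>l. cmod (A k p) * cmod (B q l) + cmod (A k q) * cmod (B p l)) I"
      by (intro L2_set_mono pw) auto
    also have "\<dots> \<le> 2 * (c * d)"
      using B pq k by (intro one rows_cols_bounded_entry[OF fin A]) (auto simp: rows_cols_bounded_def)
    finally show ?thesis .
  qed
  moreover have "L2_set (\<lambda>l. cmod (sandwich p q A B l k)) I \<le> 2 * (c * d)" if k: "k \<in> I" for k
  proof -
    have "L2_set (\<lambda>l. cmod (sandwich p q A B l k)) I
      \<le> L2_set (\<lambda>l. cmod (B q k) * cmod (A l p) + cmod (B p k) * cmod (A l q)) I"
      using pw by (intro L2_set_mono) (auto simp: mult.commute)
    also have "\<dots> \<le> 2 * (d * c)"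
      using A pq k by (intro one rows_cols_bounded_entry[OF fin B]) (auto simp: rows_cols_bounded_def)
    finally show ?thesis by (simp add: mult.commute)
  qed
  ultimately show ?thesis unfolding rows_cols_bounded_def by simp
qed

text \<open>
  The weights only shrink the terms, so that this is the Cauchy--Schwarz inequality.
\<close>

lemma weighted_pairing_bound:
  fixes w :: "'i \<Rightarrow> real"
  assumes "\<And>r. r \<in> I \<Longrightarrow> \<bar>w r\<bar> \<le> 1"
    and "L2_set (\<lambda>r. cmod (a r)) I \<le> c" and "L2_set (\<lambda>r. cmod (b r)) I \<le> d"
  shows "cmod (\<Sum>r\<in>I. of_real (w r) * (a r * b r)) \<le> c * d"
proof -
  have "cmod (\<Sum>r\<in>I. of_real (w r) * (a r * b r)) \<le> (\<Sum>r\<in>I. \<bar>cmod (a r)\<bar> * \<bar>cmod (b r)\<bar>)"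
    by (rule sum_norm_le) (use assms in \<open>auto simp: norm_mult intro!: mult_left_le_one_le\<close>)
  also have "\<dots> \<le> L2_set (\<lambda>r. cmod (a r)) I * L2_set (\<lambda>r. cmod (b r)) I" by (rule L2_set_mult_ineq)
  also have "\<dots> \<le> c * d"
    using assms(2,3) L2_set_nonneg by (intro mult_mono) (auto intro: order.trans[OF L2_set_nonneg])
  finally show ?thesis .
qed

definition wtrace :: "'i set \<Rightarrow> ('i \<Rightarrow> real) \<Rightarrow> ('i \<Rightarrow> 'i \<Rightarrow> complex) \<Rightarrow> complex" where
  "wtrace I w A = (\<Sum>r\<in>I. of_real (w r) * A r r)"

lemma wtrace_sandwich_bound:
  assumes w: "\<And>r. r \<in> I \<Longrightarrow> \<bar>w r\<bar> \<le> 1"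
    and A: "rows_cols_bounded I c A" and B: "rows_cols_bounded I d B"
    and pq: "p \<in> I" "q \<in> I"
  shows "cmod (wtrace I w (sandwich p q A B)) \<le> 2 * (c * d)"
proof -
  have "wtrace I w (sandwich p q A B) = (\<Sum>r\<in>I. of_real (w r) * (A r p * B q r))
     + (if p = q then 0 else (\<Sum>r\<in>I. of_real (w r) * (A r q * B p r)))"
    by (simp add: wtrace_def sandwich_def distrib_left sum.distrib)
  also have "cmod \<dots> \<le> c * d + c * d"
  proof (rule norm_triangle_mono)
    show 1: "cmod (\<Sum>r\<in>I. of_real (w r) * (A r p * B q r)) \<le> c * d"
      using A B pq by (intro weighted_pairing_bound w) (auto simp: rows_cols_bounded_def)
    have 2: "cmod (\<Sum>r\<in>I. of_real (w r) * (A r q * B p r)) \<le> c * d"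
      using A B pq by (intro weighted_pairing_bound w) (auto simp: rows_cols_bounded_def)
    show "cmod (if p = q then 0 else (\<Sum>r\<in>I. of_real (w r) * (A r q * B p r))) \<le> c * d"
      using 2 order.trans[OF norm_ge_zero 2] by simp
  qed
  finally show ?thesis by simp
qed

text \<open>
  A Taylor expansion of order two in the real increment $h$, with a remainder estimate at each order. Nothing
  is required of the value $f_0$ at $h = 0$: it will be a centred trace, whose size is unknown. The coefficients will be
  quantities that do not involve the entry $h$.
\<close>

definition jet :: "real \<Rightarrow> real \<Rightarrow> complex \<Rightarrow> complex \<Rightarrow> complex \<Rightarrow> complex \<Rightarrow> bool" where
  "jet K h f f0 f1 f2 \<longleftrightarrow> cmod f1 \<le> K \<and> cmod f2 \<le> K
     \<and> cmod (f - f0) \<le> K * \<bar>h\<bar>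
     \<and> cmod (f - f0 - of_real h * f1) \<le> K * h\<^sup>2
     \<and> cmod (f - f0 - of_real h * f1 - of_real (h\<^sup>2) * f2) \<le> K * \<bar>h\<bar> ^ 3"

text \<open>
  An entry of a symmetric matrix and its mirror image change together.
\<close>

definition differ_by_edge ::
  "'i set \<Rightarrow> 'i \<Rightarrow> 'i \<Rightarrow> real \<Rightarrow> ('i \<Rightarrow> 'i \<Rightarrow> real) \<Rightarrow> ('i \<Rightarrow> 'i \<Rightarrow> real) \<Rightarrow> bool" where
  "differ_by_edge I p q h A A\<^sub>0 \<longleftrightarrow> (\<forall>k\<in>I. \<forall>l\<in>I.
     A k l - A\<^sub>0 k l = (if k = p \<and> l = q \<or> k = q \<and> l = p then h else 0))"

lemma edge_resolvent_identity:
  assumes fin: "finite I" and G: "resolvent_of I A z G" and G0: "resolvent_of I A\<^sub>0 z G\<^sub>0"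
    and d: "differ_by_edge I p q h A A\<^sub>0" and pq: "p \<in> I" "q \<in> I" and kl: "k \<in> I" "l \<in> I"
  shows "G k l = G\<^sub>0 k l - of_real h * sandwich p q G G\<^sub>0 k l"
proof -
  have "(\<Sum>m\<in>I. \<Sum>n\<in>I. G k m * of_real (A\<^sub>0 m n - A m n) * G\<^sub>0 n l)
      = (\<Sum>m\<in>I. \<Sum>n\<in>I. (if m = p then (if n = q then - (of_real h * (G k m * G\<^sub>0 n l)) else 0) else 0)
          + (if p = q then 0 else if m = q then (if n = p then - (of_real h * (G k m * G\<^sub>0 n l)) else 0) else 0))"
    (is "?L = ?R")
  proof (intro sum.cong refl)
    fix m n assume "m \<in> I" "n \<in> I"
    hence "A\<^sub>0 m n - A m n = (if m = p \<and> n = q \<or> m = q \<and> n = p then - h else 0)"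
      using d unfolding differ_by_edge_def by (smt (verit))
    thus "G k m * of_real (A\<^sub>0 m n - A m n) * G\<^sub>0 n l = (if m = p then (if n = q then - (of_real h * (G k m * G\<^sub>0 n l)) else 0) else 0)
          + (if p = q then 0 else if m = q then (if n = p then - (of_real h * (G k m * G\<^sub>0 n l)) else 0) else 0)"
      by auto
  qed
  also have "?R = - (of_real h * sandwich p q G G\<^sub>0 k l)"
    using fin pq by (auto simp: sum.distrib sandwich_def algebra_simps sum.If_cases if_distrib[of "sum _"] cong: if_cong)
  finally show ?thesis using resolvent_identity[OF fin G G0 kl] by simp
qed

lemma sandwich_shift:
  assumes "\<And>k. k \<in> I \<Longrightarrow> A k p = B k p - c * C k p" "\<And>k. k \<in> I \<Longrightarrow> A k q = B k q - c * C k q" "k \<in> I"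
  shows "sandwich p q A D k l = sandwich p q B D k l - c * sandwich p q C D k l"
proof -
  have "A k p = B k p - c * C k p" "A k q = B k q - c * C k q" using assms by auto
  thus ?thesis by (simp only: sandwich_def) (simp add: algebra_simps)
qed

text \<open>
  The remainders $r_1, r_2, r_3$ come from applying one and the same identity again and again; each
  application replaces one factor $G$ by $G_0$ and produces the next power of $h$.
\<close>

lemma jet_from_remainders:
  assumes "f = f0 - of_real h * r1" "r1 = f1 - of_real h * r2" "r2 = f2 - of_real h * r3"
    and "cmod f1 \<le> K" "cmod f2 \<le> K" "cmod r1 \<le> K" "cmod r2 \<le> K" "cmod r3 \<le> K"
  shows "jet K h f f0 (- f1) f2"
proof -
  have 1: "f - f0 = - (of_real h * r1)" using assms by simp
  have 2: "f - f0 - of_real h * (- f1) = of_real (h\<^sup>2) * r2"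
    unfolding assms(1,2) by (simp add: algebra_simps power2_eq_square)
  have 3: "f - f0 - of_real h * (- f1) - of_real (h\<^sup>2) * f2 = - (of_real (h^3) * r3)"
    unfolding assms(1-3) by (simp add: algebra_simps power2_eq_square power3_eq_cube)
  show ?thesis unfolding jet_def unfolding 3 unfolding 2 unfolding 1
    using assms(4-8) by (auto simp: norm_mult power_abs mult.commute[of K] intro!: mult_left_mono simp del: of_real_power)
qed

context
  fixes I :: "'i set" and A A\<^sub>0 :: "'i \<Rightarrow> 'i \<Rightarrow> real" and z :: complex and G G\<^sub>0 :: "'i \<Rightarrow> 'i \<Rightarrow> complex"
    and p q :: 'i and h :: real
  assumes fin: "finite I" and symA: "\<And>i j. A i j = A j i" and symA0: "\<And>i j. A\<^sub>0 i j = A\<^sub>0 j i"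
    and G: "resolvent_of I A z G" and G0: "resolvent_of I A\<^sub>0 z G\<^sub>0"
    and d: "differ_by_edge I p q h A A\<^sub>0" and pq: "p \<in> I" "q \<in> I" and z: "1 \<le> \<bar>Im z\<bar>"
begin

private abbreviation "P1 \<equiv> sandwich p q G\<^sub>0 G\<^sub>0"
private abbreviation "P2 \<equiv> sandwich p q P1 G\<^sub>0"
private abbreviation "Q1 \<equiv> sandwich p q G G\<^sub>0"
private abbreviation "Q2 \<equiv> sandwich p q Q1 G\<^sub>0"
private abbreviation "Q3 \<equiv> sandwich p q Q2 G\<^sub>0"

private lemma bounds:
  "rows_cols_bounded I 1 G" "rows_cols_bounded I 1 G\<^sub>0"
  "rows_cols_bounded I 2 P1" "rows_cols_bounded I 2 Q1"
  "rows_cols_bounded I 4 P2" "rows_cols_bounded I 4 Q2" "rows_cols_bounded I 8 Q3"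
proof -
  note sw = rows_cols_bounded_sandwich[OF fin _ _ pq]
  show 1: "rows_cols_bounded I 1 G" "rows_cols_bounded I 1 G\<^sub>0"
    using resolvent_rows_cols_bounded[OF fin symA G, of 1] resolvent_rows_cols_bounded[OF fin symA0 G0, of 1] z
    by simp_all
  show 2: "rows_cols_bounded I 2 P1" "rows_cols_bounded I 2 Q1"
    using sw[OF 1(2) 1(2)] sw[OF 1(1) 1(2)] by simp_all
  show 3: "rows_cols_bounded I 4 P2" "rows_cols_bounded I 4 Q2"
    using sw[OF 2(1) 1(2)] sw[OF 2(2) 1(2)] by simp_all
  show "rows_cols_bounded I 8 Q3" using sw[OF 3(2) 1(2)] by simp
qed

private lemma steps:
  assumes "k \<in> I" "l \<in> I"
  shows "G k l = G\<^sub>0 k l - of_real h * Q1 k l"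
    "Q1 k l = P1 k l - of_real h * Q2 k l"
    "Q2 k l = P2 k l - of_real h * Q3 k l"
proof -
  have 1: "G k l = G\<^sub>0 k l - of_real h * Q1 k l" if "k \<in> I" "l \<in> I" for k l
    by (rule edge_resolvent_identity[OF fin G G0 d pq that])
  have 2: "Q1 k l = P1 k l - of_real h * Q2 k l" if "k \<in> I" "l \<in> I" for k l
    by (rule sandwich_shift[where I = I]) (use 1 that pq in auto)
  have 3: "Q2 k l = P2 k l - of_real h * Q3 k l" if "k \<in> I" "l \<in> I" for k l
    by (rule sandwich_shift[where I = I]) (use 2 that pq in auto)
  show "G k l = G\<^sub>0 k l - of_real h * Q1 k l" "Q1 k l = P1 k l - of_real h * Q2 k l"
    "Q2 k l = P2 k l - of_real h * Q3 k l" using 1 2 3 assms by blast+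
qed

lemma jet_resolvent_entry:
  assumes "k \<in> I" "l \<in> I"
  shows "jet 8 h (G k l) (G\<^sub>0 k l) (- P1 k l) (P2 k l)"
  using bounds[THEN rows_cols_bounded_entry[OF fin, of _ _ k l]] assms
  by (intro jet_from_remainders[OF steps[OF assms]]) auto

lemma jet_wtrace:
  assumes w: "\<And>r. r \<in> I \<Longrightarrow> \<bar>w r\<bar> \<le> 1"
  shows "jet 8 h (wtrace I w G) (wtrace I w G\<^sub>0) (- wtrace I w P1) (wtrace I w P2)"
proof (rule jet_from_remainders)
  have lin: "wtrace I w X = wtrace I w Y - of_real h * wtrace I w Z"
    if "\<And>r. r \<in> I \<Longrightarrow> X r r = Y r r - of_real h * Z r r" for X Y Z
    using that by (simp add: wtrace_def right_diff_distrib sum_subtractf sum_distrib_left mult_ac)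
  show "wtrace I w G = wtrace I w G\<^sub>0 - of_real h * wtrace I w Q1"
    "wtrace I w Q1 = wtrace I w P1 - of_real h * wtrace I w Q2"
    "wtrace I w Q2 = wtrace I w P2 - of_real h * wtrace I w Q3"
    by (intro lin steps; assumption)+
  have tr: "cmod (wtrace I w (sandwich p q X Y)) \<le> 2 * (c * d)"
    if "rows_cols_bounded I c X" "rows_cols_bounded I d Y" for X Y c d
    by (rule wtrace_sandwich_bound[OF w that pq])
  show "cmod (wtrace I w P1) \<le> 8" using tr[OF bounds(2) bounds(2)] by simp
  show "cmod (wtrace I w P2) \<le> 8" using tr[OF bounds(3) bounds(2)] by simp
  show "cmod (wtrace I w Q1) \<le> 8" using tr[OF bounds(1) bounds(2)] by simp
  show "cmod (wtrace I w Q2) \<le> 8" using tr[OF bounds(4) bounds(2)] by simp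
  show "cmod (wtrace I w Q3) \<le> 8" using tr[OF bounds(6) bounds(2)] by simp
qed

text \<open>
  By symmetry of $G_0$, the first coefficient of a weighted trace is a pairing of the columns $p$ and $q$,
  counted twice off the diagonal. Passing to the columns of $G$ costs a multiple of $|h|$ only. In this form the bound is
  square summable over $q$.
\<close>

lemma wtrace_derivative_bound:
  assumes w: "\<And>r. r \<in> I \<Longrightarrow> \<bar>w r\<bar> \<le> 1"
  shows "cmod (wtrace I w P1) \<le> 2 * cmod (\<Sum>r\<in>I. of_real (w r) * (G r p * G r q)) + 8 * \<bar>h\<bar>"
proof -
  let ?old = "\<Sum>r\<in>I. of_real (w r) * (G\<^sub>0 r p * G\<^sub>0 r q)"
  let ?new = "\<Sum>r\<in>I. of_real (w r) * (G r p * G r q)"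
  have sym0: "G\<^sub>0 a b = G\<^sub>0 b a" if "a \<in> I" "b \<in> I" for a b
    using resolvent_symmetric[OF fin symA0 G0 that] .
  have "wtrace I w P1 = ?old + (if p = q then 0 else ?old)"
  proof -
    have "G\<^sub>0 r p * G\<^sub>0 q r = G\<^sub>0 r p * G\<^sub>0 r q" "G\<^sub>0 r q * G\<^sub>0 p r = G\<^sub>0 r p * G\<^sub>0 r q"
      if "r \<in> I" for r using that pq sym0 by (auto simp: mult.commute)
    hence "(\<Sum>r\<in>I. of_real (w r) * (G\<^sub>0 r p * G\<^sub>0 q r)) = ?old"
      "(\<Sum>r\<in>I. of_real (w r) * (G\<^sub>0 r q * G\<^sub>0 p r)) = ?old"
      by (auto intro!: sum.cong)
    thus ?thesis by (auto simp: wtrace_def sandwich_def distrib_left sum.distrib)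
  qed
  hence 1: "cmod (wtrace I w P1) \<le> 2 * cmod ?old"
    using norm_triangle_ineq[of ?old "if p = q then 0 else ?old"] by (auto split: if_splits)
  have "?old - ?new = of_real h * ((\<Sum>r\<in>I. of_real (w r) * (G\<^sub>0 r p * Q1 r q)) + (\<Sum>r\<in>I. of_real (w r) * (Q1 r p * G r q)))"
  proof -
    have "?old - ?new = (\<Sum>r\<in>I. of_real (w r) * (G\<^sub>0 r p * (G\<^sub>0 r q - G r q) + (G\<^sub>0 r p - G r p) * G r q))"
      by (simp add: sum_subtractf[symmetric] algebra_simps)
    also have "\<dots> = (\<Sum>r\<in>I. of_real (w r) * (G\<^sub>0 r p * (of_real h * Q1 r q) + (of_real h * Q1 r p) * G r q))"
      using steps(1) pq by (intro sum.cong refl) auto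
    also have "\<dots> = of_real h * ((\<Sum>r\<in>I. of_real (w r) * (G\<^sub>0 r p * Q1 r q)) + (\<Sum>r\<in>I. of_real (w r) * (Q1 r p * G r q)))"
      by (simp add: distrib_left sum.distrib sum_distrib_left mult_ac)
    finally show ?thesis .
  qed
  also have "cmod \<dots> \<le> \<bar>h\<bar> * (1 * 2 + 2 * 1)"
    unfolding norm_mult norm_of_real
    by (intro mult_left_mono norm_triangle_mono weighted_pairing_bound w)
       (use bounds pq in \<open>auto simp: rows_cols_bounded_def\<close>)
  finally have "cmod ?old \<le> cmod ?new + 4 * \<bar>h\<bar>"
    using norm_triangle_sub[of ?old ?new] by simp
  with 1 show ?thesis by simp
qed

end

text \<open>
  The pairings are the components of the image under $G$ of the column $p$ multiplied by the weights, so that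
  the contraction property applies to their sum of squares.
\<close>

lemma resolvent_pairing_L2:
  fixes w :: "'i \<Rightarrow> real"
  assumes fin: "finite I" and sym: "\<And>i j. A i j = A j i" and G: "resolvent_of I A z G"
    and z: "1 \<le> \<bar>Im z\<bar>" and w: "\<And>r. r \<in> I \<Longrightarrow> \<bar>w r\<bar> \<le> 1" and p: "p \<in> I"
  shows "(\<Sum>q\<in>I. (cmod (\<Sum>r\<in>I. of_real (w r) * (G r p * G r q)))\<^sup>2) \<le> 1"
proof -
  let ?x = "\<lambda>r. of_real (w r) * G r p"
  have rc: "rows_cols_bounded I 1 G" using resolvent_rows_cols_bounded[OF fin sym G, of 1] z by simp
  have "L2_set (\<lambda>q. cmod (\<Sum>r\<in>I. of_real (w r) * (G r p * G r q))) I
      = L2_set (\<lambda>q. cmod (\<Sum>r\<in>I. G q r * ?x r)) I"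
    using resolvent_symmetric[OF fin sym G]
    by (intro L2_set_cong refl arg_cong[where f = cmod] sum.cong) (auto simp: mult_ac)
  also have "\<dots> \<le> \<bar>Im z\<bar> * L2_set (\<lambda>q. cmod (\<Sum>r\<in>I. G q r * ?x r)) I"
    using mult_right_mono[OF z L2_set_nonneg[of "\<lambda>q. cmod (\<Sum>r\<in>I. G q r * ?x r)" I]] by simp
  also have "\<dots> \<le> L2_set (\<lambda>r. cmod (?x r)) I"
    by (rule resolvent_contraction[OF fin sym G])
  also have "\<dots> \<le> L2_set (\<lambda>r. cmod (G r p)) I"
    using w by (intro L2_set_mono) (auto simp: norm_mult intro!: mult_left_le_one_le)
  also have "\<dots> \<le> 1" using rc p by (auto simp: rows_cols_bounded_def)
  finally show ?thesis
    by (simp add: L2_set_def real_sqrt_le_1_iff)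
qed

section \<open>The resolvent as a measurable function of the entries\<close>

text \<open>
  A vector in the kernel of $A - z$ vanishes by the lower bound for $A - z$ with right-hand side $0$.
\<close>

lemma shifted_mat_det_nonzero:
  assumes A: "A \<in> carrier_mat N N" and ent: "\<And>k l. k < N \<Longrightarrow> l < N \<Longrightarrow> A $$ (k, l) = of_real (\<alpha> k l)"
    and sym: "\<And>k l. \<alpha> k l = \<alpha> l k" and z: "Im z \<noteq> 0"
  shows "Determinant.det (A - z \<cdot>\<^sub>m 1\<^sub>m N) \<noteq> 0"
proof
  let ?B = "A - z \<cdot>\<^sub>m 1\<^sub>m N"
  have B: "?B \<in> carrier_mat N N" by (intro minus_carrier_mat smult_carrier_mat one_carrier_mat)
  assume "Determinant.det ?B = 0"
  then obtain v where v: "v \<in> carrier_vec N" "v \<noteq> 0\<^sub>v N" "?B *\<^sub>v v = 0\<^sub>v N"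
    using det_0_iff_vec_prod_zero[OF B] by blast
  have eq: "(\<Sum>k\<in>{0..<N}. of_real (\<alpha> i k) * vec_index v k) - z * vec_index v i = 0" if i: "i \<in> {0..<N}" for i
  proof -
    have "vec_index (?B *\<^sub>v v) i = (\<Sum>k\<in>{0..<N}. ?B $$ (i, k) * vec_index v k)"
      using i B v(1) by (simp add: scalar_prod_def)
    also have "\<dots> = (\<Sum>k\<in>{0..<N}. of_real (\<alpha> i k) * vec_index v k - (if i = k then z * vec_index v k else 0))"
      using i A by (intro sum.cong refl) (auto simp: ent algebra_simps)
    also have "\<dots> = (\<Sum>k\<in>{0..<N}. of_real (\<alpha> i k) * vec_index v k) - z * vec_index v i"
      using i by (simp add: sum_subtractf)
    finally show ?thesis using v(3) i by simp
  qed
  have "\<bar>Im z\<bar> * L2_set (\<lambda>i. cmod (vec_index v i)) {0..<N} \<le> L2_set (\<lambda>i. cmod 0) {0..<N}"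
    by (rule shifted_symmetric_lower_bound[where A = \<alpha> and z = z]) (use sym eq in auto)
  hence "L2_set (\<lambda>i. cmod (vec_index v i)) {0..<N} \<le> 0"
    using z L2_set_nonneg[of "\<lambda>i. cmod (vec_index v i)" "{0..<N}"] by (simp add: mult_le_0_iff L2_set_def)
  hence "L2_set (\<lambda>i. cmod (vec_index v i)) {0..<N} = 0"
    using L2_set_nonneg[of "\<lambda>i. cmod (vec_index v i)" "{0..<N}"] by linarith
  hence "\<forall>i\<in>{0..<N}. vec_index v i = 0" by (simp add: L2_set_eq_0_iff)
  hence "v = 0\<^sub>v N" using v(1) by (intro eq_vecI) auto
  with v(2) show False by simp
qed

lemma resolvent_inverse:
  assumes A: "A \<in> carrier_mat N N" and det: "Determinant.det (A - z \<cdot>\<^sub>m 1\<^sub>m N) \<noteq> 0"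
  shows "resolvent A z \<in> carrier_mat N N"
    and "(A - z \<cdot>\<^sub>m 1\<^sub>m N) * resolvent A z = 1\<^sub>m N"
    and "resolvent A z * (A - z \<cdot>\<^sub>m 1\<^sub>m N) = 1\<^sub>m N"
proof -
  let ?B = "A - z \<cdot>\<^sub>m 1\<^sub>m N"
  have B: "?B \<in> carrier_mat N N" by (intro minus_carrier_mat smult_carrier_mat one_carrier_mat)
  obtain C where C: "mat_inverse ?B = Some C"
    using mat_inverse(1)[OF B, of "()"] det_non_zero_imp_unit[OF B det, of "()"]
    by (cases "mat_inverse ?B") auto
  have R: "resolvent A z = C" using A C by (simp add: resolvent_def carrier_matD)
  show "resolvent A z \<in> carrier_mat N N" "?B * resolvent A z = 1\<^sub>m N" "resolvent A z * ?B = 1\<^sub>m N"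
    using mat_inverse(2)[OF B C] R by auto
qed

text \<open>
  Cramer's rule exhibits the entries of the resolvent as rational functions of the entries of the matrix, which
  is the reason why they are random variables.
\<close>

lemma resolvent_adjugate:
  assumes A: "A \<in> carrier_mat N N" and det: "Determinant.det (A - z \<cdot>\<^sub>m 1\<^sub>m N) \<noteq> 0" and kl: "k < N" "l < N"
  shows "resolvent A z $$ (k, l)
    = cofactor (A - z \<cdot>\<^sub>m 1\<^sub>m N) l k / Determinant.det (A - z \<cdot>\<^sub>m 1\<^sub>m N)"
proof -
  let ?B = "A - z \<cdot>\<^sub>m 1\<^sub>m N" and ?R = "resolvent A z"
  note R = resolvent_inverse[OF A det]
  have B: "?B \<in> carrier_mat N N" by (intro minus_carrier_mat smult_carrier_mat one_carrier_mat)
  note adj = adj_mat[OF B]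
  have "adj_mat ?B = (?R * ?B) * adj_mat ?B" using R(3) adj(1) by simp
  also have "\<dots> = ?R * (?B * adj_mat ?B)" by (rule assoc_mult_mat[OF R(1) B adj(1)])
  also have "\<dots> = Determinant.det ?B \<cdot>\<^sub>m ?R" unfolding adj(2) mult_smult_distrib[OF R(1) one_carrier_mat] right_mult_one_mat[OF R(1)] ..
  finally have "adj_mat ?B $$ (k, l) = Determinant.det ?B * ?R $$ (k, l)" using R(1) kl by simp
  moreover have "adj_mat ?B $$ (k, l) = cofactor ?B l k" using B kl by (simp add: adj_mat_def)
  ultimately show ?thesis using det by (simp add: field_simps)
qed

lemma borel_measurable_det:
  fixes A :: "'a \<Rightarrow> complex mat"
  assumes A: "\<And>x. A x \<in> carrier_mat N N"
    and m: "\<And>k l. k < N \<Longrightarrow> l < N \<Longrightarrow> (\<lambda>x. A x $$ (k, l)) \<in> borel_measurable M"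
  shows "(\<lambda>x. Determinant.det (A x)) \<in> borel_measurable M"
proof -
  have "(\<lambda>x. \<Sum>p\<in>{p. p permutes {0..<N}}. signof p * (\<Prod>i = 0..<N. A x $$ (i, p i)))
      \<in> borel_measurable M"
    using permutes_in_image
    by (intro borel_measurable_sum borel_measurable_times borel_measurable_prod measurable_const m)
       (fastforce simp: permutes_in_image)+
  thus ?thesis by (simp add: det_def'[OF A])
qed

lemma borel_measurable_cofactor:
  fixes A :: "'a \<Rightarrow> complex mat"
  assumes A: "\<And>x. A x \<in> carrier_mat N N"
    and m: "\<And>k l. k < N \<Longrightarrow> l < N \<Longrightarrow> (\<lambda>x. A x $$ (k, l)) \<in> borel_measurable M"
    and ij: "i < N" "j < N"
  shows "(\<lambda>x. cofactor (A x) i j) \<in> borel_measurable M"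
proof -
  have "(\<lambda>x. Determinant.det (mat_delete (A x) i j)) \<in> borel_measurable M"
  proof (rule borel_measurable_det)
    show "mat_delete (A x) i j \<in> carrier_mat (N - 1) (N - 1)" for x
      by (rule mat_delete_carrier[OF A])
    show "(\<lambda>x. mat_delete (A x) i j $$ (k, l)) \<in> borel_measurable M" if "k < N - 1" "l < N - 1" for k l
    proof -
      have "mat_delete (A x) i j $$ (k, l) = A x $$ (if k < i then k else Suc k, if l < j then l else Suc l)" for x
        using A[of x] that by (simp add: mat_delete_def)
      thus ?thesis using that by (simp add: m)
    qed
  qed
  thus ?thesis unfolding cofactor_def by simp
qed

definition indices :: "nat \<Rightarrow> int set" where
  "indices n = {- int n..int n}"

text \<open>
  The independent variables of the model sit on and above the diagonal. A configuration assigns a number to each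
  such position, and the matrix is read off from it by symmetry; resetting one value of the configuration then changes an entry and its
  mirror image at once.
\<close>

definition cfg_entry :: "(int \<times> int \<Rightarrow> real) \<Rightarrow> int \<Rightarrow> int \<Rightarrow> real" where
  "cfg_entry x i j = x (min i j, max i j)"

definition cfg_mat :: "nat \<Rightarrow> (int \<times> int \<Rightarrow> real) \<Rightarrow> complex mat" where
  "cfg_mat n x = mat (2 * n + 1) (2 * n + 1)
     (\<lambda>(k, l). complex_of_real (cfg_entry x (int k - int n) (int l - int n)))"

definition cfg_G :: "nat \<Rightarrow> complex \<Rightarrow> (int \<times> int \<Rightarrow> real) \<Rightarrow> int \<Rightarrow> int \<Rightarrow> complex" where
  "cfg_G n z x i j = resolvent (cfg_mat n x) z $$ (nat (i + int n), nat (j + int n))"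

lemma finite_indices [simp]: "finite (indices n)"
  by (simp add: indices_def)

lemma card_indices: "card (indices n) = 2 * n + 1"
  by (simp add: indices_def)

lemma cfg_entry_sym: "cfg_entry x i j = cfg_entry x j i"
  by (simp add: cfg_entry_def min.commute max.commute)

lemma perc_G_eq_cfg_G:
  "perc_G a b d n z i j x = cfg_G n z (\<lambda>(i, j). a i j x * d n i j x / sqrt (real (b n))) i j"
proof -
  have "perc_mat a b d n x = cfg_mat n (\<lambda>(i, j). a i j x * d n i j x / sqrt (real (b n)))"
    unfolding perc_mat_def cfg_mat_def by (intro cong_mat) (auto simp: perc_entry_def cfg_entry_def min_def max_def)
  thus ?thesis by (simp add: perc_G_def cfg_G_def)
qed

lemma cfg_mat_carrier [simp]: "cfg_mat n x \<in> carrier_mat (2 * n + 1) (2 * n + 1)"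
  by (simp add: cfg_mat_def)

lemma cfg_det_nonzero:
  assumes "Im z \<noteq> 0"
  shows "Determinant.det (cfg_mat n x - z \<cdot>\<^sub>m 1\<^sub>m (2 * n + 1)) \<noteq> 0"
  by (rule shifted_mat_det_nonzero[OF cfg_mat_carrier _ _ assms,
        where \<alpha> = "\<lambda>k l. cfg_entry x (int k - int n) (int l - int n)"])
     (auto simp: cfg_mat_def cfg_entry_sym intro: cfg_entry_sym)

lemma cfg_G_resolvent_of:
  assumes z: "Im z \<noteq> 0"
  shows "resolvent_of (indices n) (cfg_entry x) z (cfg_G n z x)"
proof -
  let ?N = "2 * n + 1" and ?A = "cfg_mat n x"
  let ?R = "resolvent ?A z" and ?B = "?A - z \<cdot>\<^sub>m 1\<^sub>m ?N"
  note R = resolvent_inverse[OF cfg_mat_carrier cfg_det_nonzero[OF z], of n x]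
  have B: "?B \<in> carrier_mat ?N ?N" by (intro minus_carrier_mat smult_carrier_mat one_carrier_mat)
  have Be: "?B $$ (nat (i + int n), nat (j + int n)) = of_real (cfg_entry x i j) - (if i = j then z else 0)"
    if "i \<in> indices n" "j \<in> indices n" for i j
    using that by (auto simp: indices_def cfg_mat_def)
  have bij: "bij_betw (\<lambda>k. nat (k + int n)) (indices n) {0..<?N}"
    by (rule bij_betwI[where g = "\<lambda>k. int k - int n"]) (auto simp: indices_def)
  have lt: "nat (i + int n) < ?N" if "i \<in> indices n" for i
    using that by (auto simp: indices_def)
  have index_mult: "(X * Y) $$ (k, l) = (\<Sum>m\<in>{0..<N}. X $$ (k, m) * Y $$ (m, l))"
    if "X \<in> carrier_mat N N" "Y \<in> carrier_mat N N" "k < N" "l < N" for X Y :: "complex mat" and k l N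
    using that by (auto simp: scalar_prod_def)
  have prod: "(\<Sum>k\<in>indices n. X $$ (nat (i + int n), nat (k + int n)) * Y $$ (nat (k + int n), nat (j + int n)))
     = (if i = j then 1 else 0)"
    if "i \<in> indices n" "j \<in> indices n" "X \<in> carrier_mat ?N ?N" "Y \<in> carrier_mat ?N ?N" "X * Y = 1\<^sub>m ?N"
    for i j and X Y :: "complex mat"
  proof -
    have "(X * Y) $$ (nat (i + int n), nat (j + int n))
      = (\<Sum>k\<in>{0..<?N}. X $$ (nat (i + int n), k) * Y $$ (k, nat (j + int n)))"
      using that lt by (intro index_mult) auto
    also have "\<dots> = (\<Sum>k\<in>indices n. X $$ (nat (i + int n), nat (k + int n)) * Y $$ (nat (k + int n), nat (j + int n)))"
      by (rule sum.reindex_bij_betw[OF bij, symmetric])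
    finally have "(\<Sum>k\<in>indices n. X $$ (nat (i + int n), nat (k + int n)) * Y $$ (nat (k + int n), nat (j + int n)))
      = 1\<^sub>m ?N $$ (nat (i + int n), nat (j + int n))" using that(5) by (simp only:)
    also have "\<dots> = (if i = j then 1 else 0)" using that(1,2) by (auto simp: indices_def nat_eq_iff2)
    finally show ?thesis .
  qed
  show ?thesis unfolding resolvent_of_def
  proof (intro ballI conjI)
    fix i j assume ij: "i \<in> indices n" "j \<in> indices n"
    have "(\<Sum>k\<in>indices n. ?B $$ (nat (i + int n), nat (k + int n)) * cfg_G n z x k j)
       = (\<Sum>k\<in>indices n. of_real (cfg_entry x i k) * cfg_G n z x k j - (if i = k then z * cfg_G n z x k j else 0))"
      using ij Be by (intro sum.cong refl) (auto simp: left_diff_distrib)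
    also have "\<dots> = (\<Sum>k\<in>indices n. of_real (cfg_entry x i k) * cfg_G n z x k j) - z * cfg_G n z x i j"
      using ij by (simp add: sum_subtractf)
    finally show "(\<Sum>k\<in>indices n. of_real (cfg_entry x i k) * cfg_G n z x k j) - z * cfg_G n z x i j
        = (if i = j then 1 else 0)"
      using prod[OF ij B R(1,2)] by (simp add: cfg_G_def)
    have "(\<Sum>k\<in>indices n. cfg_G n z x i k * ?B $$ (nat (k + int n), nat (j + int n)))
       = (\<Sum>k\<in>indices n. cfg_G n z x i k * of_real (cfg_entry x k j) - (if k = j then z * cfg_G n z x i k else 0))"
      using ij Be by (intro sum.cong refl) (auto simp: right_diff_distrib)
    also have "\<dots> = (\<Sum>k\<in>indices n. cfg_G n z x i k * of_real (cfg_entry x k j)) - z * cfg_G n z x i j"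
      using ij by (simp add: sum_subtractf)
    finally show "(\<Sum>k\<in>indices n. cfg_G n z x i k * of_real (cfg_entry x k j)) - z * cfg_G n z x i j
        = (if i = j then 1 else 0)"
      using prod[OF ij R(1) B R(3)] by (simp add: cfg_G_def)
  qed
qed

lemma borel_measurable_cfg_G:
  assumes z: "Im z \<noteq> 0" and ij: "i \<in> indices n" "j \<in> indices n"
    and X: "\<And>k l. (k, l) \<in> upper_pairs_upto n \<Longrightarrow> (\<lambda>x. X x (k, l)) \<in> borel_measurable M"
  shows "(\<lambda>x. cfg_G n z (X x) i j) \<in> borel_measurable M"
proof -
  let ?N = "2 * n + 1" let ?B = "\<lambda>x. cfg_mat n (X x) - z \<cdot>\<^sub>m 1\<^sub>m ?N"
  let ?i = "nat (i + int n)" and ?j = "nat (j + int n)"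
  have lt: "?i < ?N" "?j < ?N" using ij by (auto simp: indices_def)
  have B: "?B x \<in> carrier_mat ?N ?N" for x
    by (intro minus_carrier_mat smult_carrier_mat one_carrier_mat)
  have m: "(\<lambda>x. ?B x $$ (k, l)) \<in> borel_measurable M" if "k < ?N" "l < ?N" for k l
  proof -
    have "?B x $$ (k, l) = of_real (X x (min (int k - int n) (int l - int n), max (int k - int n) (int l - int n)))
        - (if k = l then z else 0)" for x
      using that by (simp add: cfg_mat_def cfg_entry_def)
    moreover have "(min (int k - int n) (int l - int n), max (int k - int n) (int l - int n)) \<in> upper_pairs_upto n"
      using that by (auto simp: upper_pairs_upto_def)
    ultimately show ?thesis using X by (auto intro!: borel_measurable_diff)
  qed
  show ?thesis
    unfolding cfg_G_def resolvent_adjugate[OF cfg_mat_carrier cfg_det_nonzero[OF z] lt]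
    by (intro borel_measurable_divide borel_measurable_cofactor[OF B m lt(2,1)] borel_measurable_det[OF B m])
qed

section \<open>Averaging over a single entry\<close>

lemma (in prob_space) expectation_mult_indep:
  fixes \<phi> :: "'b \<Rightarrow> 'c::{real_normed_field,banach,second_countable_topology}"
  assumes ind: "indep_var N\<^sub>1 X N\<^sub>2 Z"
    and \<phi>: "\<phi> \<in> borel_measurable N\<^sub>1" and F: "F \<in> borel_measurable N\<^sub>2"
    and i: "integrable M (\<lambda>x. \<phi> (X x))" "integrable M (\<lambda>x. F (Z x))"
  shows "integrable M (\<lambda>x. \<phi> (X x) * F (Z x))"
    and "(\<integral>x. \<phi> (X x) * F (Z x) \<partial>M) = (\<integral>x. \<phi> (X x) \<partial>M) * (\<integral>x. F (Z x) \<partial>M)"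
proof -
  have "indep_var borel (\<lambda>x. \<phi> (X x)) borel (\<lambda>x. F (Z x))"
    using indep_var_compose[OF ind \<phi> F] by (simp add: comp_def)
  from indep_var_integrable[OF this i] indep_var_lebesgue_integral[OF this i]
  show "integrable M (\<lambda>x. \<phi> (X x) * F (Z x))"
    and "(\<integral>x. \<phi> (X x) * F (Z x) \<partial>M) = (\<integral>x. \<phi> (X x) \<partial>M) * (\<integral>x. F (Z x) \<partial>M)" .
qed

lemma norm_mult_le: "norm (x * y) \<le> a * b" if "norm x \<le> a" "norm y \<le> b"
  for x y :: complex
  using that unfolding norm_mult by (intro mult_mono) (auto intro: order.trans[OF norm_ge_zero])

lemma (in prob_space) bounded_integrable:
  fixes f :: "'a \<Rightarrow> 'b::{banach,second_countable_topology}"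
  assumes "f \<in> borel_measurable M" "\<And>x. norm (f x) \<le> B"
  shows "integrable M f"
  using assms by (intro integrable_const_bound[of _ B]) auto

text \<open>
  On a probability space the constants are integrable, and $|X|^k \le 1 + X^m$.
\<close>

lemma (in prob_space) integrable_power_le:
  fixes X :: "'a \<Rightarrow> real"
  assumes X: "X \<in> borel_measurable M" "integrable M (\<lambda>x. X x ^ m)" and m: "even m" and k: "k \<le> m"
  shows "integrable M (\<lambda>x. \<bar>X x\<bar> ^ k)" "integrable M (\<lambda>x. X x ^ k)"
proof -
  have le: "\<bar>X x\<bar> ^ k \<le> \<bar>1 + X x ^ m\<bar>" for x
  proof (cases "\<bar>X x\<bar> \<le> 1")
    case True
    hence "\<bar>X x\<bar> ^ k \<le> 1" by (simp add: power_le_one)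
    thus ?thesis using zero_le_even_power[OF m, of "X x"] by linarith
  next
    case False
    hence "\<bar>X x\<bar> ^ k \<le> \<bar>X x\<bar> ^ m" using k by (intro power_increasing) auto
    thus ?thesis using m by (simp add: power_even_abs)
  qed
  have i: "integrable M (\<lambda>x. 1 + X x ^ m)" using X(2) by simp
  show "integrable M (\<lambda>x. \<bar>X x\<bar> ^ k)"
    by (rule Bochner_Integration.integrable_bound[OF i]) (use X(1) le in auto)
  show "integrable M (\<lambda>x. X x ^ k)"
    by (rule Bochner_Integration.integrable_bound[OF i]) (use X(1) le in \<open>auto simp: power_abs\<close>)
qed

lemma (in prob_space) norm_expectation_diff_le:
  fixes f g :: "'a \<Rightarrow> complex"
  assumes "integrable M f" "integrable M g" "integrable M e"
    and "\<And>x. cmod (f x - g x) \<le> e x"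
  shows "cmod ((\<integral>x. f x \<partial>M) - (\<integral>x. g x \<partial>M)) \<le> (\<integral>x. e x \<partial>M)"
proof -
  have "(\<integral>x. f x \<partial>M) - (\<integral>x. g x \<partial>M) = (\<integral>x. f x - g x \<partial>M)"
    using assms by simp
  also have "cmod \<dots> \<le> (\<integral>x. cmod (f x - g x) \<partial>M)" by (rule integral_norm_bound)
  also have "\<dots> \<le> (\<integral>x. e x \<partial>M)"
    using assms by (intro integral_mono) auto
  finally show ?thesis .
qed

lemma jet_bounds:
  assumes "jet K h f f0 f1 f2"
  shows "cmod f1 \<le> K" "cmod f2 \<le> K" "cmod (f - f0) \<le> K * \<bar>h\<bar>"
    "cmod (f - f0 - of_real h * f1) \<le> K * h\<^sup>2"
    "cmod (f - f0 - of_real h * f1 - of_real (h\<^sup>2) * f2) \<le> K * \<bar>h\<bar> ^ 3"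
    "cmod f \<le> cmod f0 + K * \<bar>h\<bar>" "cmod f0 \<le> cmod f + K * \<bar>h\<bar>"
  using assms norm_triangle_sub[of f f0] norm_triangle_sub[of f0 f]
  by (auto simp: jet_def norm_minus_commute)

text \<open>
  The remainder involves the unknown size of $f_0$ only through the third power of $h$.
\<close>

lemma jet_product:
  assumes f: "jet 8 h f f0 f1 f2" and g: "jet 8 h g g0 g1 g2" and g0: "cmod g0 \<le> 1"
  shows "cmod (f * g - (f0 * g0 + of_real h * (f0 * g1 + f1 * g0)
      + of_real (h\<^sup>2) * (f0 * g2 + f1 * g1 + f2 * g0))) \<le> (136 + 8 * cmod f0) * \<bar>h\<bar> ^ 3 + 64 * h ^ 4"
proof -
  note F = jet_bounds[OF f] and G = jet_bounds[OF g]
  let ?h = "complex_of_real h"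
  let ?a = "(f - f0 - ?h * f1 - of_real (h\<^sup>2) * f2) * g0"
  let ?b = "?h * ((f - f0 - ?h * f1) * g1)"
  let ?c = "of_real (h\<^sup>2) * ((f - f0) * g2)"
  let ?d = "f * (g - g0 - ?h * g1 - of_real (h\<^sup>2) * g2)"
  have "f * g - (f0 * g0 + ?h * (f0 * g1 + f1 * g0)
      + of_real (h\<^sup>2) * (f0 * g2 + f1 * g1 + f2 * g0)) = ?a + ?b + ?c + ?d"
    by (simp add: algebra_simps power2_eq_square)
  also have "cmod \<dots> \<le> cmod ?a + cmod ?b + cmod ?c + cmod ?d"
    by (intro norm_triangle_mono order_refl)
  also have "cmod ?a \<le> (8 * \<bar>h\<bar> ^ 3) * 1"
    unfolding norm_mult by (intro mult_mono F g0) auto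
  also have "cmod ?b \<le> \<bar>h\<bar> * ((8 * h\<^sup>2) * 8)"
    unfolding norm_mult norm_of_real by (intro mult_mono F G order_refl) auto
  also have "cmod ?c \<le> h\<^sup>2 * ((8 * \<bar>h\<bar>) * 8)"
    unfolding norm_mult norm_of_real abs_power2 by (intro mult_mono F G order_refl) auto
  also have "cmod ?d \<le> (cmod f0 + 8 * \<bar>h\<bar>) * (8 * \<bar>h\<bar> ^ 3)"
    unfolding norm_mult by (intro mult_mono F G) auto
  finally show ?thesis
    by (simp add: algebra_simps power2_abs[symmetric, of h] power_even_abs[symmetric, of 4 h] power3_eq_cube power2_eq_square eval_nat_numeral del: power2_abs power_even_abs)
qed

text \<open>
  For a product that is already multiplied by a second moment, an expansion to first order suffices; its linear
  term averages to zero.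
\<close>

lemma jet_triple_product:
  assumes f: "jet 8 h f f0 f1 f2" and g: "jet 8 h g g0 g1 g2" and k: "jet 8 h k k0 k1 k2"
    and b: "cmod g0 \<le> 1" "cmod k0 \<le> 1" "cmod g \<le> 1" "cmod k \<le> 1"
  shows "cmod (f * (g * k) - (f0 * (g0 * k0) + of_real h * (f0 * (g0 * k1 + g1 * k0) + f1 * (g0 * k0))))
     \<le> (136 + 80 * cmod f0) * h\<^sup>2 + 640 * \<bar>h\<bar> ^ 3"
proof -
  note F = jet_bounds[OF f] and G = jet_bounds[OF g] and K = jet_bounds[OF k]
  let ?h = "complex_of_real h"
  let ?l1 = "g0 * k1 + g1 * k0"
  have "g * k - g0 * k0 - ?h * ?l1
     = (g - g0) * (k - k0) + (g - g0 - ?h * g1) * k0 + g0 * (k - k0 - ?h * k1)"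
    by (simp add: algebra_simps)
  also have "cmod \<dots> \<le> (8 * \<bar>h\<bar>) * (8 * \<bar>h\<bar>) + (8 * h\<^sup>2) * 1 + 1 * (8 * h\<^sup>2)"
    by (intro norm_triangle_mono; unfold norm_mult; intro mult_mono G K b) auto
  finally have l2: "cmod (g * k - g0 * k0 - ?h * ?l1) \<le> 80 * h\<^sup>2"
    by (simp add: power2_eq_square abs_mult_self_eq mult_ac)
  have "cmod ?l1 \<le> 1 * 8 + 8 * 1"
    by (intro norm_triangle_mono; unfold norm_mult; intro mult_mono G K b) auto
  hence l1: "cmod ?l1 \<le> 16" by simp
  have l0: "cmod (g0 * k0) \<le> 1" unfolding norm_mult using b by (simp add: mult_le_one)
  let ?a = "(f - f0 - ?h * f1) * (g0 * k0)" and ?b = "?h * ((f - f0) * ?l1)"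
    and ?c = "f * (g * k - g0 * k0 - ?h * ?l1)"
  have "f * (g * k) - (f0 * (g0 * k0) + ?h * (f0 * ?l1 + f1 * (g0 * k0))) = ?a + ?b + ?c"
    by (simp add: algebra_simps)
  also have "cmod \<dots> \<le> cmod ?a + cmod ?b + cmod ?c"
    by (intro norm_triangle_mono order_refl)
  also have "cmod ?a \<le> (8 * h\<^sup>2) * 1"
    by (subst norm_mult) (intro mult_mono F l0, auto)
  also have "cmod ?b \<le> \<bar>h\<bar> * ((8 * \<bar>h\<bar>) * 16)"
    by (simp only: norm_mult[of ?h] norm_mult[of "f - f0"] norm_of_real) (intro mult_mono F l1 order_refl, auto)
  also have "cmod ?c \<le> (cmod f0 + 8 * \<bar>h\<bar>) * (80 * h\<^sup>2)"
    by (subst norm_mult) (intro mult_mono F l2, auto)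
  finally show ?thesis
    by (simp add: algebra_simps power2_abs[symmetric, of h] power3_eq_cube power2_eq_square del: power2_abs)
qed

text \<open>
  The odd absolute moments are thereby bounded by the neighbouring even ones.
\<close>

lemma powers_sandwiched:
  fixes h :: real
  shows "\<bar>h\<bar> \<le> 1 + h\<^sup>2" "\<bar>h\<bar> ^ 3 \<le> h\<^sup>2 + h ^ 4" "\<bar>h\<bar> ^ 5 \<le> h ^ 4 + h ^ 6"
proof -
  have 1: "\<bar>h\<bar> \<le> 1 + h\<^sup>2"
    using zero_le_power2[of "\<bar>h\<bar> - 1"] zero_le_power2[of h] by (simp add: power2_diff)
  show "\<bar>h\<bar> \<le> 1 + h\<^sup>2" by fact
  have "h\<^sup>2 * \<bar>h\<bar> \<le> h\<^sup>2 * (1 + h\<^sup>2)" "h ^ 4 * \<bar>h\<bar> \<le> h ^ 4 * (1 + h\<^sup>2)"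
    using 1 by (auto intro: mult_left_mono)
  moreover have "h\<^sup>2 * \<bar>h\<bar> = \<bar>h\<bar> ^ 3" "h ^ 4 * \<bar>h\<bar> = \<bar>h\<bar> ^ 5"
    by (simp_all add: power2_abs[symmetric, of h] power_even_abs[symmetric, of 4 h] eval_nat_numeral del: power2_abs power_even_abs)
  ultimately show "\<bar>h\<bar> ^ 3 \<le> h\<^sup>2 + h ^ 4" "\<bar>h\<bar> ^ 5 \<le> h ^ 4 + h ^ 6"
    by (simp_all add: algebra_simps flip: power_add)
qed

text \<open>
  The pointwise inequality behind \<open>frozen_off_diagonal_bound\<close>. Here $x, x_0$ are the moduli of the fluctuation
  before and after freezing, $y, y_0$ those of the off-diagonal entry, $x_1$ that of the derivative of the fluctuation, and $\eta$ is $|h|$.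
  Every loss caused by freezing must be of second order in $\eta$, since after multiplication by $E h^2$ a loss of first order would sum up
  to $b^{-1/2}$ instead of $b^{-1}$. This is possible because each term on the left contains two factors that are either small off-diagonal
  entries or themselves increments.
\<close>

lemma unfreezing_inequality:
  fixes x x0 x1 y y0 \<eta> q :: real
  assumes nn: "0 \<le> x" "0 \<le> x0" "0 \<le> y" "0 \<le> y0" "0 \<le> \<eta>" "0 \<le> x1" "y0 \<le> 1" "0 \<le> q"
    and rel: "x0 \<le> x + 8 * \<eta>" "x \<le> x0 + 8 * \<eta>" "y0 \<le> y + 8 * \<eta>" "x1 \<le> 2 * q + 8 * \<eta>"
  shows "x0 * y0\<^sup>2 + x1 * y0 \<le> (2 * x + 21) * y\<^sup>2 + 9 * q\<^sup>2
      + (128 * (\<eta>\<^sup>2 * x0) + 2132 * \<eta>\<^sup>2 + 1024 * \<eta> ^ 4)"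
proof -
  have y0: "y0\<^sup>2 \<le> 2 * y\<^sup>2 + 128 * \<eta>\<^sup>2"
  proof -
    have "y0\<^sup>2 \<le> (y + 8 * \<eta>)\<^sup>2" using rel nn by (intro power_mono) auto
    also have "\<dots> \<le> 2 * y\<^sup>2 + 128 * \<eta>\<^sup>2"
      using sum_squares_bound[of y "8 * \<eta>"] by (simp add: power2_sum power_mult_distrib)
    finally show ?thesis .
  qed
  have eta3: "\<eta> * \<eta>\<^sup>2 \<le> \<eta>\<^sup>2 + \<eta> ^ 4"
    using powers_sandwiched(2)[of \<eta>] nn by (simp add: power2_eq_square power3_eq_cube)
  have "x0 * y0\<^sup>2 \<le> (x + 8 * \<eta>) * y0\<^sup>2" using rel by (intro mult_right_mono) auto
  moreover have "x * y0\<^sup>2 \<le> x * (2 * y\<^sup>2 + 128 * \<eta>\<^sup>2)" using y0 nn by (intro mult_left_mono)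
  moreover have "\<eta> * y0\<^sup>2 \<le> \<eta>\<^sup>2 + y0\<^sup>2"
  proof -
    have "\<eta> * y0\<^sup>2 \<le> \<eta> * y0" using nn by (intro mult_left_mono) (auto simp: power2_eq_square mult_left_le)
    also have "\<dots> \<le> \<eta>\<^sup>2 + y0\<^sup>2"
      using sum_squares_bound[of \<eta> y0] mult_nonneg_nonneg[of \<eta> y0] nn by linarith
    finally show ?thesis .
  qed
  moreover have "x * \<eta>\<^sup>2 \<le> (x0 + 8 * \<eta>) * \<eta>\<^sup>2" using rel by (intro mult_right_mono) auto
  ultimately have 1: "x0 * y0\<^sup>2 \<le> 2 * (x * y\<^sup>2) + 16 * y\<^sup>2 + 128 * (x0 * \<eta>\<^sup>2) + 2056 * \<eta>\<^sup>2 + 1024 * \<eta> ^ 4"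
    using y0 eta3 unfolding distrib_left distrib_right mult.assoc mult.left_commute[of _ "numeral _"] by linarith
  have "x1 * y0 \<le> (2 * q + 8 * \<eta>) * (y + 8 * \<eta>)" using rel nn by (intro mult_mono) auto
  also have "\<dots> = 2 * q * y + 8 * (2 * q * \<eta>) + 4 * (2 * \<eta> * y) + 64 * \<eta>\<^sup>2"
    by (simp add: algebra_simps power2_eq_square)
  also have "\<dots> \<le> 9 * q\<^sup>2 + 5 * y\<^sup>2 + 76 * \<eta>\<^sup>2"
    using sum_squares_bound[of q y] sum_squares_bound[of q \<eta>] sum_squares_bound[of \<eta> y] by linarith
  finally have "x1 * y0 \<le> 9 * q\<^sup>2 + 5 * y\<^sup>2 + 76 * \<eta>\<^sup>2" .
  with 1 show ?thesis by (simp add: algebra_simps)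
qed

text \<open>
  One entry $h$ of the matrix and the family $Z$ of all other entries, which is independent of it. The entry is
  given as a coordinate of a variable $X$, because independence of a pair relates two variables with the same type of values. The odd moments
  up to the third vanish, as for a Gaussian variable.
\<close>

locale frozen_edge = prob_space M
  for M :: "'w measure" +
  fixes h :: "'w \<Rightarrow> real" and N\<^sub>h N :: "'z measure" and X Z :: "'w \<Rightarrow> 'z" and coord :: "'z \<Rightarrow> real"
    and m2 m4 m6 :: real
  assumes indep: "indep_var N\<^sub>h X N Z"
    and coord: "coord \<in> borel_measurable N\<^sub>h"
    and h_eq: "\<And>x. h x = coord (X x)"
    and h6_integrable: "integrable M (\<lambda>x. h x ^ 6)"
    and moment1: "(\<integral>x. h x \<partial>M) = 0"
    and moment2: "(\<integral>x. h x ^ 2 \<partial>M) = m2"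
    and moment3: "(\<integral>x. h x ^ 3 \<partial>M) = 0"
    and moment4: "(\<integral>x. h x ^ 4 \<partial>M) = m4"
    and moment6: "(\<integral>x. h x ^ 6 \<partial>M) = m6"
begin

lemma h_measurable [measurable]: "h \<in> borel_measurable M"
  using measurable_compose[OF indep_var_rv1[OF indep] coord] by (simp add: h_eq[abs_def])

lemma Z_measurable [measurable]: "Z \<in> measurable M N"
  using indep_var_rv2[OF indep] .

lemma moments_nonneg: "m2 \<ge> 0" "m4 \<ge> 0" "m6 \<ge> 0"
  unfolding moment2[symmetric] moment4[symmetric] moment6[symmetric] by simp_all

lemma power_integrable: "integrable M (\<lambda>x. \<bar>h x\<bar> ^ k)" "integrable M (\<lambda>x. h x ^ k)" if "k \<le> 6"
  using integrable_power_le[OF h_measurable h6_integrable _ that] by simp_all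

lemma power_times_bounded_integrable:
  fixes f :: "'w \<Rightarrow> 'b::{banach,second_countable_topology,real_normed_algebra_1}"
  assumes "f \<in> borel_measurable M" "\<And>x. norm (f x) \<le> B" "k \<le> 6"
  shows "integrable M (\<lambda>x. of_real (h x ^ k) * f x)"
proof (rule Bochner_Integration.integrable_bound)
  show "integrable M (\<lambda>x. B * \<bar>h x\<bar> ^ k)" using assms by (intro integrable_mult_right power_integrable)
  show "(\<lambda>x. of_real (h x ^ k) * f x) \<in> borel_measurable M" using assms by measurable
  show "AE x in M. norm (of_real (h x ^ k) * f x) \<le> norm (B * \<bar>h x\<bar> ^ k)"
  proof (rule AE_I2)
    fix x
    have "norm (of_real (h x ^ k) * f x) \<le> \<bar>h x\<bar> ^ k * norm (f x)"
      by (rule order.trans[OF norm_mult_ineq]) (simp only: norm_of_real power_abs order_refl)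
    also have "\<dots> \<le> \<bar>h x\<bar> ^ k * B" using assms(2) by (intro mult_left_mono) auto
    also have "\<dots> \<le> norm (B * \<bar>h x\<bar> ^ k)" by (simp add: mult.commute)
    finally show "norm (of_real (h x ^ k) * f x) \<le> norm (B * \<bar>h x\<bar> ^ k)" .
  qed
qed

lemma frozen_expectation:
  fixes F :: "'z \<Rightarrow> 'b::{banach,second_countable_topology,real_normed_field}"
  assumes F: "F \<in> borel_measurable N" "\<And>x. norm (F (Z x)) \<le> B" and k: "k \<le> 6"
  shows "(\<integral>x. of_real (h x ^ k) * F (Z x) \<partial>M) = of_real (\<integral>x. h x ^ k \<partial>M) * (\<integral>x. F (Z x) \<partial>M)"
proof -
  have i: "integrable M (\<lambda>x. F (Z x))"
    using F measurable_compose[OF Z_measurable F(1)] by (intro bounded_integrable) auto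
  have "(\<integral>x. of_real (h x ^ k) * F (Z x) \<partial>M)
      = (\<integral>x. of_real (h x ^ k) \<partial>M) * (\<integral>x. F (Z x) \<partial>M)"
    using i F k power_integrable(2)[OF k] coord by (intro expectation_mult_indep(2)[OF indep, of "\<lambda>x. of_real (coord x ^ k)", folded h_eq])
       (auto simp del: of_real_power intro!: integrable_of_real borel_measurable_of_real borel_measurable_power)
  moreover have "(\<integral>x. of_real (h x ^ k) \<partial>M) = (of_real (\<integral>x. h x ^ k \<partial>M) :: 'b)"
    by (rule integral_bounded_linear[OF bounded_linear_of_real power_integrable(2)[OF k]])
  ultimately show ?thesis by (simp only:)
qed


text \<open>
  The coefficients of the expansion in $h$ are functions of the other entries. The bound $B$, which may grow
  with the size of the matrix, makes all expectations exist.
\<close>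

definition frozen_jet ::
  "real \<Rightarrow> ('w \<Rightarrow> complex) \<Rightarrow> ('z \<Rightarrow> complex) \<Rightarrow> ('z \<Rightarrow> complex) \<Rightarrow> ('z \<Rightarrow> complex) \<Rightarrow> bool" where
  "frozen_jet B f f0 f1 f2 \<longleftrightarrow>
     f \<in> borel_measurable M \<and> f0 \<in> borel_measurable N \<and> f1 \<in> borel_measurable N \<and> f2 \<in> borel_measurable N
     \<and> (\<forall>x. cmod (f x) \<le> B \<and> cmod (f0 (Z x)) \<le> B
          \<and> jet 8 (h x) (f x) (f0 (Z x)) (f1 (Z x)) (f2 (Z x)))"

lemma frozen_jetD:
  assumes "frozen_jet B f f0 f1 f2"
  shows "f \<in> borel_measurable M" "f0 \<in> borel_measurable N" "f1 \<in> borel_measurable N" "f2 \<in> borel_measurable N"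
    "cmod (f x) \<le> B" "cmod (f0 (Z x)) \<le> B" "cmod (f1 (Z x)) \<le> 8" "cmod (f2 (Z x)) \<le> 8"
    "jet 8 (h x) (f x) (f0 (Z x)) (f1 (Z x)) (f2 (Z x))"
  using assms unfolding frozen_jet_def jet_def by blast+

text \<open>
  Integration by parts up to fourth order: $E\{h F(h)\} = E h^2\, E F'(0) + O(E h^4)$ with $F = f g$, because the first
  and the third moment vanish.
\<close>

lemma gaussian_first_order:
  assumes f: "frozen_jet B f f0 f1 f2" and g: "frozen_jet 1 g g0 g1 g2"
  shows "cmod ((\<integral>x. of_real (h x) * (f x * g x) \<partial>M)
      - of_real m2 * (\<integral>x. f0 (Z x) * g1 (Z x) + f1 (Z x) * g0 (Z x) \<partial>M))
    \<le> 200 * m4 + 8 * (m4 * (\<integral>x. cmod (f0 (Z x)) \<partial>M)) + 64 * m6"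
proof -
  note F = frozen_jetD[OF f] and G = frozen_jetD[OF g]
  note [measurable] = F(1-4) G(1-4)
  define c1 where "c1 = (\<lambda>\<zeta>. f0 \<zeta> * g0 \<zeta>)"
  define c2 where "c2 = (\<lambda>\<zeta>. f0 \<zeta> * g1 \<zeta> + f1 \<zeta> * g0 \<zeta>)"
  define c3 where "c3 = (\<lambda>\<zeta>. f0 \<zeta> * g2 \<zeta> + f1 \<zeta> * g1 \<zeta> + f2 \<zeta> * g0 \<zeta>)"
  have m [measurable]: "c1 \<in> borel_measurable N" "c2 \<in> borel_measurable N" "c3 \<in> borel_measurable N"
    unfolding c1_def c2_def c3_def by measurable
  have b: "cmod (c1 (Z x)) \<le> B * 1" "cmod (c2 (Z x)) \<le> B * 8 + 8 * 1"
    "cmod (c3 (Z x)) \<le> B * 8 + 8 * 8 + 8 * 1" for x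
    unfolding c1_def c2_def c3_def by (intro norm_triangle_mono norm_mult_le F G)+
  define P where "P = (\<lambda>x. of_real (h x ^ 1) * c1 (Z x) + of_real (h x ^ 2) * c2 (Z x) + of_real (h x ^ 3) * c3 (Z x))"
  have i: "integrable M (\<lambda>x. of_real (h x ^ 1) * c1 (Z x))" "integrable M (\<lambda>x. of_real (h x ^ 2) * c2 (Z x))"
    "integrable M (\<lambda>x. of_real (h x ^ 3) * c3 (Z x))"
    using power_times_bounded_integrable[OF measurable_compose[OF Z_measurable m(1)] b(1), of 1]
      power_times_bounded_integrable[OF measurable_compose[OF Z_measurable m(2)] b(2), of 2]
      power_times_bounded_integrable[OF measurable_compose[OF Z_measurable m(3)] b(3), of 3]
    by simp_all
  have iP: "integrable M P" unfolding P_def using i by auto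
  have EP: "(\<integral>x. P x \<partial>M) = of_real m2 * (\<integral>x. c2 (Z x) \<partial>M)"
  proof -
    have "(\<integral>x. P x \<partial>M) = (\<integral>x. of_real (h x ^ 1) * c1 (Z x) \<partial>M) + (\<integral>x. of_real (h x ^ 2) * c2 (Z x) \<partial>M)
        + (\<integral>x. of_real (h x ^ 3) * c3 (Z x) \<partial>M)"
      unfolding P_def using i by (simp del: of_real_power)
    also have "\<dots> = of_real (\<integral>x. h x ^ 1 \<partial>M) * (\<integral>x. c1 (Z x) \<partial>M) + of_real (\<integral>x. h x ^ 2 \<partial>M) * (\<integral>x. c2 (Z x) \<partial>M)
       + of_real (\<integral>x. h x ^ 3 \<partial>M) * (\<integral>x. c3 (Z x) \<partial>M)"
      by (intro arg_cong2[where f = plus] frozen_expectation[OF m(1) b(1)] frozen_expectation[OF m(2) b(2)] frozen_expectation[OF m(3) b(3)]) auto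
    finally show ?thesis using moment1 moment2 moment3 by simp
  qed
  define e where "e = (\<lambda>x. 200 * h x ^ 4 + 8 * (h x ^ 4 * cmod (f0 (Z x))) + 64 * h x ^ 6)"
  have i4: "integrable M (\<lambda>x. of_real (h x ^ 4) * cmod (f0 (Z x)))"
    by (rule power_times_bounded_integrable[of _ B]) (use F in \<open>auto\<close>)
  have ie: "integrable M e" unfolding e_def using i4 power_integrable(2)[of 4] h6_integrable by auto
  have "cmod ((\<integral>x. of_real (h x) * (f x * g x) \<partial>M) - (\<integral>x. P x \<partial>M)) \<le> (\<integral>x. e x \<partial>M)"
  proof (rule norm_expectation_diff_le[OF _ iP ie])
    have "integrable M (\<lambda>x. of_real (h x ^ 1) * (f x * g x))"
    proof (rule power_times_bounded_integrable)
      show "(\<lambda>x. f x * g x) \<in> borel_measurable M" by measurable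
      show "cmod (f x * g x) \<le> B * 1" for x by (intro norm_mult_le F(5) G(5))
    qed simp
    thus "integrable M (\<lambda>x. of_real (h x) * (f x * g x))" by simp
    fix x
    have "of_real (h x) * (f x * g x) - P x = of_real (h x) * (f x * g x - (f0 (Z x) * g0 (Z x)
       + of_real (h x) * (f0 (Z x) * g1 (Z x) + f1 (Z x) * g0 (Z x))
       + of_real ((h x)\<^sup>2) * (f0 (Z x) * g2 (Z x) + f1 (Z x) * g1 (Z x) + f2 (Z x) * g0 (Z x))))"
      unfolding P_def c1_def c2_def c3_def by (simp add: algebra_simps power2_eq_square power3_eq_cube)
    also have "cmod \<dots> \<le> \<bar>h x\<bar> * ((136 + 8 * cmod (f0 (Z x))) * \<bar>h x\<bar> ^ 3 + 64 * h x ^ 4)"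
      unfolding norm_mult norm_of_real by (intro mult_left_mono jet_product F(9) G(9) G(6)) auto
    also have "\<dots> = (136 + 8 * cmod (f0 (Z x))) * h x ^ 4 + 64 * \<bar>h x\<bar> ^ 5"
      by (simp add: power_even_abs[symmetric, of 4 "h x"] algebra_simps eval_nat_numeral del: power_even_abs)
    also have "\<dots> \<le> e x" using powers_sandwiched(3)[of "h x"] by (simp add: e_def algebra_simps)
    finally show "cmod (of_real (h x) * (f x * g x) - P x) \<le> e x" .
  qed
  also have "(\<integral>x. e x \<partial>M) = 200 * m4 + 8 * (\<integral>x. h x ^ 4 * cmod (f0 (Z x)) \<partial>M) + 64 * m6"
    unfolding e_def using i4 power_integrable(2)[of 4] h6_integrable moment4 moment6 by simp
  also have "(\<integral>x. h x ^ 4 * cmod (f0 (Z x)) \<partial>M) = m4 * (\<integral>x. cmod (f0 (Z x)) \<partial>M)"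
    using frozen_expectation[of "\<lambda>\<zeta>. cmod (f0 \<zeta>)" B 4] F moment4 by simp
  finally show ?thesis unfolding EP c2_def .
qed

text \<open>
  Freezing an entry changes an expectation by second order in $h$ only, because the first moment vanishes.
\<close>

lemma frozen_triple_product:
  assumes f: "frozen_jet B f f0 f1 f2" and g: "frozen_jet 1 g g0 g1 g2" and k: "frozen_jet 1 k k0 k1 k2"
  shows "cmod ((\<integral>x. f x * (g x * k x) \<partial>M) - (\<integral>x. f0 (Z x) * (g0 (Z x) * k0 (Z x)) \<partial>M))
    \<le> 776 * m2 + 80 * (m2 * (\<integral>x. cmod (f0 (Z x)) \<partial>M)) + 640 * m4"
proof -
  note F = frozen_jetD[OF f] and G = frozen_jetD[OF g] and K = frozen_jetD[OF k]
  note [measurable] = F(1-4) G(1-4) K(1-4)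
  define c0 where "c0 = (\<lambda>\<zeta>. f0 \<zeta> * (g0 \<zeta> * k0 \<zeta>))"
  define c1 where "c1 = (\<lambda>\<zeta>. f0 \<zeta> * (g0 \<zeta> * k1 \<zeta> + g1 \<zeta> * k0 \<zeta>) + f1 \<zeta> * (g0 \<zeta> * k0 \<zeta>))"
  have m [measurable]: "c0 \<in> borel_measurable N" "c1 \<in> borel_measurable N"
    unfolding c0_def c1_def by measurable
  have b: "cmod (c0 (Z x)) \<le> B * (1 * 1)" "cmod (c1 (Z x)) \<le> B * (1 * 8 + 8 * 1) + 8 * (1 * 1)" for x
    unfolding c0_def c1_def by (intro norm_triangle_mono norm_mult_le F G K)+
  define P where "P = (\<lambda>x. c0 (Z x) + of_real (h x ^ 1) * c1 (Z x))"
  have i: "integrable M (\<lambda>x. c0 (Z x))" "integrable M (\<lambda>x. of_real (h x ^ 1) * c1 (Z x))"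
    using bounded_integrable[OF measurable_compose[OF Z_measurable m(1)] b(1)]
      power_times_bounded_integrable[OF measurable_compose[OF Z_measurable m(2)] b(2), of 1]
    by simp_all
  have iP: "integrable M P" unfolding P_def using i by auto
  have EP: "(\<integral>x. P x \<partial>M) = (\<integral>x. c0 (Z x) \<partial>M)"
  proof -
    have "(\<integral>x. P x \<partial>M) = (\<integral>x. c0 (Z x) \<partial>M) + (\<integral>x. of_real (h x ^ 1) * c1 (Z x) \<partial>M)"
      unfolding P_def using i by (simp del: of_real_power)
    also have "(\<integral>x. of_real (h x ^ 1) * c1 (Z x) \<partial>M) = 0"
      using frozen_expectation[OF m(2) b(2), of 1] moment1 by simp
    finally show ?thesis by simp
  qed
  define e where "e = (\<lambda>x. 776 * h x ^ 2 + 80 * (h x ^ 2 * cmod (f0 (Z x))) + 640 * h x ^ 4)"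
  have i2: "integrable M (\<lambda>x. of_real (h x ^ 2) * cmod (f0 (Z x)))"
    by (rule power_times_bounded_integrable[of _ B]) (use F in \<open>auto\<close>)
  have ie: "integrable M e" unfolding e_def using i2 power_integrable(2)[of 4] power_integrable(2)[of 2] by auto
  have "cmod ((\<integral>x. f x * (g x * k x) \<partial>M) - (\<integral>x. P x \<partial>M)) \<le> (\<integral>x. e x \<partial>M)"
  proof (rule norm_expectation_diff_le[OF _ iP ie])
    show "integrable M (\<lambda>x. f x * (g x * k x))"
    proof (rule bounded_integrable)
      show "(\<lambda>x. f x * (g x * k x)) \<in> borel_measurable M" by measurable
      show "cmod (f x * (g x * k x)) \<le> B * (1 * 1)" for x
        by (intro norm_mult_le F(5) G(5) K(5))
    qed
    fix x
    have "cmod (f x * (g x * k x) - P x) \<le> (136 + 80 * cmod (f0 (Z x))) * (h x)\<^sup>2 + 640 * \<bar>h x\<bar> ^ 3"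
      using jet_triple_product[OF F(9) G(9) K(9) G(6) K(6) G(5) K(5), of x]
      unfolding P_def c0_def c1_def by simp
    also have "\<dots> \<le> e x" using powers_sandwiched(2)[of "h x"] by (simp add: e_def algebra_simps)
    finally show "cmod (f x * (g x * k x) - P x) \<le> e x" .
  qed
  also have "(\<integral>x. e x \<partial>M) = 776 * m2 + 80 * (\<integral>x. h x ^ 2 * cmod (f0 (Z x)) \<partial>M) + 640 * m4"
    unfolding e_def using i2 power_integrable(2)[of 4] power_integrable(2)[of 2] moment2 moment4 by simp
  also have "(\<integral>x. h x ^ 2 * cmod (f0 (Z x)) \<partial>M) = m2 * (\<integral>x. cmod (f0 (Z x)) \<partial>M)"
    using frozen_expectation[of "\<lambda>\<zeta>. cmod (f0 \<zeta>)" B 2] F moment2 by simp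
  finally show ?thesis unfolding EP c0_def .
qed


text \<open>
  The terms of the derivative of $f g$ with two off-diagonal factors. The right-hand side contains the true
  entry $g$ and the pairing $q$, whose squares are summable along a row.
\<close>

lemma frozen_off_diagonal_bound:
  assumes f: "frozen_jet B f f0 f1 f2" and g: "frozen_jet 1 g g0 g1 g2"
    and q: "q \<in> borel_measurable M" "\<And>x. 0 \<le> q x" "\<And>x. q x \<le> 1"
      "\<And>x. cmod (f1 (Z x)) \<le> 2 * q x + 8 * \<bar>h x\<bar>"
  shows "(\<integral>x. cmod (f0 (Z x)) * (cmod (g0 (Z x)))\<^sup>2 + cmod (f1 (Z x)) * cmod (g0 (Z x)) \<partial>M)
    \<le> (\<integral>x. (2 * cmod (f x) + 21) * (cmod (g x))\<^sup>2 + 9 * (q x)\<^sup>2 \<partial>M)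
        + 128 * (m2 * (\<integral>x. cmod (f0 (Z x)) \<partial>M)) + 2132 * m2 + 1024 * m4"
proof -
  note F = frozen_jetD[OF f] and G = frozen_jetD[OF g]
  note [measurable] = F(1-4) G(1-4) q(1)
  have B0: "0 \<le> B" using F(5)[of undefined] norm_ge_zero[of "f undefined"] by linarith
  have sq1: "(cmod (g x))\<^sup>2 \<le> 1" "(cmod (g0 (Z x)))\<^sup>2 \<le> 1" "(q x)\<^sup>2 \<le> 1" for x
    by (rule power_le_one[OF norm_ge_zero G(5)] power_le_one[OF norm_ge_zero G(6)] power_le_one[OF q(2) q(3)])+
  define L where "L = (\<lambda>x. cmod (f0 (Z x)) * (cmod (g0 (Z x)))\<^sup>2 + cmod (f1 (Z x)) * cmod (g0 (Z x)))"
  define R where "R = (\<lambda>x. (2 * cmod (f x) + 21) * (cmod (g x))\<^sup>2 + 9 * (q x)\<^sup>2)"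
  have iL: "integrable M L"
  proof (rule bounded_integrable)
    show "norm (L x) \<le> B * 1 + 8 * 1" for x
    proof -
      have "0 \<le> L x" unfolding L_def by (intro add_nonneg_nonneg mult_nonneg_nonneg) auto
      moreover have "L x \<le> B * 1 + 8 * 1"
        unfolding L_def using F(6,7)[of x] G(6)[of x] sq1[of x] B0 by (intro add_mono mult_mono) auto
      ultimately show ?thesis by simp
    qed
  qed (simp add: L_def)
  have iR: "integrable M R"
  proof (rule bounded_integrable)
    show "norm (R x) \<le> (2 * B + 21) * 1 + 9 * 1" for x
    proof -
      have "0 \<le> R x" unfolding R_def by (intro add_nonneg_nonneg mult_nonneg_nonneg) auto
      moreover have "R x \<le> (2 * B + 21) * 1 + 9 * 1"
        unfolding R_def using F(5)[of x] sq1[of x] B0 by (intro add_mono mult_mono) auto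
      ultimately show ?thesis by simp
    qed
  qed (simp add: R_def)
  define e where "e = (\<lambda>x. 128 * (h x ^ 2 * cmod (f0 (Z x))) + 2132 * h x ^ 2 + 1024 * h x ^ 4)"
  have i2: "integrable M (\<lambda>x. h x ^ 2 * cmod (f0 (Z x)))"
    using power_times_bounded_integrable[of "\<lambda>x. cmod (f0 (Z x))" B 2] F by simp
  have ie: "integrable M e" unfolding e_def using i2 power_integrable(2)[of 4] power_integrable(2)[of 2] by auto
  have "(\<integral>x. L x \<partial>M) \<le> (\<integral>x. R x + e x \<partial>M)"
  proof (rule integral_mono[OF iL Bochner_Integration.integrable_add[OF iR ie]])
    fix x
    define a where "a = cmod (f x)"
    define a0 where "a0 = cmod (f0 (Z x))"
    define y where "y = cmod (g x)"
    define y0 where "y0 = cmod (g0 (Z x))"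
    define \<eta> where "\<eta> = \<bar>h x\<bar>"
    define a1 where "a1 = cmod (f1 (Z x))"
    have nn: "0 \<le> a" "0 \<le> a0" "0 \<le> y" "0 \<le> y0" "0 \<le> \<eta>" "0 \<le> a1" "y0 \<le> 1" "0 \<le> q x"
      using q G unfolding a_def a0_def y_def y0_def \<eta>_def a1_def by auto
    have rel: "a0 \<le> a + 8 * \<eta>" "a \<le> a0 + 8 * \<eta>" "y0 \<le> y + 8 * \<eta>" "a1 \<le> 2 * q x + 8 * \<eta>"
      using jet_bounds(6,7)[OF F(9), of x] jet_bounds(6,7)[OF G(9), of x] q(4)[of x]
      unfolding a_def a0_def y_def y0_def \<eta>_def a1_def by auto
    have "a0 * y0\<^sup>2 + a1 * y0 \<le> (2 * a + 21) * y\<^sup>2 + 9 * (q x)\<^sup>2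
        + (128 * (\<eta>\<^sup>2 * a0) + 2132 * \<eta>\<^sup>2 + 1024 * \<eta> ^ 4)"
      by (rule unfreezing_inequality[OF nn rel])
    thus "L x \<le> R x + e x"
      unfolding L_def R_def e_def a_def a0_def y_def y0_def \<eta>_def a1_def by simp
  qed
  also have "\<dots> = (\<integral>x. R x \<partial>M) + (\<integral>x. e x \<partial>M)" using iR ie by simp
  also have "(\<integral>x. e x \<partial>M) = 128 * (\<integral>x. h x ^ 2 * cmod (f0 (Z x)) \<partial>M) + 2132 * m2 + 1024 * m4"
    unfolding e_def using i2 power_integrable(2)[of 4] power_integrable(2)[of 2] moment2 moment4 by simp
  also have "(\<integral>x. h x ^ 2 * cmod (f0 (Z x)) \<partial>M) = m2 * (\<integral>x. cmod (f0 (Z x)) \<partial>M)"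
    using frozen_expectation[of "\<lambda>\<zeta>. cmod (f0 \<zeta>)" B 2] F moment2 by simp
  finally show ?thesis unfolding L_def R_def by simp
qed

lemma frozen_mean_bound:
  assumes f: "frozen_jet B f f0 f1 f2"
  shows "(\<integral>x. cmod (f0 (Z x)) \<partial>M) \<le> (\<integral>x. cmod (f x) \<partial>M) + 8 * (1 + m2)"
proof -
  note F = frozen_jetD[OF f]
  note [measurable] = F(1-4)
  have i: "integrable M (\<lambda>x. cmod (f x))" "integrable M (\<lambda>x. cmod (f0 (Z x)))"
    using bounded_integrable[of "\<lambda>x. cmod (f x)" B] bounded_integrable[of "\<lambda>x. cmod (f0 (Z x))" B] F(5,6)
    by simp_all
  have i2: "integrable M (\<lambda>x. h x ^ 2)" by (rule power_integrable(2)) simp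
  have "(\<integral>x. cmod (f0 (Z x)) \<partial>M) \<le> (\<integral>x. cmod (f x) + 8 * (1 + h x ^ 2) \<partial>M)"
  proof (rule integral_mono)
    fix x show "cmod (f0 (Z x)) \<le> cmod (f x) + 8 * (1 + h x ^ 2)"
      using powers_sandwiched(1)[of "h x"] by (intro order.trans[OF jet_bounds(7)[OF F(9)]]) simp
  qed (use i i2 in auto)
  also have "\<dots> = (\<integral>x. cmod (f x) \<partial>M) + 8 * (1 + m2)"
    using i i2 moment2 by (simp add: prob_space)
  finally show ?thesis .
qed

text \<open>
  In the application, $f$ is a fluctuation, $g$ the entry $G(i,p)$, and $k, l$ are the diagonal entries at $i$ and
  $p$. The derivative of $g$ is $-k l$ up to the square of $g$, which is the content of the assumption on $g_1$.
\<close>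

lemma edge_estimate:
  assumes f: "frozen_jet B f f0 f1 f2" and g: "frozen_jet 1 g g0 g1 g2"
    and k: "frozen_jet 1 k k0 k1 k2" and l: "frozen_jet 1 l l0 l1 l2"
    and g1: "\<And>x. cmod (g1 (Z x) + k0 (Z x) * l0 (Z x)) \<le> (cmod (g0 (Z x)))\<^sup>2"
    and q: "q \<in> borel_measurable M" "\<And>x. 0 \<le> q x" "\<And>x. q x \<le> 1"
      "\<And>x. cmod (f1 (Z x)) \<le> 2 * q x + 8 * \<bar>h x\<bar>"
  defines "t \<equiv> (\<integral>x. cmod (f0 (Z x)) \<partial>M)"
  shows "cmod ((\<integral>x. of_real (h x) * (f x * g x) \<partial>M) + of_real m2 * (\<integral>x. f x * (k x * l x) \<partial>M))
    \<le> m2 * (\<integral>x. (2 * cmod (f x) + 21) * (cmod (g x))\<^sup>2 + 9 * (q x)\<^sup>2 \<partial>M)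
       + (200 * m4 + 64 * m6 + 8 * (m4 * t) + 2908 * m2\<^sup>2 + 208 * (m2\<^sup>2 * t) + 1664 * (m2 * m4))"
proof -
  note F = frozen_jetD[OF f] and G = frozen_jetD[OF g] and K = frozen_jetD[OF k] and L = frozen_jetD[OF l]
  note [measurable] = F(1-4) G(1-4) K(1-4) L(1-4)
  let ?E1 = "\<integral>x. of_real (h x) * (f x * g x) \<partial>M"
  let ?E2 = "\<integral>x. f x * (k x * l x) \<partial>M"
  let ?A = "\<integral>x. f0 (Z x) * g1 (Z x) + f1 (Z x) * g0 (Z x) \<partial>M"
  let ?C = "\<integral>x. f0 (Z x) * (k0 (Z x) * l0 (Z x)) \<partial>M"
  let ?R = "\<integral>x. (2 * cmod (f x) + 21) * (cmod (g x))\<^sup>2 + 9 * (q x)\<^sup>2 \<partial>M"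
  have iA: "integrable M (\<lambda>x. f0 (Z x) * g1 (Z x) + f1 (Z x) * g0 (Z x))"
  proof (rule bounded_integrable)
    show "cmod (f0 (Z x) * g1 (Z x) + f1 (Z x) * g0 (Z x)) \<le> B * 8 + 8 * 1" for x
      by (intro norm_triangle_mono norm_mult_le F(6,7) G(6,7))
  qed measurable
  have iC: "integrable M (\<lambda>x. f0 (Z x) * (k0 (Z x) * l0 (Z x)))"
  proof (rule bounded_integrable)
    show "cmod (f0 (Z x) * (k0 (Z x) * l0 (Z x))) \<le> B * (1 * 1)" for x
      by (intro norm_mult_le F(6) K(6) L(6))
  qed measurable
  have "cmod (?A + ?C) \<le> (\<integral>x. cmod (f0 (Z x)) * (cmod (g0 (Z x)))\<^sup>2 + cmod (f1 (Z x)) * cmod (g0 (Z x)) \<partial>M)"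
  proof -
    have "?A + ?C = (\<integral>x. f0 (Z x) * (g1 (Z x) + k0 (Z x) * l0 (Z x)) + f1 (Z x) * g0 (Z x) \<partial>M)"
      using iA iC by (subst Bochner_Integration.integral_add[symmetric]) (auto simp: algebra_simps)
    also have "cmod \<dots> \<le> (\<integral>x. cmod (f0 (Z x)) * (cmod (g0 (Z x)))\<^sup>2 + cmod (f1 (Z x)) * cmod (g0 (Z x)) \<partial>M)"
    proof (rule order.trans[OF integral_norm_bound integral_mono[OF integrable_norm]])
      show "integrable M (\<lambda>x. f0 (Z x) * (g1 (Z x) + k0 (Z x) * l0 (Z x)) + f1 (Z x) * g0 (Z x))"
        using Bochner_Integration.integrable_add[OF iA iC] by (simp add: algebra_simps)
      show "integrable M (\<lambda>x. cmod (f0 (Z x)) * (cmod (g0 (Z x)))\<^sup>2 + cmod (f1 (Z x)) * cmod (g0 (Z x)))"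
      proof (rule bounded_integrable[of _ "B * 1 + 8 * 1"])
        have B0: "0 \<le> B" using F(5)[of undefined] norm_ge_zero[of "f undefined"] by linarith
        show "norm (cmod (f0 (Z x)) * (cmod (g0 (Z x)))\<^sup>2 + cmod (f1 (Z x)) * cmod (g0 (Z x))) \<le> B * 1 + 8 * 1"
          (is "norm ?L \<le> _") for x
        proof -
          have "0 \<le> ?L" by (intro add_nonneg_nonneg mult_nonneg_nonneg) auto
          moreover have "?L \<le> B * 1 + 8 * 1"
            using F(6,7)[of x] G(6)[of x] B0 by (intro add_mono mult_mono) (auto simp: power_le_one)
          ultimately show ?thesis by simp
        qed
      qed measurable
      fix x
      show "norm (f0 (Z x) * (g1 (Z x) + k0 (Z x) * l0 (Z x)) + f1 (Z x) * g0 (Z x))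
          \<le> cmod (f0 (Z x)) * (cmod (g0 (Z x)))\<^sup>2 + cmod (f1 (Z x)) * cmod (g0 (Z x))"
        by (intro norm_triangle_mono norm_mult_le g1 order_refl)
    qed
    finally show ?thesis .
  qed
  also have "\<dots> \<le> ?R + 128 * (m2 * t) + 2132 * m2 + 1024 * m4"
    unfolding t_def by (rule frozen_off_diagonal_bound[OF f g q])
  finally have AC: "cmod (?A + ?C) \<le> ?R + 128 * (m2 * t) + 2132 * m2 + 1024 * m4" .
  have collect: "(200 * m4 + 8 * (m4 * t) + 64 * m6)
      + m2 * (776 * m2 + 80 * (m2 * t) + 640 * m4) + m2 * (R + 128 * (m2 * t) + 2132 * m2 + 1024 * m4)
    = m2 * R + (200 * m4 + 64 * m6 + 8 * (m4 * t) + 2908 * m2\<^sup>2 + 208 * (m2\<^sup>2 * t) + 1664 * (m2 * m4))"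
    for R by (simp add: algebra_simps power2_eq_square)
  have split: "?E1 + of_real m2 * ?E2 = (?E1 - of_real m2 * ?A) + of_real m2 * (?E2 - ?C) + of_real m2 * (?A + ?C)"
    by (simp add: algebra_simps)
  have bound: "cmod ((?E1 - of_real m2 * ?A) + of_real m2 * (?E2 - ?C) + of_real m2 * (?A + ?C))
    \<le> (200 * m4 + 8 * (m4 * t) + 64 * m6)
      + m2 * (776 * m2 + 80 * (m2 * t) + 640 * m4) + m2 * (?R + 128 * (m2 * t) + 2132 * m2 + 1024 * m4)"
  proof (intro norm_triangle_mono)
    show "cmod (?E1 - of_real m2 * ?A) \<le> 200 * m4 + 8 * (m4 * t) + 64 * m6"
      unfolding t_def by (rule gaussian_first_order[OF f g])
    show "cmod (of_real m2 * (?E2 - ?C)) \<le> m2 * (776 * m2 + 80 * (m2 * t) + 640 * m4)"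
      using frozen_triple_product[OF f k l] moments_nonneg unfolding t_def
      by (simp add: norm_mult mult_left_mono)
    show "cmod (of_real m2 * (?A + ?C)) \<le> m2 * (?R + 128 * (m2 * t) + 2132 * m2 + 1024 * m4)"
      using AC moments_nonneg by (simp only: norm_mult norm_of_real abs_of_nonneg) (intro mult_left_mono, auto)
  qed
  show ?thesis unfolding split by (rule order.trans[OF bound eq_refl[OF collect]])
qed

end

section \<open>Band matrices of a fixed size\<close>

lemma jet_id_or_cnj:
  assumes "\<rho> \<in> {id, cnj}" "jet K h f f0 f1 f2"
  shows "jet K h (\<rho> (f - c)) (\<rho> (f0 - c)) (\<rho> f1) (\<rho> f2)"
proof -
  have "jet K h (f - c) (f0 - c) f1 f2" using assms(2) by (simp add: jet_def)
  moreover have "jet K h (cnj x) (cnj x0) (cnj x1) (cnj x2)" if x: "jet K h x x0 x1 x2" for x x0 x1 x2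
  proof -
    have "cmod (cnj x - cnj x0) = cmod (x - x0)"
      "cmod (cnj x - cnj x0 - of_real h * cnj x1) = cmod (x - x0 - of_real h * x1)"
      "cmod (cnj x - cnj x0 - of_real h * cnj x1 - of_real (h\<^sup>2) * cnj x2)
        = cmod (x - x0 - of_real h * x1 - of_real (h\<^sup>2) * x2)"
      by (subst (2) complex_mod_cnj[symmetric], simp del: complex_mod_cnj)+
    thus ?thesis using x by (simp add: jet_def)
  qed
  ultimately show ?thesis using assms(1) by auto
qed

text \<open>
  With $\tau = \psi/\beta \le 1/\beta$, all error terms of \<open>edge_estimate\<close> are of order $\tau/\beta$, so that their sum over
  a row is of order $1/\beta$. The number $13172$ only adds up the numerical constants
  $600 + 960 + 384 + 2908 + 3328 + 4992$ of the six terms.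
\<close>

lemma edge_error_bound:
  fixes v \<tau> \<beta> \<sigma> t :: real
  assumes \<beta>: "1 \<le> \<beta>" and \<tau>: "0 \<le> \<tau>" "\<tau> \<le> 1 / \<beta>" and \<sigma>: "0 \<le> \<sigma>" and t: "0 \<le> t" "t \<le> \<sigma> + 8 * (1 + m2)"
    and m: "m2 = v\<^sup>2 * \<tau>" "m4 = 3 * v ^ 4 * \<tau> / \<beta>" "m6 = 15 * v ^ 6 * \<tau> / \<beta>\<^sup>2"
  defines "c \<equiv> 1 + v\<^sup>2"
  shows "200 * m4 + 64 * m6 + 8 * (m4 * t) + 2908 * m2\<^sup>2 + 208 * (m2\<^sup>2 * t) + 1664 * (m2 * m4)
    \<le> 13172 * c ^ 3 * (1 + \<sigma>) * (\<tau> / \<beta>)"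
proof -
  define \<kappa> where "\<kappa> = \<tau> / \<beta>"
  have \<kappa>: "0 \<le> \<kappa>" using \<tau> \<beta> by (simp add: \<kappa>_def)
  have \<tau>1: "\<tau> \<le> 1" using \<tau> \<beta> by (auto intro: order.trans)
  have \<tau>2: "\<tau> * \<tau> \<le> \<kappa>" using mult_left_mono[OF \<tau>(2,1)] by (simp add: \<kappa>_def)
  have \<kappa>\<beta>: "\<kappa> / \<beta> \<le> \<kappa>" using \<kappa> \<beta> by (simp add: divide_le_eq mult_le_cancel_left1)
  have c: "1 \<le> c" "v\<^sup>2 \<le> c" "0 \<le> v\<^sup>2" by (simp_all add: c_def)
  have c0: "0 \<le> c" using c by simp
  have cp: "c \<le> c ^ 3" "c\<^sup>2 \<le> c ^ 3" using c power_increasing[of 1 3 c] power_increasing[of 2 3 c] by simp_all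
  have v4: "v ^ 4 \<le> c\<^sup>2" "v ^ 6 \<le> c ^ 3"
    using power_mono[OF c(2,3), of 2] power_mono[OF c(2,3), of 3] by (simp_all flip: power_mult)
  have v40: "0 \<le> v ^ 4" "0 \<le> v ^ 6" by simp_all
  have m4: "0 \<le> m4" "m4 \<le> 3 * (c\<^sup>2 * \<kappa>)"
  proof -
    have "m4 = 3 * (v ^ 4 * \<kappa>)" by (simp add: m \<kappa>_def)
    thus "0 \<le> m4" "m4 \<le> 3 * (c\<^sup>2 * \<kappa>)"
      using mult_right_mono[OF v4(1) \<kappa>] mult_nonneg_nonneg[OF v40(1) \<kappa>] by linarith+
  qed
  have m6: "m6 \<le> 15 * (c ^ 3 * \<kappa>)"
  proof -
    have "m6 = 15 * (v ^ 6 * (\<kappa> / \<beta>))" by (simp add: m \<kappa>_def power2_eq_square)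
    also have "v ^ 6 * (\<kappa> / \<beta>) \<le> c ^ 3 * \<kappa>" using v4 v40 \<kappa> \<kappa>\<beta> c0 \<beta> by (intro mult_mono) auto
    finally show ?thesis by simp
  qed
  have m2: "0 \<le> m2" "m2 \<le> c" using mult_mono[OF c(2) \<tau>1 c0 \<tau>(1)] c \<tau> by (simp_all add: m)
  have m22: "0 \<le> m2\<^sup>2" "m2\<^sup>2 \<le> c\<^sup>2 * \<kappa>"
  proof -
    have "m2\<^sup>2 = v ^ 4 * (\<tau> * \<tau>)" by (simp add: m power_mult_distrib power2_eq_square eval_nat_numeral)
    also have "\<dots> \<le> c\<^sup>2 * \<kappa>" using v4 v40 \<tau>2 \<tau> c0 by (intro mult_mono) auto
    finally show "m2\<^sup>2 \<le> c\<^sup>2 * \<kappa>" .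
  qed simp
  have t16: "t \<le> 16 * (c * (1 + \<sigma>))"
  proof -
    have "t \<le> \<sigma> + 8 + 8 * m2" using t(2) by (simp add: distrib_left)
    also have "\<dots> \<le> \<sigma> + 16 * c" using m2 c by linarith
    also have "\<dots> \<le> 16 * (c * (1 + \<sigma>))"
      using mult_right_mono[OF c(1) \<sigma>] \<sigma> by (simp add: algebra_simps)
    finally show ?thesis .
  qed
  define x where "x = c ^ 3 * \<kappa> * (1 + \<sigma>)"
  have x: "c ^ 3 * \<kappa> \<le> x" "c\<^sup>2 * \<kappa> \<le> x"
  proof -
    show 1: "c ^ 3 * \<kappa> \<le> x" unfolding x_def using \<sigma> \<kappa> c0 mult_left_mono[of 1 "1 + \<sigma>" "c ^ 3 * \<kappa>"] by simp
    show "c\<^sup>2 * \<kappa> \<le> x" using 1 mult_right_mono[OF cp(2) \<kappa>] by linarith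
  qed
  have xt: "(c\<^sup>2 * \<kappa>) * (16 * (c * (1 + \<sigma>))) = 16 * x"
    by (simp add: x_def power2_eq_square power3_eq_cube algebra_simps)
  have "m4 * t \<le> (3 * (c\<^sup>2 * \<kappa>)) * (16 * (c * (1 + \<sigma>)))"
    using m4 t t16 c0 \<kappa> by (intro mult_mono) auto
  hence a: "m4 * t \<le> 48 * x" using xt by (simp add: mult.assoc)
  have "m2\<^sup>2 * t \<le> (c\<^sup>2 * \<kappa>) * (16 * (c * (1 + \<sigma>)))"
    using m22 t t16 c0 \<kappa> by (intro mult_mono) auto
  hence b: "m2\<^sup>2 * t \<le> 16 * x" using xt by simp
  have "m2 * m4 \<le> c * (3 * (c\<^sup>2 * \<kappa>))" using m2 m4 c0 by (intro mult_mono) auto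
  also have "\<dots> = 3 * (c ^ 3 * \<kappa>)" by (simp add: power2_eq_square power3_eq_cube)
  finally have d: "m2 * m4 \<le> 3 * x" using x by linarith
  have "200 * m4 + 64 * m6 + 8 * (m4 * t) + 2908 * m2\<^sup>2 + 208 * (m2\<^sup>2 * t) + 1664 * (m2 * m4) \<le> 13172 * x"
    using a b d m4 m6 m22 x by linarith
  thus ?thesis by (simp add: x_def \<kappa>_def mult_ac)
qed

text \<open>
  A random matrix of fixed size with independent entries whose moments up to the sixth are those of a Gaussian variable
  times an independent indicator of mean $s_{ij}$, divided by $\sqrt\beta$. All bounds derived here are uniform in the size.
\<close>

locale band_matrix = prob_space M
  for M :: "'w measure" +
  fixes n :: nat and z :: complex and v \<beta> :: real and s :: "int \<Rightarrow> int \<Rightarrow> real"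
    and h :: "int \<times> int \<Rightarrow> 'w \<Rightarrow> real"
  assumes beta: "1 \<le> \<beta>" and z: "1 \<le> \<bar>Im z\<bar>"
    and s_range: "0 \<le> s i j" "s i j \<le> 1" and s_sym: "s i j = s j i"
    and s_row: "i \<in> indices n \<Longrightarrow> (\<Sum>p\<in>indices n. s i p) / \<beta> \<le> 1 + 1 / \<beta>"
    and entries_indep: "indep_vars (\<lambda>_. borel) h (upper_pairs_upto n)"
    and entry6_integrable: "(i, j) \<in> upper_pairs_upto n \<Longrightarrow> integrable M (\<lambda>x. h (i, j) x ^ 6)"
    and entry1: "(i, j) \<in> upper_pairs_upto n \<Longrightarrow> (\<integral>x. h (i, j) x \<partial>M) = 0"
    and entry2: "(i, j) \<in> upper_pairs_upto n \<Longrightarrow> (\<integral>x. h (i, j) x ^ 2 \<partial>M) = v\<^sup>2 * s i j / \<beta>"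
    and entry3: "(i, j) \<in> upper_pairs_upto n \<Longrightarrow> (\<integral>x. h (i, j) x ^ 3 \<partial>M) = 0"
    and entry4: "(i, j) \<in> upper_pairs_upto n \<Longrightarrow> (\<integral>x. h (i, j) x ^ 4 \<partial>M) = 3 * v ^ 4 * s i j / \<beta>\<^sup>2"
    and entry6: "(i, j) \<in> upper_pairs_upto n \<Longrightarrow> (\<integral>x. h (i, j) x ^ 6 \<partial>M) = 15 * v ^ 6 * s i j / \<beta> ^ 3"
begin

abbreviation "I \<equiv> indices n"
abbreviation "E \<equiv> upper_pairs_upto n"

lemma z0: "Im z \<noteq> 0" using z by auto

definition G :: "'w \<Rightarrow> int \<Rightarrow> int \<Rightarrow> complex" where
  "G x = cfg_G n z (\<lambda>e. h e x)"

text \<open>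
  The position on or above the diagonal that carries the entries $(i,p)$ and $(p,i)$.
\<close>

definition edge :: "int \<Rightarrow> int \<Rightarrow> int \<times> int" where
  "edge i p = (min i p, max i p)"

definition others :: "int \<Rightarrow> int \<Rightarrow> 'w \<Rightarrow> int \<times> int \<Rightarrow> real" where
  "others i p x = (\<lambda>e\<in>E - {edge i p}. h e x)"

definition G\<^sub>0 :: "int \<Rightarrow> int \<Rightarrow> (int \<times> int \<Rightarrow> real) \<Rightarrow> int \<Rightarrow> int \<Rightarrow> complex" where
  "G\<^sub>0 i p \<zeta> = cfg_G n z (\<zeta>(edge i p := 0))"

lemma edge_in: "i \<in> I \<Longrightarrow> p \<in> I \<Longrightarrow> edge i p \<in> E"
  by (auto simp: edge_def indices_def upper_pairs_upto_def)

lemma G_resolvent: "resolvent_of I (cfg_entry (\<lambda>e. h e x)) z (G x)"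
  unfolding G_def by (rule cfg_G_resolvent_of[OF z0])

lemma G0_resolvent: "resolvent_of I (cfg_entry (\<zeta>(edge i p := 0))) z (G\<^sub>0 i p \<zeta>)"
  unfolding G\<^sub>0_def by (rule cfg_G_resolvent_of[OF z0])

lemma G_sym: "i \<in> I \<Longrightarrow> j \<in> I \<Longrightarrow> G x i j = G x j i"
  by (rule resolvent_symmetric[OF finite_indices cfg_entry_sym G_resolvent])

lemma G_bounded: "rows_cols_bounded I (1 / \<bar>Im z\<bar>) (G x)"
  using z by (intro resolvent_rows_cols_bounded[OF finite_indices cfg_entry_sym G_resolvent]) auto

lemma G_bounded1: "rows_cols_bounded I 1 (G x)"
  using z by (intro resolvent_rows_cols_bounded[OF finite_indices cfg_entry_sym G_resolvent]) auto

lemma G0_bounded1: "rows_cols_bounded I 1 (G\<^sub>0 i p \<zeta>)"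
  using z by (intro resolvent_rows_cols_bounded[OF finite_indices cfg_entry_sym G0_resolvent]) auto

lemma G_le: "i \<in> I \<Longrightarrow> j \<in> I \<Longrightarrow> cmod (G x i j) \<le> 1 / \<bar>Im z\<bar>"
  by (rule rows_cols_bounded_entry[OF finite_indices G_bounded])

lemma G_le1: "i \<in> I \<Longrightarrow> j \<in> I \<Longrightarrow> cmod (G x i j) \<le> 1"
  by (rule rows_cols_bounded_entry[OF finite_indices G_bounded1])

lemma G0_le1: "k \<in> I \<Longrightarrow> l \<in> I \<Longrightarrow> cmod (G\<^sub>0 i p \<zeta> k l) \<le> 1"
  by (rule rows_cols_bounded_entry[OF finite_indices G0_bounded1])

lemma entry_measurable: "e \<in> E \<Longrightarrow> h e \<in> borel_measurable M"
  using entries_indep by (auto simp: indep_vars_def)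

lemma G_measurable [measurable]: "i \<in> I \<Longrightarrow> j \<in> I \<Longrightarrow> (\<lambda>x. G x i j) \<in> borel_measurable M"
  unfolding G_def by (rule borel_measurable_cfg_G[OF z0]) (auto intro: entry_measurable)

lemma G0_measurable:
  assumes "k \<in> I" "l \<in> I"
  shows "(\<lambda>\<zeta>. G\<^sub>0 i p \<zeta> k l) \<in> borel_measurable (Pi\<^sub>M (E - {edge i p}) (\<lambda>_. borel))"
  unfolding G\<^sub>0_def
proof (rule borel_measurable_cfg_G[OF z0 assms])
  fix k l assume "(k, l) \<in> E"
  thus "(\<lambda>\<zeta>. (\<zeta>(edge i p := 0)) (k, l)) \<in> borel_measurable (Pi\<^sub>M (E - {edge i p}) (\<lambda>_. borel))"
    by (cases "(k, l) = edge i p") auto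
qed

lemma G_differ:
  assumes ip: "i \<in> I" "p \<in> I"
  shows "differ_by_edge I i p (h (edge i p) x) (cfg_entry (\<lambda>e. h e x)) (cfg_entry ((others i p x)(edge i p := 0)))"
  unfolding differ_by_edge_def
proof (intro ballI)
  fix k l assume kl: "k \<in> I" "l \<in> I"
  have entry: "cfg_entry c k l = c (edge k l)" for c by (simp add: cfg_entry_def edge_def)
  have "edge k l = edge i p \<longleftrightarrow> k = i \<and> l = p \<or> k = p \<and> l = i"
    by (auto simp: edge_def min_def max_def split: if_splits)
  thus "cfg_entry (\<lambda>e. h e x) k l - cfg_entry ((others i p x)(edge i p := 0)) k l
      = (if k = i \<and> l = p \<or> k = p \<and> l = i then h (edge i p) x else 0)"
    unfolding entry using edge_in[OF kl]
    by (cases "edge k l = edge i p") (simp_all only: others_def fun_upd_apply restrict_apply' Diff_iff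
        singleton_iff if_True if_False simp_thms diff_zero diff_self)
qed

lemma frozen_edge_at:
  assumes ip: "i \<in> I" "p \<in> I"
  shows "frozen_edge M (h (edge i p)) (Pi\<^sub>M {edge i p} (\<lambda>_. borel)) (Pi\<^sub>M (E - {edge i p}) (\<lambda>_. borel))
    (\<lambda>x. \<lambda>e\<in>{edge i p}. h e x) (others i p) (\<lambda>\<zeta>. \<zeta> (edge i p))
    (v\<^sup>2 * s i p / \<beta>) (3 * v ^ 4 * s i p / \<beta>\<^sup>2) (15 * v ^ 6 * s i p / \<beta> ^ 3)"
proof unfold_locales
  have e: "(min i p, max i p) \<in> E" using edge_in[OF ip] by (simp add: edge_def)
  have s: "s (min i p) (max i p) = s i p" by (simp add: min_def max_def s_sym)
  show "indep_var (Pi\<^sub>M {edge i p} (\<lambda>_. borel)) (\<lambda>x. \<lambda>e\<in>{edge i p}. h e x)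
      (Pi\<^sub>M (E - {edge i p}) (\<lambda>_. borel)) (others i p)"
    using indep_var_restrict[OF entries_indep, of "{edge i p}" "E - {edge i p}"] edge_in[OF ip]
    by (simp add: others_def[abs_def])
  show "(\<lambda>\<zeta>. \<zeta> (edge i p)) \<in> borel_measurable (Pi\<^sub>M {edge i p} (\<lambda>_. borel))" by simp
  show "h (edge i p) x = (\<lambda>e\<in>{edge i p}. h e x) (edge i p)" for x by simp
  show "integrable M (\<lambda>x. h (edge i p) x ^ 6)" unfolding edge_def by (rule entry6_integrable[OF e])
  show "(\<integral>x. h (edge i p) x \<partial>M) = 0" unfolding edge_def by (rule entry1[OF e])
  show "(\<integral>x. h (edge i p) x ^ 2 \<partial>M) = v\<^sup>2 * s i p / \<beta>" unfolding edge_def entry2[OF e] s ..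
  show "(\<integral>x. h (edge i p) x ^ 3 \<partial>M) = 0" unfolding edge_def by (rule entry3[OF e])
  show "(\<integral>x. h (edge i p) x ^ 4 \<partial>M) = 3 * v ^ 4 * s i p / \<beta>\<^sup>2" unfolding edge_def entry4[OF e] s ..
  show "(\<integral>x. h (edge i p) x ^ 6 \<partial>M) = 15 * v ^ 6 * s i p / \<beta> ^ 3" unfolding edge_def entry6[OF e] s ..
qed

text \<open>
  The map $\rho$ is the identity or complex conjugation. The conjugate is what turns a covariance without conjugation
  into a variance.
\<close>

definition fluct :: "(complex \<Rightarrow> complex) \<Rightarrow> (int \<Rightarrow> real) \<Rightarrow> 'w \<Rightarrow> complex" where
  "fluct \<rho> w x = \<rho> (wtrace I w (G x) - (\<integral>x. wtrace I w (G x) \<partial>M))"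

text \<open>
  Half the modulus of the derivative of the weighted trace in an off-diagonal entry $(i,p)$.
\<close>

definition pairing :: "(int \<Rightarrow> real) \<Rightarrow> int \<Rightarrow> int \<Rightarrow> 'w \<Rightarrow> real" where
  "pairing w i p x = cmod (\<Sum>r\<in>I. of_real (w r) * (G x r i * G x r p))"

lemma wtrace_le:
  assumes "\<And>r. r \<in> I \<Longrightarrow> \<bar>w r\<bar> \<le> 1" "\<And>r. r \<in> I \<Longrightarrow> cmod (A r r) \<le> 1"
  shows "cmod (wtrace I w A) \<le> card I"
proof -
  have "cmod (wtrace I w A) \<le> (\<Sum>r\<in>I. 1)"
    unfolding wtrace_def using assms by (intro sum_norm_le) (auto simp: norm_mult intro!: mult_le_one)
  thus ?thesis by simp
qed

lemma wtrace_measurable [measurable]: "(\<lambda>x. wtrace I w (G x)) \<in> borel_measurable M"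
  unfolding wtrace_def by (intro borel_measurable_sum borel_measurable_times G_measurable) auto

lemma mean_wtrace_le:
  assumes w: "\<And>r. r \<in> I \<Longrightarrow> \<bar>w r\<bar> \<le> 1"
  shows "cmod (\<integral>x. wtrace I w (G x) \<partial>M) \<le> card I"
proof -
  have "cmod (\<integral>x. wtrace I w (G x) \<partial>M) \<le> (\<integral>x. cmod (wtrace I w (G x)) \<partial>M)" by (rule integral_norm_bound)
  also have "\<dots> \<le> (\<integral>x. real (card I) \<partial>M)"
    using wtrace_le[of w "G _", OF w G_le1] by (intro integral_mono integrable_const_bound[of _ "real (card I)"]) auto
  finally show ?thesis by (simp add: prob_space)
qed

lemma id_or_cnj_cmod: "\<rho> \<in> {id, cnj} \<Longrightarrow> cmod (\<rho> x) = cmod x" by auto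

lemma id_or_cnj_measurable: "\<rho> \<in> {id, cnj} \<Longrightarrow> f \<in> borel_measurable N \<Longrightarrow> (\<lambda>x. \<rho> (f x)) \<in> borel_measurable N"
  for f :: "'x \<Rightarrow> complex" 
  by (auto intro: measurable_compose[OF _ borel_measurable_continuous_onI[OF continuous_on_cnj[OF continuous_on_id]]])

lemma fluct_bound:
  assumes "\<rho> \<in> {id, cnj}" and w: "\<And>r. r \<in> I \<Longrightarrow> \<bar>w r\<bar> \<le> 1"
  shows "cmod (fluct \<rho> w x) \<le> 2 * real (card I)"
  unfolding fluct_def id_or_cnj_cmod[OF assms(1)]
  using norm_triangle_ineq4[of "wtrace I w (G x)" "\<integral>x. wtrace I w (G x) \<partial>M"] wtrace_le[of w "G x", OF w G_le1] mean_wtrace_le[of w, OF w]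
  by simp

lemma fluct_measurable [measurable]:
  assumes "\<rho> \<in> {id, cnj}"
  shows "fluct \<rho> w \<in> borel_measurable M"
  unfolding fluct_def[abs_def] by (intro id_or_cnj_measurable[OF assms]) measurable

lemma pairing_props:
  assumes w: "\<And>r. r \<in> I \<Longrightarrow> \<bar>w r\<bar> \<le> 1" and ip: "i \<in> I" "p \<in> I"
  shows "pairing w i p \<in> borel_measurable M" "0 \<le> pairing w i p x" "pairing w i p x \<le> 1"
proof -
  show "pairing w i p \<in> borel_measurable M"
    unfolding pairing_def[abs_def]
    by (rule measurable_compose[OF _ borel_measurable_norm])
       (intro borel_measurable_sum borel_measurable_times borel_measurable_const G_measurable ip)
  show "0 \<le> pairing w i p x" by (simp add: pairing_def)
  have "pairing w i p x \<le> 1 * 1"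
    unfolding pairing_def using G_bounded1 ip
    by (intro weighted_pairing_bound w) (auto simp: rows_cols_bounded_def)
  thus "pairing w i p x \<le> 1" by simp
qed

lemma pairing_square_sum:
  assumes w: "\<And>r. r \<in> I \<Longrightarrow> \<bar>w r\<bar> \<le> 1" and i: "i \<in> I"
  shows "(\<Sum>p\<in>I. (pairing w i p x)\<^sup>2) \<le> 1"
  unfolding pairing_def by (rule resolvent_pairing_L2[OF finite_indices cfg_entry_sym G_resolvent z w i])

lemma G_row_square_sum:
  assumes i: "i \<in> I"
  shows "(\<Sum>p\<in>I. (cmod (G x i p))\<^sup>2) \<le> 1"
proof -
  have "L2_set (\<lambda>p. cmod (G x i p)) I \<le> 1" using G_bounded1 i by (auto simp: rows_cols_bounded_def)
  thus ?thesis by (simp add: L2_set_def)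
qed

lemma edge_term:
  assumes \<rho>: "\<rho> \<in> {id, cnj}" and w: "\<And>r. r \<in> I \<Longrightarrow> \<bar>w r\<bar> \<le> 1" and ip: "i \<in> I" "p \<in> I"
  shows "cmod ((\<integral>x. of_real (h (edge i p) x) * (fluct \<rho> w x * G x i p) \<partial>M)
      + of_real (v\<^sup>2 * s i p / \<beta>) * (\<integral>x. fluct \<rho> w x * (G x i i * G x p p) \<partial>M))
    \<le> v\<^sup>2 * s i p / \<beta> * (\<integral>x. (2 * cmod (fluct \<rho> w x) + 21) * (cmod (G x i p))\<^sup>2 + 9 * (pairing w i p x)\<^sup>2 \<partial>M)
      + 13172 * (1 + v\<^sup>2) ^ 3 * (1 + (\<integral>x. cmod (fluct \<rho> w x) \<partial>M)) * (s i p / \<beta> / \<beta>)"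
proof -
  let ?e = "edge i p"
  let ?N = "Pi\<^sub>M (E - {?e}) (\<lambda>_. borel :: real measure)"
  interpret F: frozen_edge M "h ?e" "Pi\<^sub>M {?e} (\<lambda>_. borel)" ?N
    "\<lambda>x. \<lambda>e\<in>{?e}. h e x" "others i p" "\<lambda>\<zeta>. \<zeta> ?e"
    "v\<^sup>2 * s i p / \<beta>" "3 * v ^ 4 * s i p / \<beta>\<^sup>2" "15 * v ^ 6 * s i p / \<beta> ^ 3"
    by (rule frozen_edge_at[OF ip])
  let ?P1 = "\<lambda>\<zeta>. sandwich i p (G\<^sub>0 i p \<zeta>) (G\<^sub>0 i p \<zeta>)"
  let ?P2 = "\<lambda>\<zeta>. sandwich i p (?P1 \<zeta>) (G\<^sub>0 i p \<zeta>)"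
  have m1: "(\<lambda>\<zeta>. ?P1 \<zeta> k l) \<in> borel_measurable ?N" if "k \<in> I" "l \<in> I" for k l
    using that ip unfolding sandwich_def by (cases "i = p") (auto intro!: G0_measurable borel_measurable_times borel_measurable_add)
  have m2: "(\<lambda>\<zeta>. ?P2 \<zeta> k l) \<in> borel_measurable ?N" if "k \<in> I" "l \<in> I" for k l
    using that ip m1 unfolding sandwich_def[where A = "sandwich _ _ _ _"]
    by (cases "i = p") (auto intro!: G0_measurable borel_measurable_times borel_measurable_add)
  have entry: "F.frozen_jet 1 (\<lambda>x. G x k l) (\<lambda>\<zeta>. G\<^sub>0 i p \<zeta> k l) (\<lambda>\<zeta>. - ?P1 \<zeta> k l) (\<lambda>\<zeta>. ?P2 \<zeta> k l)"
    if kl: "k \<in> I" "l \<in> I" for k l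
    unfolding F.frozen_jet_def
  proof (intro conjI allI)
    show "jet 8 (h ?e x) (G x k l) (G\<^sub>0 i p (others i p x) k l) (- ?P1 (others i p x) k l) (?P2 (others i p x) k l)" for x
      by (rule jet_resolvent_entry[OF finite_indices cfg_entry_sym cfg_entry_sym G_resolvent G0_resolvent G_differ[OF ip] ip z kl])
    show "(\<lambda>\<zeta>. - ?P1 \<zeta> k l) \<in> borel_measurable ?N" by (rule borel_measurable_uminus[OF m1[OF kl]])
  qed (rule G_measurable[OF kl] G0_measurable[OF kl] m2[OF kl] G_le1[OF kl] G0_le1[OF kl])+
  let ?c = "\<integral>x. wtrace I w (G x) \<partial>M"
  have trace: "F.frozen_jet (2 * real (card I)) (fluct \<rho> w) (\<lambda>\<zeta>. \<rho> (wtrace I w (G\<^sub>0 i p \<zeta>) - ?c))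
      (\<lambda>\<zeta>. \<rho> (- wtrace I w (?P1 \<zeta>))) (\<lambda>\<zeta>. \<rho> (wtrace I w (?P2 \<zeta>)))"
    unfolding F.frozen_jet_def
  proof (intro conjI allI)
    show "fluct \<rho> w \<in> borel_measurable M" by (rule fluct_measurable[OF \<rho>])
    show "(\<lambda>\<zeta>. \<rho> (wtrace I w (G\<^sub>0 i p \<zeta>) - ?c)) \<in> borel_measurable ?N"
      unfolding wtrace_def using G0_measurable by (intro id_or_cnj_measurable[OF \<rho>]) auto
    show "(\<lambda>\<zeta>. \<rho> (- wtrace I w (?P1 \<zeta>))) \<in> borel_measurable ?N"
      unfolding wtrace_def using m1 by (intro id_or_cnj_measurable[OF \<rho>]) auto
    show "(\<lambda>\<zeta>. \<rho> (wtrace I w (?P2 \<zeta>))) \<in> borel_measurable ?N"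
      unfolding wtrace_def using m2 by (intro id_or_cnj_measurable[OF \<rho>]) auto
    show "cmod (fluct \<rho> w x) \<le> 2 * real (card I)" for x by (rule fluct_bound[OF \<rho> w])
    show "cmod (\<rho> (wtrace I w (G\<^sub>0 i p (others i p x)) - ?c)) \<le> 2 * real (card I)" for x
      unfolding id_or_cnj_cmod[OF \<rho>]
      using norm_triangle_ineq4[of "wtrace I w (G\<^sub>0 i p (others i p x))" ?c]
        wtrace_le[of w "G\<^sub>0 i p (others i p x)", OF w G0_le1] mean_wtrace_le[of w, OF w] by simp
    show "jet 8 (h ?e x) (fluct \<rho> w x) (\<rho> (wtrace I w (G\<^sub>0 i p (others i p x)) - ?c))
        (\<rho> (- wtrace I w (?P1 (others i p x)))) (\<rho> (wtrace I w (?P2 (others i p x))))" for x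
      unfolding fluct_def
      by (rule jet_id_or_cnj[OF \<rho> jet_wtrace[OF finite_indices cfg_entry_sym cfg_entry_sym G_resolvent G0_resolvent G_differ[OF ip] ip z w]])
  qed
  have g1: "cmod (- ?P1 (others i p x) i p + G\<^sub>0 i p (others i p x) i i * G\<^sub>0 i p (others i p x) p p)
      \<le> (cmod (G\<^sub>0 i p (others i p x) i p))\<^sup>2" for x
    by (simp add: sandwich_def norm_mult power2_eq_square)
  have f1: "cmod (\<rho> (- wtrace I w (?P1 (others i p x)))) \<le> 2 * pairing w i p x + 8 * \<bar>h ?e x\<bar>" for x
    unfolding id_or_cnj_cmod[OF \<rho>] norm_minus_cancel pairing_def
    by (rule wtrace_derivative_bound[OF finite_indices cfg_entry_sym cfg_entry_sym G_resolvent G0_resolvent G_differ[OF ip] ip z w])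
  let ?t = "\<integral>x. cmod (\<rho> (wtrace I w (G\<^sub>0 i p (others i p x)) - ?c)) \<partial>M"
  have t: "?t \<le> (\<integral>x. cmod (fluct \<rho> w x) \<partial>M) + 8 * (1 + v\<^sup>2 * s i p / \<beta>)"
    by (rule F.frozen_mean_bound[OF trace])
  note * = F.edge_estimate[OF trace entry[OF ip] entry[OF ip(1) ip(1)] entry[OF ip(2) ip(2)] g1 pairing_props[OF w ip] f1]
  have \<tau>: "0 \<le> s i p / \<beta>" "s i p / \<beta> \<le> 1 / \<beta>" using s_range[of i p] beta by (simp_all add: divide_right_mono)
  have \<sigma>: "0 \<le> (\<integral>x. cmod (fluct \<rho> w x) \<partial>M)" by (rule Bochner_Integration.integral_nonneg) simp
  have t0: "0 \<le> ?t" by (rule Bochner_Integration.integral_nonneg) simp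
  have moments: "v\<^sup>2 * s i p / \<beta> = v\<^sup>2 * (s i p / \<beta>)" "3 * v ^ 4 * s i p / \<beta>\<^sup>2 = 3 * v ^ 4 * (s i p / \<beta>) / \<beta>"
    "15 * v ^ 6 * s i p / \<beta> ^ 3 = 15 * v ^ 6 * (s i p / \<beta>) / \<beta>\<^sup>2"
    by (simp_all add: power2_eq_square power3_eq_cube)
  note error = edge_error_bound[OF beta \<tau> \<sigma> t0 t moments]
  show ?thesis by (rule order.trans[OF * add_left_mono[OF error]])
qed

end

section \<open>Self-consistent equation and variances\<close>

text \<open>
  A form of the Cauchy--Schwarz inequality, $E\{XY\} \le D\sqrt{E X^2}$, weakened by the summand $1$ so that the
  optimal weight $t = D/\sqrt{E X^2}$ need not be distinguished from the degenerate case $E X^2 = 0$.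
\<close>

lemma (in prob_space) product_expectation_bound:
  fixes X Y :: "'a \<Rightarrow> real"
  assumes X: "integrable M (\<lambda>x. (X x)\<^sup>2)" and Y: "integrable M (\<lambda>x. (Y x)\<^sup>2)"
    and XY: "integrable M (\<lambda>x. X x * Y x)"
    and D: "0 < D" "(\<integral>x. (Y x)\<^sup>2 \<partial>M) \<le> D\<^sup>2"
  shows "(\<integral>x. X x * Y x \<partial>M) \<le> D * (1 + sqrt (\<integral>x. (X x)\<^sup>2 \<partial>M))"
proof -
  define \<Gamma> where "\<Gamma> = sqrt (\<integral>x. (X x)\<^sup>2 \<partial>M)"
  have \<Gamma>: "0 \<le> \<Gamma>" "(\<integral>x. (X x)\<^sup>2 \<partial>M) = \<Gamma>\<^sup>2" by (simp_all add: \<Gamma>_def)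
  define t where "t = D / (1 + \<Gamma>)"
  have t: "0 < t" using D \<Gamma> by (simp add: t_def)
  have "(\<integral>x. X x * Y x \<partial>M) \<le> (\<integral>x. (t / 2) * (X x)\<^sup>2 + (1 / (2 * t)) * (Y x)\<^sup>2 \<partial>M)"
  proof (rule integral_mono[OF XY])
    show "integrable M (\<lambda>x. (t / 2) * (X x)\<^sup>2 + (1 / (2 * t)) * (Y x)\<^sup>2)" using X Y by simp
    fix x
    have "(t / 2) * (X x)\<^sup>2 + (1 / (2 * t)) * (Y x)\<^sup>2 - X x * Y x = (t * X x - Y x)\<^sup>2 / (2 * t)"
      using t by (simp add: field_simps power2_eq_square)
    also have "0 \<le> \<dots>" using t by simp
    finally show "X x * Y x \<le> (t / 2) * (X x)\<^sup>2 + (1 / (2 * t)) * (Y x)\<^sup>2" by simp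
  qed
  also have "\<dots> = (t / 2) * \<Gamma>\<^sup>2 + (1 / (2 * t)) * (\<integral>x. (Y x)\<^sup>2 \<partial>M)" using X Y \<Gamma> by simp
  also have "\<dots> \<le> (t / 2) * (1 + \<Gamma>)\<^sup>2 + (1 / (2 * t)) * D\<^sup>2"
    using \<Gamma> t D by (intro add_mono mult_left_mono power_mono) auto
  also have "\<dots> = D * (1 + \<Gamma>)"
  proof -
    have tG: "t * (1 + \<Gamma>) = D" "t \<noteq> 0" using \<Gamma> t D by (simp_all add: t_def)
    have "(t / 2) * (1 + \<Gamma>)\<^sup>2 = (t * (1 + \<Gamma>)) * (1 + \<Gamma>) / 2" by (simp add: power2_eq_square)
    moreover have "(1 / (2 * t)) * D\<^sup>2 = D * (1 + \<Gamma>) / 2"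
      using tG(2) by (simp add: tG(1)[symmetric] power2_eq_square)
    ultimately show ?thesis using tG(1) by simp
  qed
  finally show ?thesis unfolding \<Gamma>_def .
qed

lemma quadratic_bootstrap:
  fixes x q c :: real
  assumes "0 \<le> q" "0 \<le> c" "x\<^sup>2 \<le> q * (c + x)"
  shows "x \<le> q + c"
proof (rule ccontr)
  assume "\<not> x \<le> q + c"
  hence x: "q + c < x" by simp
  hence "(q + c) * x < x * x" using assms by (intro mult_strict_right_mono) auto
  hence "c * x < q * c" using assms(3) by (simp add: power2_eq_square algebra_simps)
  moreover have "c * q \<le> c * x" using x assms by (intro mult_left_mono) auto
  ultimately show False by (simp add: mult.commute)
qed

text \<open>
  With $c = 1 + v^2$: the sum of $13172\,c^3$ over a row of total weight at most $2$, plus $30\,c^3$ from the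
  off-diagonal terms.
\<close>

definition consistency_const :: "real \<Rightarrow> real" where
  "consistency_const v = 26374 * (1 + v\<^sup>2) ^ 3"

definition variance_const :: "real \<Rightarrow> complex \<Rightarrow> real" where
  "variance_const v z = 2 * \<bar>Im z\<bar> * consistency_const v + 2"

definition covariance_const :: "real \<Rightarrow> complex \<Rightarrow> real" where
  "covariance_const v z = 2 * v\<^sup>2 * variance_const v z + 2 * \<bar>Im z\<bar> * consistency_const v"

lemma consistency_const_nonneg: "0 \<le> consistency_const v"
  by (simp add: consistency_const_def)

lemma variance_const_pos: "0 < variance_const v z"
  using consistency_const_nonneg by (simp add: variance_const_def add_nonneg_pos)

lemma covariance_const_nonneg: "0 \<le> covariance_const v z"
  using variance_const_pos[of v z] consistency_const_nonneg by (simp add: covariance_const_def)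

context band_matrix
begin

text \<open>
  The average of the diagonal of the resolvent over the band around the site $i$. It plays the role of the normalised
  trace in the self-consistent equation.
\<close>

definition U :: "int \<Rightarrow> 'w \<Rightarrow> complex" where
  "U i x = (\<Sum>p\<in>I. of_real (s i p / \<beta>) * G x p p)"

lemma indices_nonempty: "I \<noteq> {}" by (auto simp: indices_def)

lemma square_integrable:
  fixes X :: "'w \<Rightarrow> complex"
  assumes X: "X \<in> borel_measurable M" "\<And>x. cmod (X x) \<le> B"
  shows "integrable M (\<lambda>x. (cmod (X x))\<^sup>2)"
proof (rule bounded_integrable)
  show "(\<lambda>x. (cmod (X x))\<^sup>2) \<in> borel_measurable M" using X(1) by measurable
  show "norm ((cmod (X x))\<^sup>2) \<le> B\<^sup>2" for x
    using power_mono[OF X(2) norm_ge_zero, of x 2] by (simp only: real_norm_def abs_power2)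
qed

lemma s_weights: "\<bar>s i p\<bar> \<le> 1" using s_range[of i p] by simp

lemma s_row2: "i \<in> I \<Longrightarrow> (\<Sum>p\<in>I. s i p / \<beta>) \<le> 1 + 1 / \<beta>"
  using s_row by (simp add: sum_divide_distrib)

lemma s_row_le2: "i \<in> I \<Longrightarrow> (\<Sum>p\<in>I. s i p / \<beta>) \<le> 2"
proof -
  assume "i \<in> I"
  moreover have "1 / \<beta> \<le> 1" using beta by simp
  ultimately show ?thesis using s_row2[of i] by linarith
qed

lemma U_measurable [measurable]: "U i \<in> borel_measurable M"
  unfolding U_def[abs_def] by (intro borel_measurable_sum borel_measurable_times borel_measurable_const G_measurable)

lemma U_le: "i \<in> I \<Longrightarrow> cmod (U i x) \<le> (1 + 1 / \<beta>) / \<bar>Im z\<bar>"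
proof -
  assume i: "i \<in> I"
  have "cmod (U i x) \<le> (\<Sum>p\<in>I. s i p / \<beta> * (1 / \<bar>Im z\<bar>))"
    unfolding U_def using s_range beta G_le
    by (intro sum_norm_le) (auto simp: norm_mult intro!: mult_mono simp del: times_divide_eq_left times_divide_eq_right of_real_divide)
  also have "\<dots> = (\<Sum>p\<in>I. s i p / \<beta>) * (1 / \<bar>Im z\<bar>)" by (simp only: sum_distrib_right)
  also have "\<dots> \<le> (1 + 1 / \<beta>) * (1 / \<bar>Im z\<bar>)" using s_row2[OF i] by (intro mult_right_mono) auto
  finally show ?thesis by simp
qed

lemma G_mean_le: "i \<in> I \<Longrightarrow> cmod (\<integral>x. G x i i \<partial>M) \<le> 1 / \<bar>Im z\<bar>"
proof -
  assume i: "i \<in> I"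
  have "cmod (\<integral>x. G x i i \<partial>M) \<le> (\<integral>x. cmod (G x i i) \<partial>M)" by (rule integral_norm_bound)
  also have "\<dots> \<le> (\<integral>x. 1 / \<bar>Im z\<bar> \<partial>M)"
    using i G_le by (intro integral_mono integrable_const bounded_integrable[of _ "1 / \<bar>Im z\<bar>"]) auto
  finally show ?thesis by (simp add: prob_space)
qed

lemma U_mean_le: "i \<in> I \<Longrightarrow> cmod (\<integral>x. U i x \<partial>M) \<le> (1 + 1 / \<beta>) / \<bar>Im z\<bar>"
proof -
  assume i: "i \<in> I"
  have "cmod (\<integral>x. U i x \<partial>M) \<le> (\<integral>x. cmod (U i x) \<partial>M)" by (rule integral_norm_bound)
  also have "\<dots> \<le> (\<integral>x. (1 + 1 / \<beta>) / \<bar>Im z\<bar> \<partial>M)"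
    using U_le[OF i] by (intro integral_mono integrable_const bounded_integrable[of _ "(1 + 1 / \<beta>) / \<bar>Im z\<bar>"]) auto
  finally show ?thesis by (simp add: prob_space)
qed

context
  fixes \<rho> :: "complex \<Rightarrow> complex" and w :: "int \<Rightarrow> real"
  assumes \<rho>: "\<rho> \<in> {id, cnj}" and w: "\<And>r. r \<in> I \<Longrightarrow> \<bar>w r\<bar> \<le> 1"
begin

private abbreviation "f \<equiv> fluct \<rho> w"
private abbreviation "B \<equiv> 2 * real (card I)"

lemma fluct_measurable' [measurable]: "f \<in> borel_measurable M"
  by (rule fluct_measurable[OF \<rho>])

lemma fluct_bound': "cmod (f x) \<le> B"
  by (rule fluct_bound[OF \<rho> w])

lemma fluct_integrable: "integrable M f"
  by (rule bounded_integrable[OF fluct_measurable' fluct_bound'])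

lemma fluct_mean: "(\<integral>x. f x \<partial>M) = 0"
proof -
  have i: "integrable M (\<lambda>x. wtrace I w (G x))"
  proof (rule bounded_integrable[OF wtrace_measurable])
    show "cmod (wtrace I w (G x)) \<le> real (card I)" for x by (intro wtrace_le w G_le1)
  qed
  have "(\<integral>x. f x \<partial>M) = \<rho> (\<integral>x. wtrace I w (G x) - (\<integral>x. wtrace I w (G x) \<partial>M) \<partial>M)"
    unfolding fluct_def using \<rho> by (auto simp del: complex_cnj_diff)
  also have "\<dots> = \<rho> 0" using i by (simp add: prob_space)
  finally show ?thesis using \<rho> by auto
qed

lemma fluct_times_integrable:
  assumes "X \<in> borel_measurable M" "\<And>x. cmod (X x) \<le> C"
  shows "integrable M (\<lambda>x. f x * X x)"
proof (rule bounded_integrable)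
  show "(\<lambda>x. f x * X x) \<in> borel_measurable M" using assms(1) by measurable
  show "cmod (f x * X x) \<le> B * C" for x by (intro norm_mult_le fluct_bound' assms)
qed

lemma fluct_times_U:
  "(\<integral>x. f x * U i x \<partial>M) = (\<Sum>p\<in>I. of_real (s i p / \<beta>) * (\<integral>x. f x * G x p p \<partial>M))"
proof -
  have int: "integrable M (\<lambda>x. f x * G x p p)" if "p \<in> I" for p
    using that by (intro fluct_times_integrable[OF _ G_le1[OF that that]]) measurable
  have "(\<integral>x. f x * U i x \<partial>M) = (\<integral>x. (\<Sum>p\<in>I. of_real (s i p / \<beta>) * (f x * G x p p)) \<partial>M)"
    unfolding U_def by (intro Bochner_Integration.integral_cong refl) (simp add: sum_distrib_left mult_ac)
  also have "\<dots> = (\<Sum>p\<in>I. \<integral>x. of_real (s i p / \<beta>) * (f x * G x p p) \<partial>M)"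
    using int by (intro Bochner_Integration.integral_sum integrable_mult_right) auto
  also have "\<dots> = (\<Sum>p\<in>I. of_real (s i p / \<beta>) * (\<integral>x. f x * G x p p \<partial>M))"
    by (intro sum.cong refl integral_mult_right_zero)
  finally show ?thesis .
qed

text \<open>
  Row $i$ of $(H - z)G = 1$, multiplied by $f$ and averaged; the constant term disappears since $f$ is centred. The errors
  are summable over $p$ because the rows of $G$ and the pairings have bounded sum of squares.
\<close>

lemma self_consistency:
  assumes i: "i \<in> I"
  shows "cmod (z * (\<integral>x. f x * G x i i \<partial>M) + of_real (v\<^sup>2) * (\<integral>x. f x * (G x i i * U i x) \<partial>M))
    \<le> consistency_const v * (1 + (\<integral>x. cmod (f x) \<partial>M)) / \<beta>"
proof -
  let ?h = "\<lambda>p x. complex_of_real (h (edge i p) x)"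
  let ?m = "\<lambda>p. v\<^sup>2 * s i p / \<beta>"
  let ?X = "\<lambda>p x. (2 * cmod (f x) + 21) * (cmod (G x i p))\<^sup>2 + 9 * (pairing w i p x)\<^sup>2"
  define \<sigma> where "\<sigma> = (\<integral>x. cmod (f x) \<partial>M)"
  have \<sigma>: "0 \<le> \<sigma>" by (simp add: \<sigma>_def)
  have int_h: "integrable M (\<lambda>x. ?h p x * (f x * G x i p))" if p: "p \<in> I" for p
  proof -
    interpret F: frozen_edge M "h (edge i p)" "Pi\<^sub>M {edge i p} (\<lambda>_. borel)" "Pi\<^sub>M (E - {edge i p}) (\<lambda>_. borel)"
      "\<lambda>x. \<lambda>e\<in>{edge i p}. h e x" "others i p" "\<lambda>\<zeta>. \<zeta> (edge i p)"
      "v\<^sup>2 * s i p / \<beta>" "3 * v ^ 4 * s i p / \<beta>\<^sup>2" "15 * v ^ 6 * s i p / \<beta> ^ 3"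
      by (rule frozen_edge_at[OF i p])
    have "integrable M (\<lambda>x. of_real (h (edge i p) x ^ 1) * (f x * G x i p))"
    proof (rule F.power_times_bounded_integrable)
      show "(\<lambda>x. f x * G x i p) \<in> borel_measurable M" using i p by measurable
      show "cmod (f x * G x i p) \<le> B * 1" for x by (intro norm_mult_le fluct_bound' G_le1 i p)
    qed simp
    thus ?thesis by simp
  qed
  have row: "z * G x i i = (\<Sum>p\<in>I. ?h p x * G x i p) - 1" for x
  proof -
    have "(\<Sum>p\<in>I. of_real (cfg_entry (\<lambda>e. h e x) i p) * G x p i) - z * G x i i = 1"
      using G_resolvent[of x] i unfolding resolvent_of_def by auto
    moreover have "(\<Sum>p\<in>I. of_real (cfg_entry (\<lambda>e. h e x) i p) * G x p i) = (\<Sum>p\<in>I. ?h p x * G x i p)"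
      using i by (intro sum.cong refl) (auto simp: cfg_entry_def edge_def G_sym[of i])
    ultimately show ?thesis by (simp add: algebra_simps)
  qed
  have 1: "z * (\<integral>x. f x * G x i i \<partial>M) = (\<Sum>p\<in>I. \<integral>x. ?h p x * (f x * G x i p) \<partial>M)"
  proof -
    have "z * (\<integral>x. f x * G x i i \<partial>M) = (\<integral>x. f x * (z * G x i i) \<partial>M)"
      by (subst integral_mult_right_zero[symmetric]) (simp add: mult_ac)
    also have "\<dots> = (\<integral>x. (\<Sum>p\<in>I. ?h p x * (f x * G x i p)) - f x \<partial>M)"
      unfolding row by (simp add: algebra_simps sum_distrib_left)
    also have "\<dots> = (\<Sum>p\<in>I. \<integral>x. ?h p x * (f x * G x i p) \<partial>M)"
      using int_h fluct_integrable fluct_mean by (subst Bochner_Integration.integral_diff) auto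
    finally show ?thesis .
  qed
  have int_GG: "integrable M (\<lambda>x. f x * (G x i i * G x p p))" if p: "p \<in> I" for p
  proof (rule fluct_times_integrable)
    show "(\<lambda>x. G x i i * G x p p) \<in> borel_measurable M" using i p by measurable
    show "cmod (G x i i * G x p p) \<le> 1 * 1" for x by (intro norm_mult_le G_le1 i p)
  qed
  have 2: "of_real (v\<^sup>2) * (\<integral>x. f x * (G x i i * U i x) \<partial>M)
      = (\<Sum>p\<in>I. of_real (?m p) * (\<integral>x. f x * (G x i i * G x p p) \<partial>M))"
  proof -
    have "(\<integral>x. f x * (G x i i * U i x) \<partial>M) = (\<integral>x. (\<Sum>p\<in>I. of_real (s i p / \<beta>) * (f x * (G x i i * G x p p))) \<partial>M)"
      unfolding U_def by (intro Bochner_Integration.integral_cong refl) (simp add: sum_distrib_left mult_ac)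
    also have "\<dots> = (\<Sum>p\<in>I. \<integral>x. of_real (s i p / \<beta>) * (f x * (G x i i * G x p p)) \<partial>M)"
      using int_GG by (intro Bochner_Integration.integral_sum integrable_mult_right) auto
    also have "\<dots> = (\<Sum>p\<in>I. of_real (s i p / \<beta>) * (\<integral>x. f x * (G x i i * G x p p) \<partial>M))"
      by (intro sum.cong refl integral_mult_right_zero)
    finally show ?thesis by (simp add: sum_distrib_left mult_ac)
  qed
  have X0: "0 \<le> ?X p x" for p x by (intro add_nonneg_nonneg mult_nonneg_nonneg) auto
  have int_X: "integrable M (?X p)" if p: "p \<in> I" for p
  proof (rule bounded_integrable)
    have pm [measurable]: "pairing w i p \<in> borel_measurable M" by (intro pairing_props w i p)
    have pb: "0 \<le> pairing w i p x" "pairing w i p x \<le> 1" for x by (intro pairing_props w i p; assumption)+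
    show "?X p \<in> borel_measurable M" using i p pm by measurable
    have "?X p x \<le> (2 * B + 21) * 1 + 9 * 1" for x
      using fluct_bound'[of x] pb[of x] G_le1[OF i p, of x]
      by (intro add_mono mult_mono) (auto simp: power_le_one)
    thus "norm (?X p x) \<le> (2 * B + 21) * 1 + 9 * 1" for x using X0 by simp
  qed
  have sum_X: "(\<Sum>p\<in>I. \<integral>x. ?X p x \<partial>M) \<le> 2 * \<sigma> + 30"
  proof -
    have "(\<Sum>p\<in>I. \<integral>x. ?X p x \<partial>M) = (\<integral>x. (\<Sum>p\<in>I. ?X p x) \<partial>M)"
      using int_X by (intro Bochner_Integration.integral_sum[symmetric]) auto
    also have "\<dots> \<le> (\<integral>x. 2 * cmod (f x) + 30 \<partial>M)"
    proof (rule integral_mono)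
      show "integrable M (\<lambda>x. \<Sum>p\<in>I. ?X p x)" using int_X by (intro Bochner_Integration.integrable_sum) auto
      show "integrable M (\<lambda>x. 2 * cmod (f x) + 30)" using fluct_integrable by simp
      fix x
      have "(\<Sum>p\<in>I. ?X p x) = (2 * cmod (f x) + 21) * (\<Sum>p\<in>I. (cmod (G x i p))\<^sup>2) + 9 * (\<Sum>p\<in>I. (pairing w i p x)\<^sup>2)"
        by (simp add: sum.distrib sum_distrib_left)
      also have "\<dots> \<le> (2 * cmod (f x) + 21) * 1 + 9 * 1"
        by (intro add_mono mult_left_mono G_row_square_sum pairing_square_sum w i) auto
      finally show "(\<Sum>p\<in>I. ?X p x) \<le> 2 * cmod (f x) + 30" by simp
    qed
    also have "\<dots> = 2 * \<sigma> + 30" using fluct_integrable by (simp add: prob_space \<sigma>_def)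
    finally show ?thesis .
  qed
  define c where "c = 1 + v\<^sup>2"
  have c: "1 \<le> c" "v\<^sup>2 \<le> c" by (simp_all add: c_def)
  have c3: "v\<^sup>2 \<le> c ^ 3" using c power_increasing[of 1 3 c] by simp
  let ?A = "13172 * c ^ 3 * (1 + \<sigma>) / \<beta>"
  have A0: "0 \<le> ?A" using c \<sigma> beta by simp
  have "cmod (z * (\<integral>x. f x * G x i i \<partial>M) + of_real (v\<^sup>2) * (\<integral>x. f x * (G x i i * U i x) \<partial>M))
     \<le> (\<Sum>p\<in>I. v\<^sup>2 / \<beta> * (\<integral>x. ?X p x \<partial>M) + ?A * (s i p / \<beta>))"
    unfolding 1 2 sum.distrib[symmetric]
  proof (rule sum_norm_le)
    fix p assume p: "p \<in> I"
    have "v\<^sup>2 * s i p / \<beta> \<le> v\<^sup>2 / \<beta>"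
      using s_range[of i p] beta by (intro divide_right_mono mult_left_le) auto
    moreover have "0 \<le> (\<integral>x. ?X p x \<partial>M)" using X0 by (intro Bochner_Integration.integral_nonneg) auto
    ultimately have "?m p * (\<integral>x. ?X p x \<partial>M) \<le> v\<^sup>2 / \<beta> * (\<integral>x. ?X p x \<partial>M)"
      by (rule mult_right_mono)
    moreover have "13172 * (1 + v\<^sup>2) ^ 3 * (1 + (\<integral>x. cmod (f x) \<partial>M)) * (s i p / \<beta> / \<beta>) = ?A * (s i p / \<beta>)"
      by (simp add: c_def \<sigma>_def)
    ultimately have le: "?m p * (\<integral>x. ?X p x \<partial>M)
        + 13172 * (1 + v\<^sup>2) ^ 3 * (1 + (\<integral>x. cmod (f x) \<partial>M)) * (s i p / \<beta> / \<beta>)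
      \<le> v\<^sup>2 / \<beta> * (\<integral>x. ?X p x \<partial>M) + ?A * (s i p / \<beta>)"
      by linarith
    show "cmod ((\<integral>x. ?h p x * (f x * G x i p) \<partial>M)
        + of_real (?m p) * (\<integral>x. f x * (G x i i * G x p p) \<partial>M))
      \<le> v\<^sup>2 / \<beta> * (\<integral>x. ?X p x \<partial>M) + ?A * (s i p / \<beta>)"
      by (rule order.trans[OF edge_term[OF \<rho> _ i p] le]) (rule w)
  qed
  also have "\<dots> = v\<^sup>2 / \<beta> * (\<Sum>p\<in>I. \<integral>x. ?X p x \<partial>M) + ?A * (\<Sum>p\<in>I. s i p / \<beta>)"
    by (simp only: sum.distrib sum_distrib_left)
  also have "\<dots> \<le> v\<^sup>2 / \<beta> * (2 * \<sigma> + 30) + ?A * 2"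
    using sum_X s_row_le2[OF i] A0 beta by (intro add_mono mult_left_mono) auto
  also have "\<dots> \<le> c ^ 3 / \<beta> * (30 * (1 + \<sigma>)) + ?A * 2"
    using c3 \<sigma> beta c by (intro add_right_mono mult_mono divide_right_mono) auto
  also have "\<dots> = consistency_const v * (1 + \<sigma>) / \<beta>" by (simp add: consistency_const_def c_def[symmetric] algebra_simps add_divide_distrib)
  finally show ?thesis unfolding \<sigma>_def .
qed

text \<open>
  Expand the product of the three centred factors; the term with two expectations vanishes because $f$ is centred.
\<close>

lemma centred_product_expansion:
  assumes i: "i \<in> I"
  shows "(\<integral>x. f x * (G x i i * U i x) \<partial>M)
    = (\<integral>x. U i x \<partial>M) * (\<integral>x. f x * G x i i \<partial>M) + (\<integral>x. G x i i \<partial>M) * (\<integral>x. f x * U i x \<partial>M)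
      + (\<integral>x. f x * ((G x i i - (\<integral>x. G x i i \<partial>M)) * (U i x - (\<integral>x. U i x \<partial>M))) \<partial>M)"
proof -
  define a where "a = (\<integral>x. G x i i \<partial>M)"
  define u where "u = (\<integral>x. U i x \<partial>M)"
  have iG: "integrable M (\<lambda>x. f x * G x i i)"
    using G_le1[OF i i] i by (intro fluct_times_integrable) auto
  have iU: "integrable M (\<lambda>x. f x * U i x)"
    using U_le[OF i] by (intro fluct_times_integrable) auto
  have iGU: "integrable M (\<lambda>x. f x * (G x i i * U i x))"
  proof (rule fluct_times_integrable)
    show "(\<lambda>x. G x i i * U i x) \<in> borel_measurable M" using i by measurable
    show "cmod (G x i i * U i x) \<le> 1 * ((1 + 1 / \<beta>) / \<bar>Im z\<bar>)" for x
      by (intro norm_mult_le G_le1 U_le i)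
  qed
  have "(\<integral>x. f x * ((G x i i - a) * (U i x - u)) \<partial>M)
      = (\<integral>x. f x * (G x i i * U i x) - u * (f x * G x i i) - a * (f x * U i x) + a * u * f x \<partial>M)"
    by (intro Bochner_Integration.integral_cong refl) (simp add: algebra_simps)
  also have "\<dots> = (\<integral>x. f x * (G x i i * U i x) \<partial>M) - u * (\<integral>x. f x * G x i i \<partial>M) - a * (\<integral>x. f x * U i x \<partial>M)"
    using iG iU iGU fluct_integrable fluct_mean by simp
  finally show ?thesis unfolding a_def[symmetric] u_def[symmetric] by simp
qed

text \<open>
  Apply the self-consistent equation at the site where $|E\{f\,G(i,i)\}|$ is largest. Both linear terms of the expansion
  are then at most $v^2(1+1/\beta)/y$ times this maximum and can be moved to the left, after multiplication by $y = |\mathrm{Im}\,z|$.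
\<close>

lemma covariance_bound:
  assumes gap: "2 * v\<^sup>2 * (1 + 1 / \<beta>) \<le> (Im z)\<^sup>2"
    and D: "\<And>i. i \<in> I \<Longrightarrow> (\<integral>x. cmod (f x) * cmod (U i x - (\<integral>x. U i x \<partial>M)) \<partial>M) \<le> D"
    and j: "j \<in> I"
  shows "((Im z)\<^sup>2 - 2 * v\<^sup>2 * (1 + 1 / \<beta>)) * cmod (\<integral>x. f x * G x j j \<partial>M)
    \<le> 2 * v\<^sup>2 * D + \<bar>Im z\<bar> * (consistency_const v * (1 + (\<integral>x. cmod (f x) \<partial>M)) / \<beta>)"
proof -
  let ?R = "\<lambda>i. cmod (\<integral>x. f x * G x i i \<partial>M)"
  define y where "y = \<bar>Im z\<bar>"
  define S where "S = 1 + 1 / \<beta>"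
  define e where "e = consistency_const v * (1 + (\<integral>x. cmod (f x) \<partial>M)) / \<beta>"
  have y: "0 < y" using z by (simp add: y_def)
  have S: "0 \<le> S" using beta by (simp add: S_def)
  define R where "R = Max (?R ` I)"
  have RI: "?R p \<le> R" if "p \<in> I" for p using that by (simp add: R_def)
  have "R \<in> ?R ` I" unfolding R_def using indices_nonempty by (intro Max_in) auto
  then obtain i where i: "i \<in> I" and Ri: "?R i = R" by auto
  have R0: "0 \<le> R" using Ri norm_ge_zero by metis
  have fU: "cmod (\<integral>x. f x * U i x \<partial>M) \<le> S * R"
  proof -
    have "cmod (\<Sum>p\<in>I. of_real (s i p / \<beta>) * (\<integral>x. f x * G x p p \<partial>M)) \<le> (\<Sum>p\<in>I. s i p / \<beta> * R)"
    proof (rule sum_norm_le)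
      fix p assume p: "p \<in> I"
      have "cmod (of_real (s i p / \<beta>) * (\<integral>x. f x * G x p p \<partial>M)) = s i p / \<beta> * ?R p"
        using s_range[of i p] beta by (simp only: norm_mult norm_of_real abs_of_nonneg divide_nonneg_nonneg)
      also have "\<dots> \<le> s i p / \<beta> * R" using s_range[of i p] beta RI[OF p] by (intro mult_left_mono) auto
      finally show "cmod (of_real (s i p / \<beta>) * (\<integral>x. f x * G x p p \<partial>M)) \<le> s i p / \<beta> * R" .
    qed
    also have "\<dots> = (\<Sum>p\<in>I. s i p / \<beta>) * R" by (simp add: sum_distrib_right)
    also have "\<dots> \<le> S * R" unfolding S_def using s_row2[OF i] R0 by (intro mult_right_mono)
    finally show ?thesis unfolding fluct_times_U .
  qed
  let ?a = "\<integral>x. G x i i \<partial>M" and ?u = "\<integral>x. U i x \<partial>M"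
  have tri: "cmod (\<integral>x. f x * ((G x i i - ?a) * (U i x - ?u)) \<partial>M) \<le> 2 / y * D"
  proof -
    have G0: "cmod (G x i i - ?a) \<le> 2 / y" for x
      using norm_triangle_ineq4[of "G x i i" ?a] G_le[OF i i, of x] G_mean_le[OF i] by (simp add: y_def)
    have U0: "cmod (U i x - ?u) \<le> 2 * (S / y)" for x
      using norm_triangle_ineq4[of "U i x" ?u] U_le[OF i, of x] U_mean_le[OF i] unfolding y_def S_def by linarith
    have m: "(\<lambda>x. (G x i i - ?a) * (U i x - ?u)) \<in> borel_measurable M" using i by measurable
    have int: "integrable M (\<lambda>x. f x * ((G x i i - ?a) * (U i x - ?u)))"
      by (rule fluct_times_integrable[OF m norm_mult_le[OF G0 U0]])
    have intU: "integrable M (\<lambda>x. f x * (U i x - ?u))" by (rule fluct_times_integrable[OF _ U0]) measurable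
    have "cmod (\<integral>x. f x * ((G x i i - ?a) * (U i x - ?u)) \<partial>M)
        \<le> (\<integral>x. cmod (f x * ((G x i i - ?a) * (U i x - ?u))) \<partial>M)" by (rule integral_norm_bound)
    also have "\<dots> \<le> (\<integral>x. 2 / y * (cmod (f x) * cmod (U i x - ?u)) \<partial>M)"
    proof (rule integral_mono)
      show "integrable M (\<lambda>x. cmod (f x * ((G x i i - ?a) * (U i x - ?u))))" using int by (rule integrable_norm)
      show "integrable M (\<lambda>x. 2 / y * (cmod (f x) * cmod (U i x - ?u)))"
        using integrable_norm[OF intU] by (intro integrable_mult_right) (simp add: norm_mult)
      fix x
      have "cmod (G x i i - ?a) * (cmod (f x) * cmod (U i x - ?u)) \<le> 2 / y * (cmod (f x) * cmod (U i x - ?u))"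
        by (intro mult_right_mono G0) auto
      thus "cmod (f x * ((G x i i - ?a) * (U i x - ?u))) \<le> 2 / y * (cmod (f x) * cmod (U i x - ?u))"
        by (simp only: norm_mult mult_ac)
    qed
    also have "\<dots> = 2 / y * (\<integral>x. cmod (f x) * cmod (U i x - ?u) \<partial>M)" by (rule integral_mult_right_zero)
    also have "\<dots> \<le> 2 / y * D" using D[OF i] y by (intro mult_left_mono) auto
    finally show ?thesis .
  qed
  have X: "cmod (\<integral>x. f x * (G x i i * U i x) \<partial>M) \<le> S / y * R + 1 / y * (S * R) + 2 / y * D"
    unfolding centred_product_expansion[OF i]
    by (intro norm_triangle_mono norm_mult_le tri)
       (use U_mean_le[OF i] G_mean_le[OF i] fU Ri in \<open>auto simp: y_def S_def\<close>)
  have norm_le_add_cancel: "cmod a \<le> cmod (a + b) + cmod b" for a b :: complex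
    using norm_triangle_ineq4[of "a + b" b] by simp
  have "y * R \<le> cmod z * R" using R0 abs_Im_le_cmod by (intro mult_right_mono) (auto simp: y_def)
  also have "\<dots> = cmod (z * (\<integral>x. f x * G x i i \<partial>M))" by (simp add: norm_mult Ri)
  also have "\<dots> \<le> cmod (z * (\<integral>x. f x * G x i i \<partial>M) + of_real (v\<^sup>2) * (\<integral>x. f x * (G x i i * U i x) \<partial>M))
      + cmod (of_real (v\<^sup>2) * (\<integral>x. f x * (G x i i * U i x) \<partial>M))"
    by (rule norm_le_add_cancel)
  also have "\<dots> \<le> e + v\<^sup>2 * (S / y * R + 1 / y * (S * R) + 2 / y * D)"
  proof (rule add_mono)
    show "cmod (z * (\<integral>x. f x * G x i i \<partial>M) + of_real (v\<^sup>2) * (\<integral>x. f x * (G x i i * U i x) \<partial>M)) \<le> e"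
      unfolding e_def by (rule self_consistency[OF i])
    show "cmod (of_real (v\<^sup>2) * (\<integral>x. f x * (G x i i * U i x) \<partial>M)) \<le> v\<^sup>2 * (S / y * R + 1 / y * (S * R) + 2 / y * D)"
      unfolding norm_mult norm_of_real abs_power2 using X by (intro mult_mono) auto
  qed
  finally have "y * (y * R) \<le> y * (e + v\<^sup>2 * (S / y * R + 1 / y * (S * R) + 2 / y * D))"
    using y by (intro mult_left_mono) auto
  also have "\<dots> = y * e + 2 * v\<^sup>2 * S * R + 2 * v\<^sup>2 * D"
    using y by (simp add: field_simps)
  finally have main: "(y\<^sup>2 - 2 * v\<^sup>2 * S) * R \<le> 2 * v\<^sup>2 * D + y * e"
    by (simp add: power2_eq_square algebra_simps)
  have yy: "y\<^sup>2 = (Im z)\<^sup>2" by (simp add: y_def)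
  have "(y\<^sup>2 - 2 * v\<^sup>2 * S) * ?R j \<le> (y\<^sup>2 - 2 * v\<^sup>2 * S) * R"
    using gap RI[OF j] by (intro mult_left_mono) (auto simp: yy S_def)
  with main show ?thesis
    unfolding y_def[symmetric] S_def[symmetric] e_def[symmetric] yy[symmetric] by linarith
qed

end


lemma U_centred_bound: "i \<in> I \<Longrightarrow> cmod (U i x - (\<integral>x. U i x \<partial>M)) \<le> 2 * ((1 + 1 / \<beta>) / \<bar>Im z\<bar>)"
  using norm_triangle_ineq4[of "U i x" "\<integral>x. U i x \<partial>M"] U_le[of i x] U_mean_le[of i] by linarith

lemma wtrace_U: "wtrace I (s j) (G x) = of_real \<beta> * U j x"
  unfolding wtrace_def U_def sum_distrib_left using beta by (intro sum.cong refl) simp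

lemma fluct_U: "fluct cnj (s j) x = of_real \<beta> * cnj (U j x - (\<integral>x. U j x \<partial>M))"
  unfolding fluct_def wtrace_U integral_mult_right_zero right_diff_distrib[symmetric] by simp

lemma mean_abs_bound:
  fixes X :: "'w \<Rightarrow> complex"
  assumes "X \<in> borel_measurable M" "\<And>x. cmod (X x) \<le> B"
  shows "(\<integral>x. cmod (X x) \<partial>M) \<le> 1 + sqrt (\<integral>x. (cmod (X x))\<^sup>2 \<partial>M)"
proof -
  have "integrable M (\<lambda>x. (cmod (X x))\<^sup>2)"
    by (rule square_integrable[OF assms])
  moreover have "integrable M (\<lambda>x. cmod (X x) * 1)"
    using bounded_integrable[OF assms] by simp
  ultimately show ?thesis
    using product_expectation_bound[of "\<lambda>x. cmod (X x)" "\<lambda>_. 1" 1] by (simp add: prob_space)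
qed

text \<open>
  For $f = \beta\,\overline{U_j^0}$ the number $E\{f\,U_j\}$ is $\beta\,\mathbf{Var}\{U_j\}$, and it is at the same time an average of
  the numbers $E\{f\,G(i,i)\}$. For the site $j$ of largest variance, the remaining triple product is controlled by the same variance,
  $E|f|\,|U_k^0| \le \beta\,\mathbf{Var}\{U_j\}$; the gap condition says that the three contributions $v^2 + v^2 + 2v^2$, times $1+1/\beta$, do
  not reach $y^2$. What remains is a quadratic inequality for $\beta\sqrt{\mathbf{Var}\{U_j\}}$.
\<close>

lemma local_trace_variance:
  assumes gap: "4 * v\<^sup>2 * (1 + 1 / \<beta>) + 1 \<le> (Im z)\<^sup>2" and i: "i \<in> I"
  shows "(\<integral>x. (cmod (U i x - (\<integral>x. U i x \<partial>M)))\<^sup>2 \<partial>M) \<le> (variance_const v z / \<beta>)\<^sup>2"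
proof -
  define W where "W = (\<lambda>i x. U i x - (\<integral>x. U i x \<partial>M))"
  define V where "V = (\<lambda>i. \<integral>x. (cmod (W i x))\<^sup>2 \<partial>M)"
  define y where "y = \<bar>Im z\<bar>"
  define S where "S = 1 + 1 / \<beta>"
  have y: "0 < y" "y\<^sup>2 = (Im z)\<^sup>2" using z by (simp_all add: y_def)
  have S: "0 \<le> S" "S \<le> 2" using beta by (simp_all add: S_def)
  have W_m [measurable]: "W k \<in> borel_measurable M" for k unfolding W_def by measurable
  have W_b: "cmod (W k x) \<le> 2 * (S / y)" if "k \<in> I" for k x
    unfolding W_def S_def y_def by (rule U_centred_bound[OF that])
  have W_i: "integrable M (W k)" if "k \<in> I" for k by (rule bounded_integrable[OF W_m W_b[OF that]])
  have W2_i: "integrable M (\<lambda>x. (cmod (W k x))\<^sup>2)" if "k \<in> I" for k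
    by (rule square_integrable[OF W_m W_b[OF that]])
  have "Max (V ` I) \<in> V ` I" using indices_nonempty by (intro Max_in) auto
  then obtain j where j: "j \<in> I" and Vj: "V j = Max (V ` I)" by auto
  have Vmax: "V k \<le> V j" if "k \<in> I" for k using that Vj by simp
  define r where "r = \<beta> * sqrt (V j)"
  have V0: "0 \<le> V j" unfolding V_def by (rule Bochner_Integration.integral_nonneg) simp
  have r0: "0 \<le> r" and r2: "r\<^sup>2 = \<beta>\<^sup>2 * V j" using beta V0 by (simp_all add: r_def power_mult_distrib)
  let ?f = "fluct cnj (s j)"
  have f: "?f x = of_real \<beta> * cnj (W j x)" for x unfolding W_def by (rule fluct_U)
  have f_abs: "cmod (?f x) = \<beta> * cmod (W j x)" for x using beta by (simp add: f norm_mult)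
  have \<rho>: "cnj \<in> {id, cnj}" by simp
  have w: "\<bar>s j k\<bar> \<le> 1" for k by (rule s_weights)
  have fm: "?f \<in> borel_measurable M" by (rule fluct_measurable[OF \<rho>])
  have fb: "cmod (?f x) \<le> 2 * real (card I)" for x by (rule fluct_bound[OF \<rho> w])
  have f2: "(\<integral>x. (cmod (?f x))\<^sup>2 \<partial>M) = r\<^sup>2"
    unfolding f_abs power_mult_distrib r2 V_def by simp
  have sig: "(\<integral>x. cmod (?f x) \<partial>M) \<le> 1 + r"
    using mean_abs_bound[OF fm fb] r0 unfolding f2 by simp
  have D: "(\<integral>x. cmod (?f x) * cmod (U k x - (\<integral>x. U k x \<partial>M)) \<partial>M) \<le> \<beta> * V j" if k: "k \<in> I" for k
  proof -
    have "(\<integral>x. cmod (?f x) * cmod (W k x) \<partial>M) = \<beta> * (\<integral>x. cmod (W j x) * cmod (W k x) \<partial>M)"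
      unfolding f_abs by (simp add: mult.assoc)
    also have "(\<integral>x. cmod (W j x) * cmod (W k x) \<partial>M) \<le> (\<integral>x. (cmod (W j x))\<^sup>2 / 2 + (cmod (W k x))\<^sup>2 / 2 \<partial>M)"
    proof (rule integral_mono)
      show "integrable M (\<lambda>x. cmod (W j x) * cmod (W k x))"
      proof (rule bounded_integrable)
        show "norm (cmod (W j x) * cmod (W k x)) \<le> (2 * (S / y)) * (2 * (S / y))" for x
          using W_b[OF j, of x] W_b[OF k, of x] by (simp only: real_norm_def abs_mult abs_norm_cancel) (intro mult_mono, auto intro: order.trans[OF norm_ge_zero])
      qed measurable
      show "cmod (W j x) * cmod (W k x) \<le> (cmod (W j x))\<^sup>2 / 2 + (cmod (W k x))\<^sup>2 / 2" for x
        using sum_squares_bound[of "cmod (W j x)" "cmod (W k x)"] by simp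
    qed (use W2_i j k in auto)
    also have "\<dots> = V j / 2 + V k / 2" using W2_i[OF j] W2_i[OF k] by (simp add: V_def)
    also have "\<dots> \<le> V j" using Vmax[OF k] by simp
    finally have "(\<integral>x. cmod (?f x) * cmod (W k x) \<partial>M) \<le> \<beta> * V j" using beta by simp
    thus ?thesis unfolding W_def .
  qed
  let ?c = "y\<^sup>2 - 2 * v\<^sup>2 * S"
  have gap': "1 \<le> y\<^sup>2 - 4 * v\<^sup>2 * S" using gap by (simp add: y S_def)
  have vS: "0 \<le> v\<^sup>2 * S" using S by simp
  have c0: "0 \<le> ?c" using gap' vS by linarith
  have gap2: "2 * v\<^sup>2 * (1 + 1 / \<beta>) \<le> (Im z)\<^sup>2" using c0 by (simp add: y S_def)
  let ?e = "2 * v\<^sup>2 * (\<beta> * V j) + y * (consistency_const v * (2 + r) / \<beta>)"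
  have R: "?c * cmod (\<integral>x. ?f x * G x k k \<partial>M) \<le> ?e" if k: "k \<in> I" for k
  proof -
    have "?c * cmod (\<integral>x. ?f x * G x k k \<partial>M)
       \<le> 2 * v\<^sup>2 * (\<beta> * V j) + y * (consistency_const v * (1 + (\<integral>x. cmod (?f x) \<partial>M)) / \<beta>)"
      using covariance_bound[OF \<rho> w gap2 D k] by (simp add: y S_def y_def)
    also have "\<dots> \<le> ?e"
      using sig y consistency_const_nonneg beta by (intro add_left_mono mult_left_mono divide_right_mono) auto
    finally show ?thesis .
  qed
  have e0: "0 \<le> ?e" using R[OF j] c0 by (meson mult_nonneg_nonneg norm_ge_zero order.trans)
  have fW: "(\<integral>x. ?f x * U j x \<partial>M) = of_real (\<beta> * V j)"
  proof -
    have iU: "integrable M (\<lambda>x. ?f x * U j x)" by (rule fluct_times_integrable[OF \<rho> w _ U_le[OF j]]) measurable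
    have "(\<integral>x. ?f x * W j x \<partial>M) = (\<integral>x. ?f x * U j x - ?f x * (\<integral>x. U j x \<partial>M) \<partial>M)"
      by (simp add: W_def right_diff_distrib)
    also have "\<dots> = (\<integral>x. ?f x * U j x \<partial>M)"
      using iU fluct_integrable[OF \<rho> w] fluct_mean[OF \<rho> w] by simp
    finally have "(\<integral>x. ?f x * U j x \<partial>M) = (\<integral>x. ?f x * W j x \<partial>M)" ..
    also have "\<dots> = (\<integral>x. of_real (\<beta> * (cmod (W j x))\<^sup>2) \<partial>M)"
      by (intro Bochner_Integration.integral_cong refl) (simp add: f complex_norm_square[symmetric] mult_ac)
    also have "\<dots> = of_real (\<integral>x. \<beta> * (cmod (W j x))\<^sup>2 \<partial>M)" by (rule integral_complex_of_real)
    finally show ?thesis by (simp add: V_def)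
  qed
  have "?c * (\<beta> * V j) = ?c * cmod (\<integral>x. ?f x * U j x \<partial>M)" unfolding fW norm_of_real using beta V0 by simp
  also have "(\<integral>x. ?f x * U j x \<partial>M) = (\<Sum>p\<in>I. of_real (s j p / \<beta>) * (\<integral>x. ?f x * G x p p \<partial>M))"
    by (rule fluct_times_U[OF \<rho> w])
  also have "?c * cmod (\<Sum>p\<in>I. of_real (s j p / \<beta>) * (\<integral>x. ?f x * G x p p \<partial>M))
      \<le> ?c * (\<Sum>p\<in>I. s j p / \<beta> * cmod (\<integral>x. ?f x * G x p p \<partial>M))"
    using s_range beta
    by (intro mult_left_mono c0 sum_norm_le)
       (simp add: norm_mult norm_divide abs_of_nonneg)
  also have "\<dots> = (\<Sum>p\<in>I. s j p / \<beta> * (?c * cmod (\<integral>x. ?f x * G x p p \<partial>M)))"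
    by (simp only: sum_distrib_left mult.left_commute[of ?c])
  also have "\<dots> \<le> (\<Sum>p\<in>I. s j p / \<beta> * ?e)"
    using s_range beta by (intro sum_mono mult_left_mono R) auto
  also have "\<dots> = (\<Sum>p\<in>I. s j p / \<beta>) * ?e" by (simp only: sum_distrib_right)
  also have "\<dots> \<le> S * ?e" unfolding S_def using s_row2[OF j] e0 by (intro mult_right_mono)
  also have "\<dots> = S * (2 * v\<^sup>2 * (\<beta> * V j)) + S * (y * (consistency_const v * (2 + r) / \<beta>))" by (rule distrib_left)
  also have "S * (y * (consistency_const v * (2 + r) / \<beta>)) \<le> 2 * (y * (consistency_const v * (2 + r) / \<beta>))"
    using S y consistency_const_nonneg r0 beta by (intro mult_right_mono) auto
  finally have "?c * (\<beta> * V j) \<le> S * (2 * v\<^sup>2 * (\<beta> * V j)) + 2 * (y * (consistency_const v * (2 + r) / \<beta>))" by simp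
  hence "(y\<^sup>2 - 4 * v\<^sup>2 * S) * (\<beta> * V j) \<le> 2 * (y * (consistency_const v * (2 + r) / \<beta>))"
    by (simp add: algebra_simps)
  moreover have "1 * (\<beta> * V j) \<le> (y\<^sup>2 - 4 * v\<^sup>2 * S) * (\<beta> * V j)"
    using gap' beta V0 by (intro mult_right_mono) auto
  ultimately have "\<beta> * V j \<le> 2 * (y * (consistency_const v * (2 + r) / \<beta>))" by linarith
  hence "\<beta> * (\<beta> * V j) \<le> \<beta> * (2 * (y * (consistency_const v * (2 + r) / \<beta>)))"
    using beta by (intro mult_left_mono) auto
  moreover have "\<beta> * (\<beta> * V j) = r\<^sup>2" unfolding r2 by (simp add: power2_eq_square mult.assoc)
  moreover have "\<beta> * (2 * (y * (consistency_const v * (2 + r) / \<beta>))) = (2 * y * consistency_const v) * (2 + r)"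
    using beta by simp
  ultimately have "r\<^sup>2 \<le> (2 * y * consistency_const v) * (2 + r)" by simp
  hence "r \<le> 2 * y * consistency_const v + 2" using y consistency_const_nonneg by (intro quadratic_bootstrap) auto
  hence "r \<le> variance_const v z" by (simp add: variance_const_def y_def)
  hence "r\<^sup>2 \<le> (variance_const v z)\<^sup>2" using r0 by (intro power_mono)
  hence "V j \<le> (variance_const v z / \<beta>)\<^sup>2" using beta by (simp add: r2 power_divide field_simps)
  with Vmax[OF i] show ?thesis unfolding V_def W_def by simp
qed

text \<open>
  The triple product is now estimated by the Cauchy--Schwarz inequality and the bound $O(1/\beta)$ for the standard
  deviation of the local trace.
\<close>

lemma trace_covariance:
  assumes gap: "4 * v\<^sup>2 * (1 + 1 / \<beta>) + 1 \<le> (Im z)\<^sup>2" and \<rho>: "\<rho> \<in> {id, cnj}" and i: "i \<in> I"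
  shows "cmod (\<integral>x. fluct \<rho> (\<lambda>_. 1) x * G x i i \<partial>M)
    \<le> covariance_const v z * (1 + sqrt (\<integral>x. (cmod (fluct \<rho> (\<lambda>_. 1) x))\<^sup>2 \<partial>M)) / \<beta>"
proof -
  let ?f = "fluct \<rho> (\<lambda>_. 1)"
  define \<Gamma> where "\<Gamma> = sqrt (\<integral>x. (cmod (?f x))\<^sup>2 \<partial>M)"
  have \<Gamma>: "0 \<le> \<Gamma>" unfolding \<Gamma>_def by (intro real_sqrt_ge_zero Bochner_Integration.integral_nonneg) simp
  have w: "\<bar>(\<lambda>_. 1::real) r\<bar> \<le> 1" for r :: int by simp
  have fm: "?f \<in> borel_measurable M" by (rule fluct_measurable[OF \<rho>])
  have fb: "cmod (?f x) \<le> 2 * real (card I)" for x by (rule fluct_bound[OF \<rho> w])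
  have f2i: "integrable M (\<lambda>x. (cmod (?f x))\<^sup>2)"
    by (rule square_integrable[OF fm fb])
  have sig: "(\<integral>x. cmod (?f x) \<partial>M) \<le> 1 + \<Gamma>" unfolding \<Gamma>_def by (rule mean_abs_bound[OF fm fb])
  have D: "(\<integral>x. cmod (?f x) * cmod (U k x - (\<integral>x. U k x \<partial>M)) \<partial>M) \<le> variance_const v z / \<beta> * (1 + \<Gamma>)" if k: "k \<in> I" for k
    unfolding \<Gamma>_def
  proof (rule product_expectation_bound[OF f2i])
    let ?W = "\<lambda>x. U k x - (\<integral>x. U k x \<partial>M)"
    have Wm: "?W \<in> borel_measurable M" by measurable
    show "integrable M (\<lambda>x. (cmod (?W x))\<^sup>2)"
      by (rule square_integrable[OF Wm U_centred_bound[OF k]])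
    show "integrable M (\<lambda>x. cmod (?f x) * cmod (?W x))"
      using integrable_norm[OF fluct_times_integrable[OF \<rho> w Wm U_centred_bound[OF k]]] by (simp add: norm_mult)
    show "0 < variance_const v z / \<beta>" using variance_const_pos beta by simp
    show "(\<integral>x. (cmod (?W x))\<^sup>2 \<partial>M) \<le> (variance_const v z / \<beta>)\<^sup>2" by (rule local_trace_variance[OF gap k])
  qed
  define S where "S = 1 + 1 / \<beta>"
  have vS: "0 \<le> v\<^sup>2 * S" using beta by (simp add: S_def)
  have gap': "4 * (v\<^sup>2 * S) + 1 \<le> (Im z)\<^sup>2" using gap by (simp add: S_def mult_ac)
  have gap2: "2 * v\<^sup>2 * (1 + 1 / \<beta>) \<le> (Im z)\<^sup>2"
    unfolding S_def[symmetric] mult.assoc using gap' vS by linarith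
  \<comment> \<open>Only the two linear terms are moved to the left here, so that half of $4v^2$ suffices.\<close>
  have c1: "1 \<le> (Im z)\<^sup>2 - 2 * v\<^sup>2 * (1 + 1 / \<beta>)"
    unfolding S_def[symmetric] mult.assoc using gap' vS by linarith
  have "1 * cmod (\<integral>x. ?f x * G x i i \<partial>M)
      \<le> ((Im z)\<^sup>2 - 2 * v\<^sup>2 * (1 + 1 / \<beta>)) * cmod (\<integral>x. ?f x * G x i i \<partial>M)"
    by (rule mult_right_mono[OF c1]) simp
  also have "\<dots> \<le> 2 * v\<^sup>2 * (variance_const v z / \<beta> * (1 + \<Gamma>)) + \<bar>Im z\<bar> * (consistency_const v * (1 + (\<integral>x. cmod (?f x) \<partial>M)) / \<beta>)"
    by (rule covariance_bound[OF \<rho> w gap2 D i])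
  also have "\<dots> \<le> 2 * v\<^sup>2 * (variance_const v z / \<beta> * (1 + \<Gamma>)) + \<bar>Im z\<bar> * (consistency_const v * (2 * (1 + \<Gamma>)) / \<beta>)"
    using sig \<Gamma> consistency_const_nonneg beta by (intro add_left_mono mult_left_mono divide_right_mono) auto
  also have "\<dots> = covariance_const v z * (1 + \<Gamma>) / \<beta>"
    using beta by (simp add: covariance_const_def field_simps)
  finally show ?thesis unfolding \<Gamma>_def by simp
qed

definition g :: "'w \<Rightarrow> complex" where
  "g x = (\<Sum>i\<in>I. G x i i) / of_nat (2 * n + 1)"

abbreviation "N \<equiv> real (2 * n + 1)"

lemma wtrace_g: "wtrace I (\<lambda>_. 1) (G x) = of_real N * g x"
  by (simp add: wtrace_def g_def del: of_nat_Suc of_nat_add)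

lemma fluct_g:
  assumes "\<rho> \<in> {id, cnj}"
  shows "fluct \<rho> (\<lambda>_. 1) x = of_real N * \<rho> (centred M g x)"
proof -
  have "wtrace I (\<lambda>_. 1) (G x) - (\<integral>x. wtrace I (\<lambda>_. 1) (G x) \<partial>M) = of_real N * centred M g x"
    unfolding wtrace_g integral_mult_right_zero right_diff_distrib[symmetric] centred_def ..
  thus ?thesis unfolding fluct_def using assms by auto
qed

lemma fluct_g_square:
  assumes "\<rho> \<in> {id, cnj}"
  shows "(\<integral>x. (cmod (fluct \<rho> (\<lambda>_. 1) x))\<^sup>2 \<partial>M) = N\<^sup>2 * cvariance M g"
proof -
  have "(cmod (fluct \<rho> (\<lambda>_. 1) x))\<^sup>2 = N\<^sup>2 * (cmod (centred M g x))\<^sup>2" for x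
    unfolding fluct_g[OF assms] norm_mult norm_of_real id_or_cnj_cmod[OF assms] power_mult_distrib power2_abs ..
  thus ?thesis unfolding cvariance_def by simp
qed

lemma cvariance_nonneg: "0 \<le> cvariance M g"
  unfolding cvariance_def by (rule Bochner_Integration.integral_nonneg) simp

lemma trace_covariance_g:
  assumes gap: "4 * v\<^sup>2 * (1 + 1 / \<beta>) + 1 \<le> (Im z)\<^sup>2" and i: "i \<in> I"
  shows "cmod (\<integral>x. centred M g x * centred M (\<lambda>x. G x i i) x \<partial>M)
    \<le> covariance_const v z * (1 / (N * \<beta>) + sqrt (cvariance M g) / \<beta>)"
proof -
  let ?f = "fluct id (\<lambda>_. 1)"
  have \<rho>: "id \<in> {id, cnj}" by simp
  have w: "\<bar>(\<lambda>_. 1::real) r\<bar> \<le> 1" for r :: int by simp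
  have N: "0 < N" by simp
  have int: "integrable M (\<lambda>x. ?f x * G x i i)"
    using i by (intro fluct_times_integrable[OF \<rho> w _ G_le1[OF i i]]) measurable
  define m where "m = (\<integral>x. G x i i \<partial>M)"
  have "of_real N * (\<integral>x. centred M g x * centred M (\<lambda>x. G x i i) x \<partial>M)
      = (\<integral>x. of_real N * (centred M g x * centred M (\<lambda>x. G x i i) x) \<partial>M)"
    by (rule integral_mult_right_zero[symmetric])
  also have "\<dots> = (\<integral>x. ?f x * G x i i - ?f x * m \<partial>M)"
    unfolding fluct_g[OF \<rho>] id_apply centred_def[of _ "\<lambda>x. G x i i"] m_def[symmetric]
    by (simp only: right_diff_distrib mult.assoc)
  also have "\<dots> = (\<integral>x. ?f x * G x i i \<partial>M)"
    using int fluct_integrable[OF \<rho> w] fluct_mean[OF \<rho> w] by simp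
  finally have scaled: "of_real N * (\<integral>x. centred M g x * centred M (\<lambda>x. G x i i) x \<partial>M) = (\<integral>x. ?f x * G x i i \<partial>M)" .
  have "N * cmod (\<integral>x. centred M g x * centred M (\<lambda>x. G x i i) x \<partial>M) = cmod (\<integral>x. ?f x * G x i i \<partial>M)"
    unfolding scaled[symmetric] norm_mult norm_of_real abs_of_pos[OF N] ..
  also have "\<dots> \<le> covariance_const v z * (1 + sqrt (N\<^sup>2 * cvariance M g)) / \<beta>"
    using trace_covariance[OF gap \<rho> i] unfolding fluct_g_square[OF \<rho>] .
  also have "sqrt (N\<^sup>2 * cvariance M g) = N * sqrt (cvariance M g)"
    using N by (simp only: real_sqrt_mult real_sqrt_abs abs_of_pos)
  also have "covariance_const v z * (1 + N * sqrt (cvariance M g)) / \<beta>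
      = N * (covariance_const v z * (1 / (N * \<beta>) + sqrt (cvariance M g) / \<beta>))"
    using N beta by (simp add: field_simps del: of_nat_Suc of_nat_add)
  finally show ?thesis using N by (simp only: mult_le_cancel_left_pos)
qed

text \<open>
  The variance of the trace is $E\{f\,\mathrm{Tr}\,G\}$ with the conjugate fluctuation $f$, hence a sum of $N$ covariances
  that are bounded by \<open>trace_covariance\<close>; this is again a quadratic inequality.
\<close>

lemma trace_variance_g:
  assumes gap: "4 * v\<^sup>2 * (1 + 1 / \<beta>) + 1 \<le> (Im z)\<^sup>2" and bN: "\<beta> \<le> N"
  shows "cvariance M g \<le> ((covariance_const v z + 1) / \<beta>)\<^sup>2"
proof -
  let ?f = "fluct cnj (\<lambda>_. 1)" and ?C = "covariance_const v z"
  define r where "r = N * sqrt (cvariance M g)"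
  have \<rho>: "cnj \<in> {id, cnj}" by simp
  have w: "\<bar>(\<lambda>_. 1::real) r\<bar> \<le> 1" for r :: int by simp
  have N: "0 < N" by simp
  have r0: "0 \<le> r" and r2: "r\<^sup>2 = N\<^sup>2 * cvariance M g"
    using cvariance_nonneg by (simp_all add: r_def power_mult_distrib)
  have sq: "sqrt (N\<^sup>2 * cvariance M g) = r"
    using r0 unfolding r2[symmetric] by simp
  have int: "integrable M (\<lambda>x. ?f x * G x i i)" if i: "i \<in> I" for i
    using i by (intro fluct_times_integrable[OF \<rho> w _ G_le1[OF i i]]) measurable
  have "complex_of_real (r\<^sup>2) = (\<integral>x. of_real ((cmod (?f x))\<^sup>2) \<partial>M)"
    unfolding r2 fluct_g_square[OF \<rho>, symmetric] integral_complex_of_real ..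
  also have "\<dots> = (\<integral>x. ?f x * (\<Sum>i\<in>I. G x i i) - ?f x * (\<integral>x. wtrace I (\<lambda>_. 1) (G x) \<partial>M) \<partial>M)"
  proof (intro Bochner_Integration.integral_cong refl)
    fix x
    have "of_real ((cmod (?f x))\<^sup>2) = ?f x * cnj (?f x)" by (rule complex_norm_square)
    also have "cnj (?f x) = wtrace I (\<lambda>_. 1) (G x) - (\<integral>x. wtrace I (\<lambda>_. 1) (G x) \<partial>M)"
      by (simp only: fluct_def complex_cnj_cnj)
    also have "wtrace I (\<lambda>_. 1) (G x) = (\<Sum>i\<in>I. G x i i)" by (simp add: wtrace_def)
    finally show "complex_of_real ((cmod (?f x))\<^sup>2)
        = ?f x * (\<Sum>i\<in>I. G x i i) - ?f x * (\<integral>x. wtrace I (\<lambda>_. 1) (G x) \<partial>M)"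
      by (simp only: right_diff_distrib)
  qed
  also have "\<dots> = (\<Sum>i\<in>I. \<integral>x. ?f x * G x i i \<partial>M)"
    using int fluct_integrable[OF \<rho> w] fluct_mean[OF \<rho> w] by (simp add: sum_distrib_left)
  finally have square: "complex_of_real (r\<^sup>2) = (\<Sum>i\<in>I. \<integral>x. ?f x * G x i i \<partial>M)" .
  have "r\<^sup>2 = cmod (\<Sum>i\<in>I. \<integral>x. ?f x * G x i i \<partial>M)"
    unfolding square[symmetric] norm_of_real abs_power2 ..
  also have "\<dots> \<le> (\<Sum>i\<in>I. ?C * (1 + r) / \<beta>)"
    using trace_covariance[OF gap \<rho>] unfolding fluct_g_square[OF \<rho>] sq by (intro sum_norm_le)
  also have "\<dots> = (N * ?C / \<beta>) * (1 + r)" by (simp add: card_indices)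
  finally have "r \<le> N * ?C / \<beta> + 1"
    using covariance_const_nonneg beta N by (intro quadratic_bootstrap) auto
  also have "\<dots> \<le> N * ?C / \<beta> + N / \<beta>" using bN beta by (intro add_left_mono) (simp add: field_simps)
  also have "\<dots> = N * ((?C + 1) / \<beta>)" by (simp add: algebra_simps add_divide_distrib)
  finally have "sqrt (cvariance M g) \<le> (?C + 1) / \<beta>" unfolding r_def using N by (simp only: mult_le_cancel_left_pos)
  hence "(sqrt (cvariance M g))\<^sup>2 \<le> ((?C + 1) / \<beta>)\<^sup>2" using cvariance_nonneg by (intro power_mono) auto
  thus ?thesis using cvariance_nonneg by simp
qed

end

section \<open>Long-range percolation matrices\<close>

text \<open>
  For sets of product form the joint probability factors first into the two families and then within each of them, and
  finite intersections of this kind determine independence.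
\<close>

lemma (in prob_space) indep_vars_joined:
  fixes X D :: "'i \<Rightarrow> 'a \<Rightarrow> real"
  assumes X: "indep_vars (\<lambda>_. borel) X I" and A: "A \<subseteq> I" "finite A" "A \<noteq> {}"
    and D: "indep_vars (\<lambda>_. borel) D B" and B: "finite B" "B \<noteq> {}"
    and ind: "indep_var (Pi\<^sub>M I (\<lambda>_. borel)) (\<lambda>x. \<lambda>i\<in>I. X i x) (Pi\<^sub>M B (\<lambda>_. borel)) (\<lambda>x. \<lambda>i\<in>B. D i x)"
  shows "indep_vars (\<lambda>_. borel) (case_sum X D) (A <+> B)"
proof -
  have XA: "indep_vars (\<lambda>_. borel) X A" by (rule indep_vars_subset[OF X A(1)])
  have Xm: "X i \<in> borel_measurable M" if "i \<in> I" for i using X that by (auto simp: indep_vars_def)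
  have Dm: "D i \<in> borel_measurable M" if "i \<in> B" for i using D that by (auto simp: indep_vars_def)
  show ?thesis
  proof (subst indep_vars_finite[where E = "\<lambda>_. sets borel"])
    show "\<forall>S\<in>\<Pi> i\<in>A <+> B. sets borel. prob (\<Inter>j\<in>A <+> B. case_sum X D j -` S j \<inter> space M)
        = (\<Prod>j\<in>A <+> B. prob (case_sum X D j -` S j \<inter> space M))"
    proof
      fix S :: "'i + 'i \<Rightarrow> real set" assume S: "S \<in> (\<Pi> i\<in>A <+> B. sets borel)"
      have SA: "S (Inl i) \<in> sets borel" if "i \<in> A" for i using S that by (auto simp: Pi_iff)
      have SB: "S (Inr i) \<in> sets borel" if "i \<in> B" for i using S that by (auto simp: Pi_iff)
      define PA where "PA = {f \<in> space (Pi\<^sub>M I (\<lambda>_. borel :: real measure)). \<forall>i\<in>A. f i \<in> S (Inl i)}"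
      define PB where "PB = {f \<in> space (Pi\<^sub>M B (\<lambda>_. borel :: real measure)). \<forall>i\<in>B. f i \<in> S (Inr i)}"
      have PA: "PA \<in> sets (Pi\<^sub>M I (\<lambda>_. borel))"
      proof -
        have "PA = (\<Inter>i\<in>A. (\<lambda>f. f i) -` S (Inl i) \<inter> space (Pi\<^sub>M I (\<lambda>_. borel)))"
          using A(3) by (auto simp: PA_def)
        also have "\<dots> \<in> sets (Pi\<^sub>M I (\<lambda>_. borel))"
          using A SA by (intro sets.finite_INT measurable_sets[OF measurable_component_singleton]) auto
        finally show ?thesis .
      qed
      have PB: "PB \<in> sets (Pi\<^sub>M B (\<lambda>_. borel))"
      proof -
        have "PB = (\<Inter>i\<in>B. (\<lambda>f. f i) -` S (Inr i) \<inter> space (Pi\<^sub>M B (\<lambda>_. borel)))"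
          using B(2) by (auto simp: PB_def)
        also have "\<dots> \<in> sets (Pi\<^sub>M B (\<lambda>_. borel))"
          using B SB by (intro sets.finite_INT measurable_sets[OF measurable_component_singleton]) auto
        finally show ?thesis .
      qed
      have eqA: "(\<lambda>x. \<lambda>i\<in>I. X i x) -` PA \<inter> space M = (\<Inter>i\<in>A. X i -` S (Inl i) \<inter> space M)"
        using A by (auto simp: PA_def space_PiM)
      have eqB: "(\<lambda>x. \<lambda>i\<in>B. D i x) -` PB \<inter> space M = (\<Inter>i\<in>B. D i -` S (Inr i) \<inter> space M)"
        using B by (auto simp: PB_def space_PiM)
      have "(\<Inter>j\<in>A <+> B. case_sum X D j -` S j \<inter> space M)
          = (\<Inter>i\<in>A. X i -` S (Inl i) \<inter> space M) \<inter> (\<Inter>i\<in>B. D i -` S (Inr i) \<inter> space M)"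
        by (auto simp: Plus_def ball_Un)
      also have "\<dots> = (\<lambda>x. (\<lambda>i\<in>I. X i x, \<lambda>i\<in>B. D i x)) -` (PA \<times> PB) \<inter> space M"
        unfolding eqA[symmetric] eqB[symmetric] by auto
      finally have "prob (\<Inter>j\<in>A <+> B. case_sum X D j -` S j \<inter> space M)
          = prob (\<Inter>i\<in>A. X i -` S (Inl i) \<inter> space M) * prob (\<Inter>i\<in>B. D i -` S (Inr i) \<inter> space M)"
        using indep_varD[OF ind PA PB] unfolding eqA eqB by (simp only:)
      also have "prob (\<Inter>i\<in>A. X i -` S (Inl i) \<inter> space M) = (\<Prod>i\<in>A. prob (X i -` S (Inl i) \<inter> space M))"
        by (rule indep_varsD_finite[OF XA A(3,2)]) (rule SA)
      also have "prob (\<Inter>i\<in>B. D i -` S (Inr i) \<inter> space M) = (\<Prod>i\<in>B. prob (D i -` S (Inr i) \<inter> space M))"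
        by (rule indep_varsD_finite[OF D B(2,1)]) (rule SB)
      finally show "prob (\<Inter>j\<in>A <+> B. case_sum X D j -` S j \<inter> space M)
        = (\<Prod>j\<in>A <+> B. prob (case_sum X D j -` S j \<inter> space M))"
        using A B by (simp add: prod.Plus)
    qed
    show "case_sum X D i \<in> borel_measurable M" if "i \<in> A <+> B" for i
      using that A Xm Dm by auto
    show "sets borel = sigma_sets (space borel) (sets borel)" by (simp only: sets.sigma_sets_eq)
    show "Int_stable (sets borel)" by (rule sets.Int_stable)
  qed (use A B in \<open>auto simp: sets.space_closed\<close>)
qed

text \<open>
  By monotonicity, the value of $\psi$ at a lattice point different from $0$ is a lower bound of $\psi$ on the adjacent lattice
  interval on the side of the origin. These intervals are disjoint, so that the Riemann sum is at most the integral. The origin itself has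
  no such interval and is left out.
\<close>

lemma profile_riemann_sum:
  fixes \<psi> :: "real \<Rightarrow> real" and \<beta> :: real and i :: int and J :: "int set"
  assumes nonneg: "\<And>t. 0 \<le> \<psi> t" and even: "\<And>t. \<psi> (- t) = \<psi> t"
    and mono: "\<And>s t. 0 \<le> s \<Longrightarrow> s \<le> t \<Longrightarrow> \<psi> t \<le> \<psi> s"
    and int: "has_bochner_integral lborel \<psi> 1" and \<beta>: "0 < \<beta>" and J: "finite J" "i \<notin> J"
  shows "(\<Sum>p\<in>J. \<psi> (real_of_int (i - p) / \<beta>)) / \<beta> \<le> 1"
proof -
  define lo where "lo = (\<lambda>p. if p < i then i - p - 1 else i - p)"
  define A where "A = (\<lambda>p. {real_of_int (lo p) / \<beta> <..< (real_of_int (lo p) + 1) / \<beta>})"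
  let ?c = "\<lambda>p. \<psi> (real_of_int (i - p) / \<beta>)"
  have len: "emeasure lborel (A p) = ennreal (1 / \<beta>)" "measure lborel (A p) = 1 / \<beta>" for p
    using \<beta> by (auto simp: A_def divide_right_mono diff_divide_distrib[symmetric])
  have int_c: "integrable lborel (\<lambda>t. ?c p * indicator (A p) t)" for p
    using len(1)[of p] by (intro integrable_mult_right integrable_real_indicator) (auto simp: A_def)
  have val: "(\<integral>t. ?c p * indicator (A p) t \<partial>lborel) = ?c p / \<beta>" for p
    using len(2)[of p] by simp
  have lo_eq: "lo p = \<lfloor>t * \<beta>\<rfloor>" if "t \<in> A p" for p t
    using that \<beta> by (intro floor_unique[symmetric]) (auto simp: A_def field_simps)
  have dominated: "?c p \<le> \<psi> t" if t: "t \<in> A p" and p: "p \<noteq> i" for p t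
  proof (cases "p < i")
    case True
    hence lo: "0 \<le> real_of_int (lo p)" "real_of_int (lo p) + 1 = real_of_int (i - p)" by (simp_all add: lo_def)
    have "0 \<le> real_of_int (lo p) / \<beta>" using lo(1) \<beta> by simp
    hence "0 \<le> t" "t \<le> real_of_int (i - p) / \<beta>" using t unfolding A_def lo(2) by simp_all
    thus ?thesis by (rule mono)
  next
    case False
    hence lo: "real_of_int (lo p) + 1 \<le> 0" "lo p = i - p" using p by (simp_all add: lo_def)
    have "(real_of_int (lo p) + 1) / \<beta> \<le> 0" using lo(1) \<beta> by (simp add: divide_nonpos_pos)
    hence "0 \<le> - t" "- t \<le> - (real_of_int (i - p) / \<beta>)" using t unfolding A_def lo(2) by simp_all
    hence "\<psi> (- (real_of_int (i - p) / \<beta>)) \<le> \<psi> (- t)" by (rule mono)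
    thus ?thesis by (simp only: even)
  qed
  have "(\<Sum>p\<in>J. ?c p) / \<beta> = (\<Sum>p\<in>J. \<integral>t. ?c p * indicator (A p) t \<partial>lborel)"
    unfolding val by (rule sum_divide_distrib)
  also have "\<dots> = (\<integral>t. (\<Sum>p\<in>J. ?c p * indicator (A p) t) \<partial>lborel)"
    using int_c by (intro Bochner_Integration.integral_sum[symmetric]) auto
  also have "\<dots> \<le> (\<integral>t. \<psi> t \<partial>lborel)"
  proof (rule integral_mono)
    show "integrable lborel (\<lambda>t. \<Sum>p\<in>J. ?c p * indicator (A p) t)"
      using int_c by (intro Bochner_Integration.integrable_sum) auto
    show "integrable lborel \<psi>" using int by (rule integrable.intros)
    fix t :: real
    define m where "m = \<lfloor>t * \<beta>\<rfloor>"
    \<comment> \<open>The only lattice point whose interval can contain $t$: right of the origin it lies one step further out.\<close>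
    define p0 where "p0 = (if 0 \<le> m then i - 1 - m else i - m)"
    have "(\<Sum>p\<in>J. ?c p * indicator (A p) t) \<le> (\<Sum>p\<in>J. if p = p0 then \<psi> t else 0)"
    proof (rule sum_mono)
      fix p assume p: "p \<in> J"
      hence pi: "p \<noteq> i" using J by auto
      show "?c p * indicator (A p) t \<le> (if p = p0 then \<psi> t else 0)"
      proof (cases "t \<in> A p")
        case True
        have "lo p = m" unfolding m_def by (rule lo_eq[OF True])
        hence "p = p0" using pi by (auto simp: lo_def p0_def split: if_splits)
        thus ?thesis using dominated[OF True pi] True by simp
      qed (use nonneg in auto)
    qed
    also have "\<dots> \<le> \<psi> t" using nonneg J by (simp add: sum.delta)
    finally show "(\<Sum>p\<in>J. ?c p * indicator (A p) t) \<le> \<psi> t" .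
  qed
  also have "\<dots> = 1" using int by (rule has_bochner_integral_integral_eq)
  finally show ?thesis .
qed

context long_range_percolation
begin

definition entry :: "nat \<Rightarrow> int \<times> int \<Rightarrow> 'w \<Rightarrow> real" where
  "entry n e x = a (fst e) (snd e) x * d n (fst e) (snd e) x / sqrt (real (b n))"

definition profile :: "nat \<Rightarrow> int \<Rightarrow> int \<Rightarrow> real" where
  "profile n i j = \<psi> (real_of_int (i - j) / real (b n))"

lemma b_pos: "0 < real (b n)" using b_bounds[of n] by simp

lemma profile_row:
  assumes "i \<in> indices n"
  shows "(\<Sum>p\<in>indices n. profile n i p) / real (b n) \<le> 1 + 1 / real (b n)"
proof -
  have "(\<Sum>p\<in>indices n. profile n i p) = \<psi> 0 + (\<Sum>p\<in>indices n - {i}. profile n i p)"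
    using assms by (simp add: sum.remove[of _ i] profile_def)
  moreover have "(\<Sum>p\<in>indices n - {i}. profile n i p) / real (b n) \<le> 1"
    unfolding profile_def using \<psi>_range \<psi>_even \<psi>_noninc \<psi>_integral b_pos
    by (intro profile_riemann_sum) auto
  moreover have "\<psi> 0 / real (b n) \<le> 1 / real (b n)" using \<psi>_range[of 0] by (intro divide_right_mono) auto
  ultimately show ?thesis by (simp add: add_divide_distrib)
qed

lemma finite_pairs: "finite (upper_pairs_upto n)"
  by (rule finite_subset[of _ "{- int n..int n} \<times> {- int n..int n}"]) (auto simp: upper_pairs_upto_def)

lemma pairs_nonempty: "upper_pairs_upto n \<noteq> {}"
  by (auto simp: upper_pairs_upto_def)

lemma pairs_subset: "upper_pairs_upto n \<subseteq> upper_pairs"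
  by (auto simp: upper_pairs_upto_def upper_pairs_def)

lemma entry_indep: "indep_vars (\<lambda>_. borel) (entry n) (upper_pairs_upto n)"
proof -
  let ?U = "upper_pairs_upto n"
  let ?Y = "case_sum (\<lambda>(i, j). a i j) (\<lambda>(i, j). d n i j)"
  let ?K = "\<lambda>e. {Inl e, Inr e}"
  have blocks: "indep_var (Pi\<^sub>M upper_pairs (\<lambda>_. borel)) (\<lambda>x. \<lambda>e\<in>upper_pairs. (\<lambda>(i, j). a i j) e x)
      (Pi\<^sub>M ?U (\<lambda>_. borel)) (\<lambda>x. \<lambda>e\<in>?U. (\<lambda>(i, j). d n i j) e x)"
    using a_d_indep[of n] by (simp add: case_prod_unfold)
  have "indep_vars (\<lambda>_. borel) ?Y (?U <+> ?U)"
    by (rule indep_vars_joined[OF a_indep pairs_subset finite_pairs pairs_nonempty d_indep finite_pairs pairs_nonempty blocks])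
  hence "indep_vars (\<lambda>e. Pi\<^sub>M (?K e) (\<lambda>_. borel)) (\<lambda>e x. \<lambda>i\<in>?K e. ?Y i x) ?U"
    by (rule indep_vars_restrict) (auto simp: disjoint_family_on_def)
  hence "indep_vars (\<lambda>_. borel) (\<lambda>e x. (\<lambda>f. f (Inl e) * f (Inr e) / sqrt (real (b n))) (\<lambda>i\<in>?K e. ?Y i x)) ?U"
    by (rule indep_vars_compose2) measurable
  thus ?thesis by (simp add: entry_def[abs_def] case_prod_unfold)
qed

lemma entry_factors_indep:
  assumes "(i, j) \<in> upper_pairs_upto n"
  shows "indep_var borel (a i j) borel (d n i j)"
proof -
  have "(i, j) \<in> upper_pairs" using assms pairs_subset by auto
  thus ?thesis
    using indep_var_compose[OF a_d_indep[of n], of "\<lambda>f. f (i, j)" borel "\<lambda>f. f (i, j)" borel] assms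
    by (simp add: comp_def)
qed

text \<open>
  Almost surely $d$ is the indicator of the event $d = 1$, because the two given probabilities add up to $1$.
\<close>

lemma d_power_mean:
  assumes e: "(i, j) \<in> upper_pairs_upto n" and k: "0 < k"
  shows "integrable M (\<lambda>x. d n i j x ^ k)" "(\<integral>x. d n i j x ^ k \<partial>M) = profile n i j"
proof -
  have m [measurable]: "d n i j \<in> borel_measurable M" using indep_var_rv2[OF entry_factors_indep[OF e]] .
  let ?A = "{x \<in> space M. d n i j x = 1}" and ?B = "{x \<in> space M. d n i j x = 0}"
  have ms: "?A \<in> events" "?B \<in> events" by measurable
  have "prob (?A \<union> ?B) = prob ?A + prob ?B" using ms by (intro finite_measure_Union) auto
  also have "\<dots> = 1" unfolding d_one[OF e] d_zero[OF e] by simp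
  finally have "prob (?A \<union> ?B) = 1" .
  hence "AE x in M. x \<in> ?A \<union> ?B" using ms prob_eq_1[of "?A \<union> ?B"] by blast
  hence ae: "AE x in M. d n i j x ^ k = indicator ?A x"
    by eventually_elim (use k in \<open>auto simp: indicator_def power_0_left\<close>)
  have iA: "integrable M (indicator ?A :: 'w \<Rightarrow> real)" using ms by (intro integrable_real_indicator) (auto simp: emeasure_eq_measure)
  show "integrable M (\<lambda>x. d n i j x ^ k)"
    by (rule integrable_cong_AE_imp[OF iA]) (use ae in \<open>auto\<close>)
  have "(\<integral>x. d n i j x ^ k \<partial>M) = (\<integral>x. indicator ?A x \<partial>M)"
    using ae by (intro integral_cong_AE) (use ms in auto)
  also have "\<dots> = prob ?A" using ms by simp
  finally show "(\<integral>x. d n i j x ^ k \<partial>M) = profile n i j" unfolding d_one[OF e] profile_def .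
qed

lemma entry_moment:
  assumes e: "(i, j) \<in> upper_pairs_upto n" and k: "0 < k" and ak: "integrable M (\<lambda>x. a i j x ^ k)"
  shows "integrable M (\<lambda>x. entry n (i, j) x ^ k)"
    "(\<integral>x. entry n (i, j) x ^ k \<partial>M) = (\<integral>x. a i j x ^ k \<partial>M) * profile n i j / sqrt (real (b n)) ^ k"
proof -
  have ind: "indep_var borel (\<lambda>x. a i j x ^ k) borel (\<lambda>x. d n i j x ^ k)"
    using indep_var_compose[OF entry_factors_indep[OF e], of "\<lambda>x. x ^ k" borel "\<lambda>x. x ^ k" borel] by (simp add: comp_def)
  have eq: "entry n (i, j) x ^ k = (a i j x ^ k * d n i j x ^ k) / sqrt (real (b n)) ^ k" for x
    by (simp add: entry_def power_mult_distrib power_divide)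
  show "integrable M (\<lambda>x. entry n (i, j) x ^ k)"
    unfolding eq by (intro integrable_divide indep_var_integrable[OF ind ak] d_power_mean(1)[OF e k])
  have "(\<integral>x. entry n (i, j) x ^ k \<partial>M) = (\<integral>x. a i j x ^ k * d n i j x ^ k \<partial>M) / sqrt (real (b n)) ^ k"
    unfolding eq by simp
  also have "(\<integral>x. a i j x ^ k * d n i j x ^ k \<partial>M) = (\<integral>x. a i j x ^ k \<partial>M) * profile n i j"
    using indep_var_lebesgue_integral[OF ind ak d_power_mean(1)[OF e k]] d_power_mean(2)[OF e k] by simp
  finally show "(\<integral>x. entry n (i, j) x ^ k \<partial>M) = (\<integral>x. a i j x ^ k \<partial>M) * profile n i j / sqrt (real (b n)) ^ k" .
qed

lemma perc_G_eq: "perc_G a b d n z i j x = cfg_G n z (\<lambda>e. entry n e x) i j"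
  unfolding perc_G_eq_cfg_G by (simp add: entry_def case_prod_unfold)

text \<open>
  The integral of a function that is not integrable is $0$ by convention; hence the positive value of the sixth moment
  implies that it exists, and with it all lower moments.
\<close>

lemma band_matrix_instance:
  assumes odd: "\<And>i p l. l \<in> {0, 1, 2::nat} \<Longrightarrow> (\<integral>x. a i p x ^ (2 * l + 1) \<partial>M) = 0"
    and m4: "\<And>i p. (\<integral>x. a i p x ^ 4 \<partial>M) = 3 * v ^ 4"
    and m6: "\<And>i p. (\<integral>x. a i p x ^ 6 \<partial>M) = 15 * v ^ 6"
    and z: "1 \<le> \<bar>Im z\<bar>"
  shows "band_matrix M n z v (real (b n)) (profile n) (entry n)"
proof unfold_locales
  have sqrt_b: "sqrt (real (b n)) ^ 2 = real (b n)" "sqrt (real (b n)) ^ 4 = real (b n) ^ 2" "sqrt (real (b n)) ^ 6 = real (b n) ^ 3"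
    using power_mult[of "sqrt (real (b n))" 2 2] power_mult[of "sqrt (real (b n))" 2 3] by simp_all
  have a6: "integrable M (\<lambda>x. a i j x ^ 6)" for i j
    using m6[of i j] v_pos not_integrable_integral_eq[of M "\<lambda>x. a i j x ^ 6"] by fastforce
  have a_int: "integrable M (\<lambda>x. a i j x ^ k)" if "(i, j) \<in> upper_pairs_upto n" "k \<le> 6" for i j k
    by (rule integrable_power_le(2)[OF indep_var_rv1[OF entry_factors_indep[OF that(1)]] a6 _ that(2)]) simp
  show "1 \<le> real (b n)" using b_pos[of n] by simp
  show "1 \<le> \<bar>Im z\<bar>" by (rule z)
  show "0 \<le> profile n i j" "profile n i j \<le> 1" for i j using \<psi>_range by (auto simp: profile_def)
  show "profile n i j = profile n j i" for i j
  proof -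
    have "real_of_int (i - j) / real (b n) = - (real_of_int (j - i) / real (b n))"
      by (simp add: minus_divide_left)
    thus ?thesis unfolding profile_def by (simp only: \<psi>_even)
  qed
  show "(\<Sum>p\<in>indices n. profile n i p) / real (b n) \<le> 1 + 1 / real (b n)" if "i \<in> indices n" for i
    by (rule profile_row[OF that])
  show "indep_vars (\<lambda>_. borel) (entry n) (upper_pairs_upto n)" by (rule entry_indep)
  fix i j assume e: "(i, j) \<in> upper_pairs_upto n"
  note mom = entry_moment[OF e _ a_int[OF e]]
  show "integrable M (\<lambda>x. entry n (i, j) x ^ 6)" by (rule mom(1)) auto
  show "(\<integral>x. entry n (i, j) x \<partial>M) = 0" using mom(2)[of 1] a_mean[of i j] by simp
  show "(\<integral>x. entry n (i, j) x ^ 2 \<partial>M) = v\<^sup>2 * profile n i j / real (b n)"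
    using mom(2)[of 2] a_second_moment[of i j] by (simp add: sqrt_b)
  show "(\<integral>x. entry n (i, j) x ^ 3 \<partial>M) = 0" using mom(2)[of 3] odd[of 1 i j] by (simp add: numeral_3_eq_3)
  show "(\<integral>x. entry n (i, j) x ^ 4 \<partial>M) = 3 * v ^ 4 * profile n i j / (real (b n))\<^sup>2"
    using mom(2)[of 4] m4[of i j] by (simp add: sqrt_b)
  show "(\<integral>x. entry n (i, j) x ^ 6 \<partial>M) = 15 * v ^ 6 * profile n i j / real (b n) ^ 3"
    using mom(2)[of 6] m6[of i j] by (simp add: sqrt_b)
qed

end

theorem theorem5p2:
  fixes M :: "'w measure"
    and v \<eta> :: real
    and a :: "int \<Rightarrow> int \<Rightarrow> 'w \<Rightarrow> real"
    and \<psi> :: "real \<Rightarrow> real"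
    and b :: "nat \<Rightarrow> nat"
    and d :: "nat \<Rightarrow> int \<Rightarrow> int \<Rightarrow> 'w \<Rightarrow> real"
  assumes model: "long_range_percolation M v a \<psi> b d"
    and odd_moments: "\<And>i p l. l \<in> {0, 1, 2::nat} \<Longrightarrow> (\<integral>\<omega>. a i p \<omega> ^ (2 * l + 1) \<partial>M) = 0"
    and moment2: "\<And>i p. (\<integral>\<omega>. a i p \<omega> ^ 2 \<partial>M) = v ^ 2"
    and moment4: "\<And>i p. (\<integral>\<omega>. a i p \<omega> ^ 4 \<partial>M) = 3 * v ^ 4"
    and moment6: "\<And>i p. (\<integral>\<omega>. a i p \<omega> ^ 6 \<partial>M) = 15 * v ^ 6"
    and moment10: "(SUP (i, p). \<integral>\<^sup>+\<omega>. ennreal (\<bar>a i p \<omega>\<bar> ^ 10) \<partial>M) < \<infinity>"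
    and sqrt_psi: "integrable lborel (\<lambda>t. sqrt (\<psi> t))"
    and eta: "\<eta> = 2 * v + 1"
  shows "\<forall>z\<in>{z. \<bar>Im z\<bar> \<ge> \<eta>}.
      (\<lambda>n. SUP i\<in>{- int n..int n}.
          cmod (\<integral>\<omega>. centred M (perc_g a b d n z) \<omega> * centred M (perc_G a b d n z i i) \<omega> \<partial>M))
        \<in> O(\<lambda>n. 1 / (real n * real (b n))
               + 1 / real (b n) * sqrt (cvariance M (perc_g a b d n z)))
    \<and> (\<lambda>n. cvariance M (perc_g a b d n z)) \<in> O(\<lambda>n. 1 / (real (b n))\<^sup>2)"
proof
  interpret long_range_percolation M v a \<psi> b d by (rule model)
  fix z :: complex assume "z \<in> {z. \<bar>Im z\<bar> \<ge> \<eta>}"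
  hence y: "2 * v + 1 \<le> \<bar>Im z\<bar>" using eta by simp
  have z1: "1 \<le> \<bar>Im z\<bar>" using y v_pos by linarith
  let ?C = "covariance_const v z"
  let ?V = "\<lambda>n. cvariance M (perc_g a b d n z)"
  let ?R = "\<lambda>n i. cmod (\<integral>x. centred M (perc_g a b d n z) x * centred M (perc_G a b d n z i i) x \<partial>M)"
  have C: "0 \<le> ?C" by (rule covariance_const_nonneg)
  have bounds: "(\<forall>i\<in>{- int n..int n}. ?R n i \<le> ?C * (1 / (real n * real (b n)) + 1 / real (b n) * sqrt (?V n)))
      \<and> ?V n \<le> (?C + 1)\<^sup>2 * (1 / (real (b n))\<^sup>2) \<and> 0 \<le> ?V n"
    if n: "1 \<le> n" "v \<le> real (b n)" for n
  proof -
    interpret B: band_matrix M n z v "real (b n)" "profile n" "entry n"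
      by (rule band_matrix_instance[OF odd_moments moment4 moment6 z1])
    have G: "perc_G a b d n z i i = (\<lambda>x. B.G x i i)" for i
      by (rule ext) (simp add: perc_G_eq B.G_def)
    have g: "perc_g a b d n z = B.g"
      by (rule ext) (simp only: perc_g_def B.g_def G indices_def)
    have gap: "4 * v\<^sup>2 * (1 + 1 / real (b n)) + 1 \<le> (Im z)\<^sup>2"
    proof -
      have "v\<^sup>2 * (1 / real (b n)) \<le> v"
        using n v_pos b_pos[of n] by (simp add: divide_le_eq power2_eq_square)
      hence "4 * v\<^sup>2 * (1 + 1 / real (b n)) + 1 \<le> 4 * v\<^sup>2 + 4 * v + 1" by (simp add: distrib_left)
      also have "\<dots> = (2 * v + 1)\<^sup>2" by (simp add: power2_eq_square algebra_simps)
      also have "\<dots> \<le> \<bar>Im z\<bar>\<^sup>2" using y v_pos by (intro power_mono) auto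
      finally show ?thesis by simp
    qed
    have "?R n i \<le> ?C * (1 / (real n * real (b n)) + 1 / real (b n) * sqrt (?V n))" if i: "i \<in> {- int n..int n}" for i
    proof -
      have "?R n i \<le> ?C * (1 / (B.N * real (b n)) + sqrt (?V n) / real (b n))"
        unfolding g G using i by (intro B.trace_covariance_g[OF gap]) (simp add: indices_def)
      also have "\<dots> \<le> ?C * (1 / (real n * real (b n)) + 1 / real (b n) * sqrt (?V n))"
        using C n b_pos[of n] by (intro mult_left_mono add_mono divide_left_mono mult_right_mono) auto
      finally show ?thesis .
    qed
    moreover have "?V n \<le> (?C + 1)\<^sup>2 * (1 / (real (b n))\<^sup>2)"
      using B.trace_variance_g[OF gap] b_bounds[of n] unfolding g by (simp add: power_divide)
    moreover have "0 \<le> ?V n" unfolding g by (rule B.cvariance_nonneg)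
    ultimately show ?thesis by blast
  qed
  \<comment> \<open>Then $v^2/b \<le> v$, and hence $4v^2(1+1/b) + 1 \<le> (2v+1)^2$.\<close>
  have large: "\<forall>\<^sub>F n in sequentially. nat \<lceil>v\<rceil> \<le> b n"
    using b_at_top unfolding filterlim_at_top by (rule spec)
  hence ev: "\<forall>\<^sub>F n in sequentially. 1 \<le> n \<and> v \<le> real (b n)"
    using large eventually_ge_at_top[of 1] by eventually_elim (auto simp: nat_le_iff ceiling_le_iff)
  show "(\<lambda>n. SUP i\<in>{- int n..int n}. ?R n i) \<in> O(\<lambda>n. 1 / (real n * real (b n)) + 1 / real (b n) * sqrt (?V n))
    \<and> ?V \<in> O(\<lambda>n. 1 / (real (b n))\<^sup>2)"
  proof
    show "(\<lambda>n. SUP i\<in>{- int n..int n}. ?R n i) \<in> O(\<lambda>n. 1 / (real n * real (b n)) + 1 / real (b n) * sqrt (?V n))"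
    proof (rule bigoI[of _ ?C], use ev in eventually_elim)
      fix n assume n: "1 \<le> n \<and> v \<le> real (b n)"
      have "(SUP i\<in>{- int n..int n}. ?R n i) = Max (?R n ` {- int n..int n})"
        by (rule cSup_eq_Max) auto
      also have "\<dots> \<in> ?R n ` {- int n..int n}" by (rule Max_in) auto
      finally obtain i where i: "i \<in> {- int n..int n}" and eq: "(SUP i\<in>{- int n..int n}. ?R n i) = ?R n i"
        by auto
      have "0 \<le> 1 / (real n * real (b n)) + 1 / real (b n) * sqrt (?V n)"
        using bounds n by simp
      thus "norm (SUP i\<in>{- int n..int n}. ?R n i) \<le> ?C * norm (1 / (real n * real (b n)) + 1 / real (b n) * sqrt (?V n))"
        unfolding eq real_norm_def using bounds n i by simp
    qed
    show "?V \<in> O(\<lambda>n. 1 / (real (b n))\<^sup>2)"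
      by (rule bigoI[of _ "(?C + 1)\<^sup>2"], use ev in eventually_elim) (use bounds in simp)
  qed
qed

end
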